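(* Let $m_1,\ldots,m_k$ be non-negative integers and $N=m_1+\cdots+m_k$. Then the $q$-multinomial coefficient $$\left[\begin{array}{c}N\\ m_1,\ldots,m_k\end{array}\right]_q=\frac{(q;q)_N}{(q;q)_{m_1}\cdots(q;q)_{m_k}}$$ and the $q^2$-multinomial coefficient $\left[\begin{array}{c}N\\ m_1,\ldots,m_k\end{array}\right]_{q^2}$ (obtained from it by replacing $q$ with $q^2$) both belong to the set $\mathcal L^+$ of PK-realizable polynomials.
   Context: $(q;q)_m=\prod_{j=1}^m(1-q^j)$. A polynomial $P(q)\in\mathbb N[q]$ with non-zero constant term is called PK-realizable if there exist a partition $\lambda$, a dominant sequence of rectangular partitions $R$, and an integer $L$ such that $P(q)=q^LK_{\lambda R}(q)$. Parabolic Kostka polynomials: for $f$ a Laurent polynomial in $x_1,\ldots,x_n$ put $\pi_n(f)=J(1)^{-1}J(f)$, $J(f)=\sum_{w\in S_n}\mathrm{sgn}(w)\,w(x^\delta f)$, $\delta=(n-1,n-2,\ldots,0)$; extend coefficientwise to power series in $q$. For a composition $\eta=(\eta_1,\ldots,\eta_p)$ of $n$ let $\Phi(\eta)$ be the set of pairs $(i,j)$ with $1\le i\le\eta_1+\cdots+\eta_u<j\le n$ for some $u$. For a partition $\mu$ with $l(\mu)\le n$, define $K_{\lambda\mu\eta}(q)$ by $$\pi_n\Bigl(x^\mu\prod_{(i,j)\in\Phi(\eta)}(1-qx_i/x_j)^{-1}\Bigr)=\sum_\lambda K_{\lambda\mu\eta}(q)\,s_\lambda(x_1,\ldots,x_n),$$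 where factors are expanded as power series in $q$, $\lambda$ runs over weakly decreasing sequences in $\mathbb Z^n$, and $s_\lambda=\pi_n(x^\lambda)$. A dominant sequence of rectangular partitions is $R=(R_1,\ldots,R_p)$, $R_a=(\mu_a^{\eta_a})$ ($\eta_a$ rows of length $\mu_a$), with $\mu_1\ge\cdots\ge\mu_p$. Put $\eta(R)=(\eta_1,\ldots,\eta_p)$, $n=\sum\eta_a$, let $\mu(R)$ be the concatenation of the parts of $R_1,\ldots,R_p$, and define $K_{\lambda R}(q)=K_{\lambda\,\mu(R)\,\eta(R)}(q)$ (zero if $l(\lambda)>n$, where $l(\lambda)$ is the number of nonzero parts). *)

theory Defs
  imports
    "HOL-Computational_Algebra.Computational_Algebra"
    "HOL-Library.Poly_Mapping"
    "HOL-Combinatorics.Permutations"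
begin

section \<open>Laurent polynomials and the operator \<open>\<pi>\<^sub>n\<close>\<close>

text \<open>
  The variables are numbered from \<open>0\<close>: \<open>x\<^sub>0, \<dots>, x\<^sub>n\<^sub>-\<^sub>1\<close> play the role of
  \<open>x\<^sub>1, \<dots>, x\<^sub>n\<close>. A \<open>weight\<close> is an exponent vector (finitely supported, integer
  entries); a Laurent polynomial is a finitely supported family of integer coefficients
  indexed by weights, and the product of the type \<open>laurent\<close> is the convolution product.
\<close>

type_synonym weight = "nat \<Rightarrow>\<^sub>0 int"
type_synonym laurent = "weight \<Rightarrow>\<^sub>0 int"

definition xmon :: "weight \<Rightarrow> laurent" where
  "xmon \<gamma> = Poly_Mapping.single \<gamma> 1"

definition weight_of :: "nat list \<Rightarrow> weight" where
  "weight_of xs = Poly_Mapping.nth (map int xs)"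

definition delta :: "nat \<Rightarrow> weight" where
  "delta n = weight_of (rev [0..<n])"

text \<open>
  The substitution \<open>x\<^sub>i \<mapsto> x\<^sub>w\<^sub>(\<^sub>i\<^sub>)\<close>. It sends \<open>x\<^sup>\<gamma>\<close> to the monomial in which the
  exponent of \<open>x\<^sub>j\<close> is \<open>\<gamma>\<close> at \<open>w\<^sup>-\<^sup>1(j)\<close>.
\<close>

definition perm_act :: "(nat \<Rightarrow> nat) \<Rightarrow> laurent \<Rightarrow> laurent" where
  "perm_act w f =
     (\<Sum>\<gamma>\<in>Poly_Mapping.keys f.
        Poly_Mapping.single (Poly_Mapping.map_key (inv w) \<gamma>) (Poly_Mapping.lookup f \<gamma>))"

definition alternant :: "nat \<Rightarrow> laurent \<Rightarrow> laurent" where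
  "alternant n f =
     (\<Sum>w | w permutes {..<n}. of_int (sign w) * perm_act w (xmon (delta n) * f))"

text \<open>
  \<open>J(1)\<^sup>-\<^sup>1 J(f)\<close> is the quotient in the ring of Laurent polynomials (an integral domain in
  which the Vandermonde determinant \<open>J(1)\<close> divides every \<open>J(f)\<close>).
\<close>

definition pi_op :: "nat \<Rightarrow> laurent \<Rightarrow> laurent" where
  "pi_op n f = (THE g. alternant n 1 * g = alternant n f)"

definition dominant_weights :: "nat \<Rightarrow> weight set" where
  "dominant_weights n =
     {\<gamma>. Poly_Mapping.keys \<gamma> \<subseteq> {..<n} \<and>
         (\<forall>i j. i \<le> j \<and> j < n \<longrightarrow> Poly_Mapping.lookup \<gamma> j \<le> Poly_Mapping.lookup \<gamma> i)}"

definition schur :: "nat \<Rightarrow> weight \<Rightarrow> laurent" where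
  "schur n \<gamma> = pi_op n (xmon \<gamma>)"

text \<open>The coefficient family of \<open>g\<close> in the basis of the \<open>s\<^sub>\<lambda>\<close>, \<open>\<lambda>\<close> dominant.\<close>

definition schur_expansion :: "nat \<Rightarrow> laurent \<Rightarrow> (weight \<Rightarrow>\<^sub>0 int)" where
  "schur_expansion n g =
     (THE c. Poly_Mapping.keys c \<subseteq> dominant_weights n \<and>
             g = (\<Sum>\<gamma>\<in>Poly_Mapping.keys c. of_int (Poly_Mapping.lookup c \<gamma>) * schur n \<gamma>))"


section \<open>Parabolic Kostka polynomials\<close>

text \<open>
  With indices starting at \<open>0\<close>, the condition \<open>i \<le> s < j\<close> on \<open>s = \<eta>\<^sub>1 + \<dots> + \<eta>\<^sub>u\<close>
  becomes \<open>i < s \<le> j\<close>.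
\<close>

definition Phi :: "nat list \<Rightarrow> (nat \<times> nat) set" where
  "Phi \<eta> = {(i, j). j < sum_list \<eta> \<and>
             (\<exists>u \<le> length \<eta>. i < sum_list (take u \<eta>) \<and> sum_list (take u \<eta>) \<le> j)}"

text \<open>\<open>(1 - q x\<^sub>i / x\<^sub>j)\<^sup>-\<^sup>1\<close> as a power series in \<open>q\<close> over the Laurent polynomials.\<close>

definition geom_factor :: "nat \<Rightarrow> nat \<Rightarrow> laurent fps" where
  "geom_factor i j =
     Abs_fps (\<lambda>d. xmon (Poly_Mapping.single i 1 - Poly_Mapping.single j 1) ^ d)"

definition kostka_gen :: "weight \<Rightarrow> nat list \<Rightarrow> laurent fps" where
  "kostka_gen \<mu> \<eta> = fps_const (xmon \<mu>) * (\<Prod>(i, j)\<in>Phi \<eta>. geom_factor i j)"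

text \<open>
  \<open>K\<^sub>\<lambda>\<^sub>\<mu>\<^sub>\<eta>(q)\<close>, as a power series in \<open>q\<close>; \<open>\<pi>\<^sub>n\<close> is applied to each
  coefficient of the generating series, with \<open>n\<close> the sum of the composition \<open>\<eta>\<close>.
\<close>

definition parabolic_kostka :: "weight \<Rightarrow> weight \<Rightarrow> nat list \<Rightarrow> int fps" where
  "parabolic_kostka \<gamma> \<mu> \<eta> =
     (let n = sum_list \<eta> in
      Abs_fps (\<lambda>d. Poly_Mapping.lookup
                     (schur_expansion n (pi_op n (fps_nth (kostka_gen \<mu> \<eta>) d))) \<gamma>))"

text \<open>A partition is the list of its (positive) parts, so \<open>length\<close> is \<open>l(\<lambda>)\<close>.\<close>

definition is_partition :: "nat list \<Rightarrow> bool" where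
  "is_partition xs \<longleftrightarrow> sorted_wrt (\<ge>) xs \<and> (\<forall>x\<in>set xs. 0 < x)"

text \<open>
  A pair \<open>(m, h)\<close> stands for the rectangular partition \<open>(m\<^sup>h)\<close>, with \<open>h\<close> rows of length
  \<open>m\<close>.
\<close>

definition dominant_rects :: "(nat \<times> nat) list \<Rightarrow> bool" where
  "dominant_rects R \<longleftrightarrow>
     (\<forall>(m, h)\<in>set R. 0 < m \<and> 0 < h) \<and> sorted_wrt (\<ge>) (map fst R)"

definition rects_eta :: "(nat \<times> nat) list \<Rightarrow> nat list" where
  "rects_eta R = map snd R"

definition rects_mu :: "(nat \<times> nat) list \<Rightarrow> nat list" where
  "rects_mu R = concat (map (\<lambda>(m, h). replicate h m) R)"

definition kostka_rects :: "nat list \<Rightarrow> (nat \<times> nat) list \<Rightarrow> int fps" where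
  "kostka_rects xs R =
     (if length xs \<le> sum_list (rects_eta R)
      then parabolic_kostka (weight_of xs) (weight_of (rects_mu R)) (rects_eta R)
      else 0)"

text \<open>
  The set \<open>\<L>\<^sup>+\<close>. As \<open>L\<close> may be negative, \<open>P(q) = q\<^sup>L K(q)\<close> is an identity of formal
  Laurent series.
\<close>

definition PK_realizable :: "int poly set" where
  "PK_realizable =
     {P. (\<forall>i. 0 \<le> coeff P i) \<and> coeff P 0 \<noteq> 0 \<and>
         (\<exists>xs R L. is_partition xs \<and> dominant_rects R \<and>
            fps_to_fls (fps_of_poly P) = fls_X_intpow L * fps_to_fls (kostka_rects xs R))}"


section \<open>\<open>q\<close>-multinomial coefficients\<close>

definition q_poch :: "nat \<Rightarrow> int poly" where
  "q_poch m = (\<Prod>j=1..m. 1 - monom 1 j)"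

text \<open>The division is exact, see \<open>q_multinomial_mult\<close> below.\<close>

definition q_multinomial :: "nat list \<Rightarrow> int poly" where
  "q_multinomial ms = q_poch (sum_list ms) div (\<Prod>m\<leftarrow>ms. q_poch m)"

lemma q_poch_0 [simp]: "q_poch 0 = 1"
  by (simp add: q_poch_def)

lemma q_poch_Suc: "q_poch (Suc m) = q_poch m * (1 - monom 1 (Suc m))"
  by (simp add: q_poch_def)

lemma q_poch_nonzero: "q_poch m \<noteq> 0"
proof -
  have "poly (q_poch m) 0 = 1"
    by (induction m) (simp_all add: q_poch_Suc poly_monom)
  then show ?thesis by auto
qed

lemma q_poch_dvd: "q_poch a * q_poch b dvd q_poch (a + b)"
proof (induction "a + b" arbitrary: a b)
  case 0
  then show ?case by simp
next
  case (Suc s)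
  show ?case
  proof (cases "a = 0 \<or> b = 0")
    case True
    then show ?thesis by auto
  next
    case False
    then obtain a' b' where ab: "a = Suc a'" "b = Suc b'"
      by (metis not0_implies_Suc)
    have "q_poch a' * q_poch b dvd q_poch (a' + b)"
      using Suc ab by (intro Suc.hyps(1)) auto
    then have 1: "q_poch a * q_poch b dvd q_poch (a' + b) * (1 - monom 1 a)"
      unfolding ab(1) q_poch_Suc by (auto elim!: dvdE simp: ac_simps)
    have "q_poch a * q_poch b' dvd q_poch (a + b')"
      using Suc ab by (intro Suc.hyps(1)) auto
    then have 2: "q_poch a * q_poch b dvd q_poch (a + b') * (1 - monom 1 b)"
      unfolding ab(2) q_poch_Suc by (auto elim!: dvdE simp: ac_simps)
    have e: "a' + b = a + b'" "a + b = Suc (a + b')"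
      by (simp_all add: ab)
    have m: "(monom 1 (Suc (a + b')) :: int poly) = monom 1 a * monom 1 b"
      by (simp add: mult_monom ab)
    have "q_poch (a + b) =
        q_poch (a' + b) * (1 - monom 1 a) + monom 1 a * (q_poch (a + b') * (1 - monom 1 b))"
      unfolding e q_poch_Suc m by (simp add: algebra_simps)
    with 1 2 show ?thesis by (metis dvd_add dvd_mult)
  qed
qed

lemma q_multinomial_mult: "q_multinomial ms * (\<Prod>m\<leftarrow>ms. q_poch m) = q_poch (sum_list ms)"
proof -
  have "(\<Prod>m\<leftarrow>ms. q_poch m) dvd q_poch (sum_list ms)"
  proof (induction ms)
    case (Cons m ms)
    then have "q_poch m * (\<Prod>m\<leftarrow>ms. q_poch m) dvd q_poch m * q_poch (sum_list ms)"
      by (simp add: mult_dvd_mono)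
    also have "\<dots> dvd q_poch (m + sum_list ms)"
      by (rule q_poch_dvd)
    finally show ?case by simp
  qed simp
  then show ?thesis
    by (simp only: q_multinomial_def dvd_div_mult_self)
qed

definition subst_q_squared :: "int poly \<Rightarrow> int poly" where
  "subst_q_squared P = pcompose P (monom 1 2)"

end

theory Submission
  imports Defs "Jordan_Normal_Form.Determinant"
begin

text \<open>
  A \<open>q\<close>-multinomial coefficient is a product of Gaussian binomial coefficients
  (\<open>q_multinomial_Cons\<close>), so it suffices to realize these and their images under
  \<open>q \<mapsto> q\<^sup>2\<close>, and to show that products of realizable polynomials are realizable.

  Both parts rest on a formula for \<open>K\<close> as a signed sum of constant terms
  (\<open>parabolic_kostka_eq_weyl_sum\<close>): with \<open>\<kappa> = \<lambda> + \<delta>\<close> and \<open>\<nu> = \<mu> + \<delta>\<close>, it is the sum over all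
  permutations \<open>w\<close> of \<open>sgn w\<close> times the constant term of
  \<open>(\<Prod>i. x\<^sub>i ^ \<nu>\<^sub>i) * (\<Prod>i. x\<^sub>w\<^sub>i ^ (- \<kappa>\<^sub>i)) * (\<Prod>(i, j)\<in>\<Phi>. 1 / (1 - q x\<^sub>i / x\<^sub>j))\<close>.
  It follows from two facts on alternants: \<open>J(1)\<close> divides \<open>J(f)\<close>, and \<open>J(f)\<close> is a combination
  of alternants \<open>J(x\<^sup>\<lambda>)\<close>, in which the coefficient of \<open>J(x\<^sup>\<lambda>)\<close> is the coefficient of
  \<open>x\<^sup>\<kappa>\<close> in \<open>J(f)\<close>.

  The product over \<open>\<Phi>\<close> only involves monomials whose degree in the first \<open>a\<close> variables is
  nonnegative. If \<open>\<kappa>\<close> has a large gap after its first \<open>a\<close> entries, then a permutation \<open>w\<close> that does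
  not preserve the set of the first \<open>a\<close> indices leads to positive degrees only, and the constant
  term vanishes (\<open>ct_eq_0_unless_stabilizing\<close>): only block permutations remain. If moreover \<open>\<kappa>\<close>
  and \<open>\<nu>\<close> have equal sums over the first \<open>a\<close> entries, then the factors for pairs \<open>(i, j)\<close> that
  cross from the first group to the second may be replaced by 1, and the expression
  becomes a product (\<open>weyl_sum_product\<close>). Hence raising one pair \<open>(\<lambda>, R)\<close> by a large constant and
  appending a second pair realizes the product (\<open>kostka_realizable_mult\<close>).

  For the Gaussian coefficient of \<open>k\<close> and \<open>n\<close>, take three rectangles with \<open>n\<close> rows and very
  different widths, and let \<open>\<lambda> - \<mu>\<close> be \<open>k\<close> on the rows of the first, 0 on the second and
  \<open>- k\<close> on the third. For the image of the coefficient of \<open>m\<close> and \<open>n\<close> under \<open>q \<mapsto> q\<^sup>2\<close>, take two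
  pairs of equal rectangles with \<open>n\<close> rows, and let \<open>\<lambda> - \<mu>\<close> be \<open>m\<close> on the first pair and
  \<open>- m\<close> on the second. Once the groups are separated, the constant term contains for each
  group an alternant in the inverse variables, which comes from the signed sum over its permutations,
  and the factor \<open>x\<^sup>\<delta>\<close>, which may be antisymmetrized. Cauchy's determinant absorbs two
  alternants and turns the product of \<open>1 / (1 - q x\<^sub>i / y\<^sub>j)\<close> over all pairs of variables of two
  blocks into a signed sum over perfect matchings (\<open>cauchy_determinant\<close>, \<open>ct_block_cauchy\<close>).
  What is left is the constant term of a product over the edges of a sparse graph, and it
  enumerates the flows with given sources and sinks by their size (\<open>ct_prod_geo\<close>). The signs
  cancel all flows but those with pairwise distinct values along one block (\<open>sum_sign_fixing\<close>,
  \<open>sum_signed_matches_square\<close>). These values form a subset \<open>S\<close> of \<open>n\<close> elements of an interval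
  \<open>{0, \<dots>, k + n - 1}\<close>, and \<open>S\<close> is counted with weight \<open>q\<close>, respectively \<open>q\<^sup>2\<close>, to the power
  \<open>\<Sum>S\<close>. The sum over all \<open>S\<close> is the Gaussian coefficient up to a power of \<open>q\<close>
  (\<open>subset_poly_eq_gaussian\<close>).
\<close>

section \<open>Alternants and the Cauchy determinant\<close>

text \<open>
  The alternant \<open>det (z\<^sub>l ^ e\<^sub>i)\<close>. The ring is arbitrary because \<open>z\<close> will stand for variables as
  well as for their inverses.
\<close>

definition alt_sum :: "nat \<Rightarrow> (nat \<Rightarrow> 'a::comm_ring_1) \<Rightarrow> (nat \<Rightarrow> nat) \<Rightarrow> 'a" where
  "alt_sum n z e = (\<Sum>p | p permutes {..<n}. of_int (sign p) * (\<Prod>i<n. z (p i) ^ e i))"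

abbreviation vandermonde :: "nat \<Rightarrow> (nat \<Rightarrow> 'a::comm_ring_1) \<Rightarrow> 'a" where
  "vandermonde n z \<equiv> alt_sum n z (\<lambda>i. i)"

text \<open>
  The series \<open>1 / (1 - u q)\<close>.
\<close>

definition geo :: "'a::comm_ring_1 \<Rightarrow> 'a fps" where
  "geo u = Abs_fps (\<lambda>d. u ^ d)"

lemma geo_nth [simp]: "geo u $ d = u ^ d"
  by (simp add: geo_def)

lemma fps_linear_mult_nth:
  fixes F :: "'a::comm_ring_1 fps"
  shows "((1 - fps_const u * fps_X) * F) $ d = F $ d - (if d = 0 then 0 else u * F $ (d - 1))"
proof -
  have "(1 - fps_const u * fps_X) * F = F - fps_const u * (fps_X * F)"
    by (simp add: algebra_simps)
  then show ?thesis by simp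
qed

lemma geo_inverse: "(1 - fps_const u * fps_X) * geo u = 1"
proof (rule fps_ext)
  fix d show "((1 - fps_const u * fps_X) * geo u) $ d = 1 $ d"
    unfolding fps_linear_mult_nth by (cases d) auto
qed

text \<open>
  The longest element of the symmetric group on \<open>{..<n}\<close>, extended by the identity.
\<close>

definition mirror :: "nat \<Rightarrow> nat \<Rightarrow> nat" where
  "mirror n i = (if i < n then n - 1 - i else i)"

lemma mirror_permutes [simp]: "mirror n permutes {..<n}"
proof (rule bij_imp_permutes)
  show "bij_betw (mirror n) {..<n} {..<n}"
    by (rule bij_betw_byWitness[of _ "mirror n"]) (auto simp: mirror_def)
qed (auto simp: mirror_def)

lemma mirror_mirror [simp]: "mirror n (mirror n i) = i"
  by (auto simp: mirror_def)

lemma sign_conj: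
  assumes "finite S" "p permutes S" "r permutes S"
  shows "sign (r \<circ> p \<circ> r) = sign p"
proof -
  have "permutation p" "permutation r" using assms permutation_permutes by blast+
  then show ?thesis
    by (simp add: sign_compose permutation_compose mult.commute)
qed

lemma sum_permutes_mirror:
  "(\<Sum>p | p permutes {..<n}. f p) = (\<Sum>p | p permutes {..<n}. f (mirror n \<circ> p \<circ> mirror n))"
  by (rule sum.reindex_bij_witness[of _ "\<lambda>p. mirror n \<circ> p \<circ> mirror n" "\<lambda>p. mirror n \<circ> p \<circ> mirror n"])
     (auto simp: fun_eq_iff intro!: permutes_compose arg_cong[where f = f])

lemma prod_mirror: "(\<Prod>i<n. f (mirror n i)) = (\<Prod>i<n. f i)"
  using prod.permute[OF mirror_permutes, of f n] by (simp add: o_def)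

lemma alt_sum_decreasing:
  "alt_sum n z (\<lambda>i. n - 1 - i) = vandermonde n (\<lambda>i. z (mirror n i))"
  unfolding alt_sum_def
proof (subst sum_permutes_mirror, rule sum.cong[OF refl])
  fix p assume p: "p \<in> {p. p permutes {..<n}}"
  have "(\<Prod>i<n. z ((mirror n \<circ> p \<circ> mirror n) i) ^ (n - 1 - i))
      = (\<Prod>i<n. (\<lambda>i. z (mirror n (p i)) ^ (n - 1 - mirror n i)) (mirror n i))"
    by simp
  also have "\<dots> = (\<Prod>i<n. z (mirror n (p i)) ^ i)"
    by (subst prod_mirror, rule prod.cong) (auto simp: mirror_def)
  finally show "of_int (sign (mirror n \<circ> p \<circ> mirror n)) * (\<Prod>i<n. z ((mirror n \<circ> p \<circ> mirror n) i) ^ (n - 1 - i))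
      = of_int (sign p) * (\<Prod>i<n. z (mirror n (p i)) ^ i)"
    using p sign_conj[of "{..<n}" p "mirror n"] by simp
qed

lemma alt_sum_decreasing_sign:
  "alt_sum n z (\<lambda>i. n - 1 - i) = of_int (sign (mirror n)) * vandermonde n z"
proof -
  have pr: "permutation (mirror n)" using mirror_permutes permutation_permutes by blast
  have "alt_sum n z (\<lambda>i. n - 1 - i) =
    (\<Sum>p | p permutes {..<n}. of_int (sign (p \<circ> mirror n)) * (\<Prod>i<n. z ((p \<circ> mirror n) i) ^ (n - 1 - i)))"
    unfolding alt_sum_def
    by (rule sum_permutations_compose_right[OF mirror_permutes])
  also have "\<dots> = (\<Sum>p | p permutes {..<n}. of_int (sign (mirror n)) * (of_int (sign p) * (\<Prod>i<n. z (p i) ^ i)))"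
  proof (rule sum.cong[OF refl])
    fix p assume "p \<in> {p. p permutes {..<n}}"
    then have pp: "permutation p" using permutation_permutes by blast
    have "(\<Prod>i<n. z ((p \<circ> mirror n) i) ^ (n - 1 - i)) = (\<Prod>i<n. (\<lambda>i. z (p i) ^ (n - 1 - mirror n i)) (mirror n i))"
      by simp
    also have "\<dots> = (\<Prod>i<n. z (p i) ^ i)"
      by (subst prod_mirror, rule prod.cong) (auto simp: mirror_def)
    finally show "of_int (sign (p \<circ> mirror n)) * (\<Prod>i<n. z ((p \<circ> mirror n) i) ^ (n - 1 - i)) =
         of_int (sign (mirror n)) * (of_int (sign p) * (\<Prod>i<n. z (p i) ^ i))"
      by (simp add: sign_compose[OF pp pr] mult_ac)
  qed
  finally show ?thesis by (simp add: alt_sum_def sum_distrib_left)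
qed

text \<open>
  The factor \<open>z ^ (n - 1 - i)\<close> is \<open>z ^ (n - 1)\<close> times a power of the inverse, and the product of the
  \<open>z ^ (n - 1)\<close> is invariant under permutations.
\<close>

lemma alt_sum_inverse:
  assumes "\<And>i. i < n \<Longrightarrow> z i * z' i = 1"
  shows "alt_sum n z (\<lambda>i. n - 1 - i) = (\<Prod>i<n. z i) ^ (n - 1) * vandermonde n z'"
proof -
  have *: "(\<Prod>i<n. z (p i) ^ (n - 1 - i)) = (\<Prod>i<n. z i) ^ (n - 1) * (\<Prod>i<n. z' (p i) ^ i)"
    if p: "p permutes {..<n}" for p
  proof -
    have "(\<Prod>i<n. z i) = (\<Prod>i<n. z (p i))"
      using prod.permute[OF p, of z] by (simp add: o_def)
    then have "(\<Prod>i<n. z i) ^ (n - 1) * (\<Prod>i<n. z' (p i) ^ i) = (\<Prod>i<n. z (p i) ^ (n - 1) * z' (p i) ^ i)"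
      by (simp add: prod_power_distrib prod.distrib)
    also have "\<dots> = (\<Prod>i<n. z (p i) ^ (n - 1 - i))"
    proof (rule prod.cong[OF refl])
      fix i assume i: "i \<in> {..<n}"
      then have "p i < n" using permutes_in_image[OF p] by auto
      have "z (p i) ^ (n - 1) = z (p i) ^ (n - 1 - i) * z (p i) ^ i"
        using i by (simp flip: power_add)
      then show "z (p i) ^ (n - 1) * z' (p i) ^ i = z (p i) ^ (n - 1 - i)"
        using assms[OF \<open>p i < n\<close>] by (simp add: mult.assoc flip: power_mult_distrib)
    qed
    finally show ?thesis by simp
  qed
  show ?thesis
    unfolding alt_sum_def sum_distrib_left
  proof (rule sum.cong[OF refl])
    fix p assume "p \<in> {p. p permutes {..<n}}"
    then have p: "p permutes {..<n}" by simp
    show "of_int (sign p) * (\<Prod>i<n. z (p i) ^ (n - 1 - i)) =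
        (\<Prod>i<n. z i) ^ (n - 1) * (of_int (sign p) * (\<Prod>i<n. z' (p i) ^ i))"
      unfolding *[OF p] by (rule mult.left_commute)
  qed
qed

text \<open>
  Up to sign, its coefficients are the elementary symmetric polynomials of all \<open>y\<^sub>i\<close> but \<open>y\<^sub>l\<close>.
\<close>

definition omit_poly :: "nat \<Rightarrow> (nat \<Rightarrow> 'a::comm_ring_1) \<Rightarrow> nat \<Rightarrow> 'a fps" where
  "omit_poly n y l = (\<Prod>i\<in>{..<n} - {l}. 1 - fps_const (y i) * fps_X)"

lemma prod_linear_nth_eq_0:
  fixes y :: "nat \<Rightarrow> 'a::comm_ring_1"
  assumes "finite S" "card S < d"
  shows "(\<Prod>i\<in>S. 1 - fps_const (y i) * fps_X) $ d = 0"
  using assms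
proof (induction S arbitrary: d rule: finite_induct)
  case (insert s S)
  then show ?case
    by (simp add: fps_linear_mult_nth)
qed simp

lemma prod_linear_scale_nth:
  fixes y :: "nat \<Rightarrow> 'a::comm_ring_1"
  assumes "finite S"
  shows "(\<Prod>i\<in>S. 1 - fps_const (c * y i) * fps_X) $ d = c ^ d * (\<Prod>i\<in>S. 1 - fps_const (y i) * fps_X) $ d"
  using assms
proof (induction S arbitrary: d rule: finite_induct)
  case (insert s S)
  show ?case
    unfolding prod.insert[OF insert.hyps(1,2)] fps_linear_mult_nth insert.IH
    by (cases d) (simp_all add: right_diff_distrib mult_ac del: fps_mult_nth)
qed auto

lemma omit_poly_nth_eq_0: "l < n \<Longrightarrow> n \<le> d \<Longrightarrow> omit_poly n y l $ d = 0"
  unfolding omit_poly_def by (rule prod_linear_nth_eq_0) auto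

lemma omit_poly_mult:
  assumes "l < n"
  shows "omit_poly n y l * (\<Prod>i<n. geo (y i)) = geo (y l)"
proof -
  have "(\<Prod>i<n. geo (y i)) = geo (y l) * (\<Prod>i\<in>{..<n} - {l}. geo (y i))"
    using assms by (subst prod.remove[of _ l]) auto
  then have "omit_poly n y l * (\<Prod>i<n. geo (y i)) =
     geo (y l) * (\<Prod>i\<in>{..<n} - {l}. (1 - fps_const (y i) * fps_X) * geo (y i))"
    by (simp add: omit_poly_def prod.distrib mult_ac)
  then show ?thesis by (simp add: geo_inverse)
qed

text \<open>
  The coefficient of degree \<open>a\<close> of the identity \<open>omit_poly_mult\<close>.
\<close>

lemma power_eq_omit_poly:
  assumes "l < n"
  shows "y l ^ a = (\<Sum>k<n. (if k \<le> a then (\<Prod>i<n. geo (y i)) $ (a - k) else 0) * omit_poly n y l $ k)"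
proof -
  define F where "F = omit_poly n y l"
  define H where "H = (\<Prod>i<n. geo (y i))"
  have "y l ^ a = (F * H) $ a"
    using omit_poly_mult[OF assms, of y] by (simp add: F_def H_def)
  also have "\<dots> = (\<Sum>k=0..a. F $ k * H $ (a - k))"
    by (simp add: fps_mult_nth)
  also have "\<dots> = (\<Sum>k\<in>{0..a} \<union> {..<n}. if k \<le> a then F $ k * H $ (a - k) else 0)"
    by (rule sum.mono_neutral_cong_left) auto
  also have "\<dots> = (\<Sum>k<n. if k \<le> a then F $ k * H $ (a - k) else 0)"
    by (rule sum.mono_neutral_right) (auto simp: F_def omit_poly_nth_eq_0[OF assms])
  also have "\<dots> = (\<Sum>k<n. (if k \<le> a then H $ (a - k) else 0) * F $ k)"
    by (rule sum.cong) auto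
  finally show ?thesis unfolding F_def H_def .
qed

lemma prod_geo_nth_0: "(\<Prod>i\<in>S. geo (y i)) $ 0 = 1"
  by (induction S rule: infinite_finite_induct) auto

lemma alt_sum_eq_det: "alt_sum n z e = det (mat n n (\<lambda>(i, l). z l ^ e i))"
  unfolding alt_sum_def det_def
  by (auto simp: atLeast0LessThan intro!: sum.cong prod.cong dest: permutes_in_image)

text \<open>
  The matrix \<open>(y\<^sub>l ^ e\<^sub>i)\<close> is a product of a matrix of complete homogeneous symmetric polynomials,
  \<open>h(e\<^sub>i - k)\<close>, and a matrix that does not depend on \<open>e\<close>. For \<open>e\<^sub>i = i\<close> the first factor is
  unitriangular, so the determinant of the second one is the Vandermonde determinant. This gives the
  divisibility of all alternants by the Vandermonde determinant over any commutative ring, without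
  unique factorization.
\<close>

lemma alt_sum_factor:
  fixes y :: "nat \<Rightarrow> 'a::comm_ring_1" and n :: nat
  defines "h \<equiv> \<lambda>e :: nat \<Rightarrow> nat. mat n n (\<lambda>(i, k). if k \<le> e i then (\<Prod>i<n. geo (y i)) $ (e i - k) else 0)"
  defines "M \<equiv> mat n n (\<lambda>(k, l). omit_poly n y l $ k)"
  shows "alt_sum n y e = det (h e) * det M"
proof -
  have "mat n n (\<lambda>(i, l). y l ^ e i) = h e * M"
    by (rule eq_matI)
       (auto simp: h_def M_def scalar_prod_def power_eq_omit_poly[of _ n y] atLeast0LessThan intro!: sum.cong)
  then show ?thesis
    unfolding alt_sum_eq_det by (simp add: det_mult[of _ n] h_def M_def)
qed

lemma vandermonde_eq_det:
  fixes y :: "nat \<Rightarrow> 'a::comm_ring_1"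
  shows "vandermonde n y = det (mat n n (\<lambda>(k, l). omit_poly n y l $ k))"
proof -
  define h where "h = mat n n (\<lambda>(i, k). if k \<le> i then (\<Prod>i<n. geo (y i)) $ (i - k) else 0)"
  have "det h = prod_list (diag_mat h)"
    by (rule det_lower_triangular[of n]) (auto simp: h_def)
  also have "diag_mat h = map (\<lambda>_. 1) [0..<n]"
    unfolding diag_mat_def by (rule map_cong) (auto simp: h_def prod_geo_nth_0)
  also have "prod_list \<dots> = 1"
    by (induction n) auto
  finally show ?thesis
    using alt_sum_factor[of n y "\<lambda>i. i"] by (simp add: h_def)
qed

lemma vandermonde_dvd_alt_sum: "vandermonde n y dvd alt_sum n y e"
  using alt_sum_factor[of n y e] vandermonde_eq_det[of n y] by simp

lemma fps_const_sum: "fps_const (\<Sum>i\<in>S. f i) = (\<Sum>i\<in>S. fps_const (f i))"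
  by (induction S rule: infinite_finite_induct) (simp_all flip: fps_const_add)

lemma fps_const_prod:
  "fps_const (\<Prod>i\<in>S. f i :: 'a::comm_ring_1) = (\<Prod>i\<in>S. fps_const (f i))"
  by (induction S rule: infinite_finite_induct) (simp_all flip: fps_const_mult)

text \<open>
  The polynomial \<open>\<Prod>i\<noteq>j. 1 - q x\<^sub>l y\<^sub>i\<close> is obtained from \<open>omit_poly\<close> by evaluating at \<open>q x\<^sub>l\<close>. So
  the matrix of these polynomials is a product of \<open>((q x\<^sub>l) ^ k)\<close> and of the matrix of
  coefficients, whose determinant is known from \<open>vandermonde_eq_det\<close>. Dividing row \<open>l\<close> by
  \<open>\<Prod>i. 1 - q x\<^sub>l y\<^sub>i\<close> turns its entries into \<open>1 / (1 - q x\<^sub>l y\<^sub>j)\<close>.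
\<close>

lemma cauchy_determinant:
  fixes x y :: "nat \<Rightarrow> 'a::comm_ring_1"
  shows "fps_X ^ (\<Sum>i<n. i) * fps_const (vandermonde n x * vandermonde n y) * (\<Prod>i<n. \<Prod>j<n. geo (x i * y j))
    = (\<Sum>p | p permutes {..<n}. of_int (sign p) * (\<Prod>i<n. geo (x i * y (p i))))"
proof -
  define P where "P = mat n n (\<lambda>(l, k). fps_const (x l ^ k) * fps_X ^ k)"
  define Q where "Q = mat n n (\<lambda>(k, j). fps_const (omit_poly n y j $ k))"
  define N where "N = mat n n (\<lambda>(l, j). \<Prod>i\<in>{..<n} - {j}. 1 - fps_const (x l * y i) * fps_X)"
  have "N = P * Q"
  proof (rule eq_matI)
    fix l j assume "l < dim_row (P * Q)" "j < dim_col (P * Q)"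
    then have lj: "l < n" "j < n" by (auto simp: P_def Q_def)
    have "N $$ (l, j) = (\<Sum>k<n. fps_const (x l ^ k) * fps_X ^ k * fps_const (omit_poly n y j $ k))"
    proof (rule fps_ext)
      fix d
      have "(\<Sum>k<n. fps_const (x l ^ k) * fps_X ^ k * fps_const (omit_poly n y j $ k)) $ d
         = (\<Sum>k<n. if k = d then x l ^ k * omit_poly n y j $ k else 0)"
        unfolding fps_sum_nth by (rule sum.cong) (auto simp: fps_X_power_iff mult_ac)
      also have "\<dots> = x l ^ d * omit_poly n y j $ d"
        by (subst sum.delta) (auto simp: omit_poly_nth_eq_0[OF lj(2)])
      also have "\<dots> = N $$ (l, j) $ d"
        using lj unfolding N_def omit_poly_def
        by (simp add: prod_linear_scale_nth)
      finally show "N $$ (l, j) $ d = (\<Sum>k<n. fps_const (x l ^ k) * fps_X ^ k * fps_const (omit_poly n y j $ k)) $ d" ..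
    qed
    then show "N $$ (l, j) = (P * Q) $$ (l, j)"
      using lj by (simp add: P_def Q_def scalar_prod_def atLeast0LessThan)
  qed (auto simp: N_def P_def Q_def)
  then have "det N = det P * det Q"
    by (simp add: det_mult[of _ n] P_def Q_def)
  also have "det P = det (transpose_mat P)"
    by (rule det_transpose[symmetric, of _ n]) (simp add: P_def)
  also have "\<dots> = (\<Sum>p | p permutes {..<n}. of_int (sign p) * (\<Prod>k<n. fps_const (x (p k) ^ k) * fps_X ^ k))"
    unfolding det_def by (auto simp: P_def atLeast0LessThan intro!: sum.cong prod.cong dest: permutes_in_image)
  also have "\<dots> = fps_X ^ (\<Sum>i<n. i) * fps_const (vandermonde n x)"
    unfolding alt_sum_def fps_const_sum sum_distrib_left
  proof (rule sum.cong[OF refl])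
    fix p
    show "of_int (sign p) * (\<Prod>k<n. fps_const (x (p k) ^ k) * fps_X ^ k) =
      fps_X ^ (\<Sum>i<n. i) * fps_const (of_int (sign p) * (\<Prod>k<n. x (p k) ^ k))"
      unfolding prod.distrib power_sum fps_const_mult[symmetric] fps_const_prod fps_of_int
      by (rule mult.left_commute[symmetric, THEN trans]) (simp add: mult_ac)
  qed
  also have "det Q = fps_const (vandermonde n y)"
  proof -
    interpret comm_ring_hom "fps_const :: 'a \<Rightarrow> 'a fps"
      by unfold_locales (simp_all flip: fps_const_add fps_const_mult)
    have "Q = map_mat fps_const (mat n n (\<lambda>(k, l). omit_poly n y l $ k))"
      by (rule eq_matI) (auto simp: Q_def)
    then show ?thesis by (simp add: vandermonde_eq_det)
  qed
  finally have detN: "det N = fps_X ^ (\<Sum>i<n. i) * fps_const (vandermonde n x) * fps_const (vandermonde n y)" .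
  have "(\<Sum>p | p permutes {..<n}. of_int (sign p) * (\<Prod>i<n. geo (x i * y (p i))))
     = (\<Sum>p | p permutes {..<n}. of_int (sign p) * (\<Prod>i<n. N $$ (i, p i) * (\<Prod>j<n. geo (x i * y j))))"
  proof (intro sum.cong refl arg_cong2[where f = "(*)"] prod.cong)
    fix p i assume "p \<in> {p. p permutes {..<n}}" "i \<in> {..<n}"
    then have i: "i < n" "p i < n" by (auto dest: permutes_in_image)
    have "N $$ (i, p i) = omit_poly n (\<lambda>j. x i * y j) (p i)"
      using i by (simp add: N_def omit_poly_def)
    then show "geo (x i * y (p i)) = N $$ (i, p i) * (\<Prod>j<n. geo (x i * y j))"
      using omit_poly_mult[OF i(2), of "\<lambda>j. x i * y j"] by simp
  qed
  also have "\<dots> = det N * (\<Prod>i<n. \<Prod>j<n. geo (x i * y j))"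
    unfolding det_def by (simp add: N_def prod.distrib sum_distrib_right atLeast0LessThan mult.assoc)
  finally show ?thesis by (simp add: detN mult.assoc)
qed

section \<open>Laurent polynomials\<close>

abbreviation lookup :: "('a \<Rightarrow>\<^sub>0 'b::zero) \<Rightarrow> 'a \<Rightarrow> 'b" where
  "lookup \<equiv> Poly_Mapping.lookup"
abbreviation keys :: "('a \<Rightarrow>\<^sub>0 'b::zero) \<Rightarrow> 'a set" where
  "keys \<equiv> Poly_Mapping.keys"
abbreviation single :: "'a \<Rightarrow> 'b::zero \<Rightarrow> 'a \<Rightarrow>\<^sub>0 'b" where
  "single \<equiv> Poly_Mapping.single"

abbreviation pinv :: "('a \<Rightarrow> 'a) \<Rightarrow> 'a \<Rightarrow> 'a" where
  "pinv w \<equiv> inv_into UNIV w"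

lemma sum_single_lookup:
  assumes "finite S" "keys f \<subseteq> S"
  shows "(\<Sum>\<gamma>\<in>S. single \<gamma> (lookup f \<gamma>)) = f"
proof (rule poly_mapping_eqI)
  fix k
  have "lookup (\<Sum>\<gamma>\<in>S. single \<gamma> (lookup f \<gamma>)) k = (\<Sum>\<gamma>\<in>S. if \<gamma> = k then lookup f \<gamma> else 0)"
    unfolding lookup_sum by (rule sum.cong) (auto simp: lookup_single when_def)
  also have "\<dots> = lookup f k"
    using assms by (auto simp: in_keys_iff)
  finally show "lookup (\<Sum>\<gamma>\<in>S. single \<gamma> (lookup f \<gamma>)) k = lookup f k" .
qed

lemma xmon_add: "xmon (a + b) = xmon a * xmon b"
  by (simp add: xmon_def mult_single)

lemma xmon_0 [simp]: "xmon 0 = 1"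
  by (simp add: xmon_def)

lemma xmon_sum: "xmon (\<Sum>i\<in>S. f i) = (\<Prod>i\<in>S. xmon (f i))"
  by (induction S rule: infinite_finite_induct) (simp_all add: xmon_add)

lemma lookup_of_int_mult: "lookup (of_int c * f) k = c * lookup (f :: laurent) k"
  by (induction c rule: int_induct[of _ 0])
     (simp_all add: algebra_simps lookup_add lookup_minus)

lemma of_int_times_xmon: "of_int c * xmon \<gamma> = single \<gamma> c"
  by (rule poly_mapping_eqI) (simp add: lookup_of_int_mult xmon_def lookup_single when_def)

lemma laurent_expand: 
  assumes "finite S" "keys f \<subseteq> S"
  shows "f = (\<Sum>\<gamma>\<in>S. of_int (lookup f \<gamma>) * xmon \<gamma>)"
  using sum_single_lookup[OF assms] by (simp add: of_int_times_xmon)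

lemma lookup_xmon_mult: "lookup (xmon \<gamma> * f) \<kappa> = lookup f (\<kappa> - \<gamma>)"
proof -
  have "xmon \<gamma> * f = (\<Sum>\<beta>\<in>keys f. single (\<gamma> + \<beta>) (lookup f \<beta>))"
  proof -
    have "xmon \<gamma> * f = xmon \<gamma> * (\<Sum>\<beta>\<in>keys f. single \<beta> (lookup f \<beta>))"
      by (simp add: sum_single_lookup)
    then show ?thesis by (simp add: sum_distrib_left xmon_def mult_single)
  qed
  then have "lookup (xmon \<gamma> * f) \<kappa> = (\<Sum>\<beta>\<in>keys f. lookup (single (\<gamma> + \<beta>) (lookup f \<beta>)) \<kappa>)"
    by (simp only: lookup_sum)
  also have "\<dots> = (\<Sum>\<beta>\<in>keys f. if \<beta> = \<kappa> - \<gamma> then lookup f \<beta> else 0)"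
    by (rule sum.cong) (auto simp: lookup_single when_def)
  also have "\<dots> = lookup f (\<kappa> - \<gamma>)"
    by (simp add: in_keys_iff)
  finally show ?thesis .
qed

section \<open>Change of exponents\<close>

definition wmap :: "(weight \<Rightarrow> weight) \<Rightarrow> laurent \<Rightarrow> laurent" where
  "wmap \<phi> f = (\<Sum>\<gamma>\<in>keys f. single (\<phi> \<gamma>) (lookup f \<gamma>))"

lemma wmap_superset:
  "finite S \<Longrightarrow> keys f \<subseteq> S \<Longrightarrow> wmap \<phi> f = (\<Sum>\<gamma>\<in>S. single (\<phi> \<gamma>) (lookup f \<gamma>))"
  unfolding wmap_def by (rule sum.mono_neutral_left) (auto simp: in_keys_iff)

lemma wmap_0 [simp]: "wmap \<phi> 0 = 0"
  by (simp add: wmap_def)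

lemma wmap_single [simp]: "wmap \<phi> (single \<gamma> c) = single (\<phi> \<gamma>) c"
  by (simp add: wmap_def)

lemma wmap_xmon [simp]: "wmap \<phi> (xmon \<gamma>) = xmon (\<phi> \<gamma>)"
  by (simp add: xmon_def)

lemma wmap_add: "wmap \<phi> (f + g) = wmap \<phi> f + wmap \<phi> g"
proof -
  have "keys (f + g) \<subseteq> keys f \<union> keys g" by (rule keys_add)
  then show ?thesis
    using wmap_superset[of "keys f \<union> keys g" "f + g"] wmap_superset[of "keys f \<union> keys g" f]
      wmap_superset[of "keys f \<union> keys g" g]
    by (simp add: lookup_add single_add sum.distrib)
qed

lemma wmap_sum: "wmap \<phi> (\<Sum>i\<in>S. f i) = (\<Sum>i\<in>S. wmap \<phi> (f i))"
  by (induction S rule: infinite_finite_induct) (auto simp: wmap_add)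

lemma wmap_of_int_mult: "wmap \<phi> (of_int c * f) = of_int c * wmap \<phi> f"
proof (induction c rule: int_induct[of _ 0])
  case (step1 i)
  then show ?case by (simp add: algebra_simps wmap_add)
next
  case (step2 i)
  have "wmap \<phi> (of_int i * f) = wmap \<phi> (of_int (i - 1) * f + f)" by (simp add: algebra_simps)
  then show ?case unfolding wmap_add using step2 by (simp add: algebra_simps)
qed simp

lemma wmap_mult:
  assumes add: "\<And>a b. \<phi> (a + b) = \<phi> a + \<phi> b"
  shows "wmap \<phi> (f * g) = wmap \<phi> f * wmap \<phi> g"
proof -
  have f: "f = (\<Sum>\<gamma>\<in>keys f. of_int (lookup f \<gamma>) * xmon \<gamma>)"
    and g: "g = (\<Sum>\<gamma>\<in>keys g. of_int (lookup g \<gamma>) * xmon \<gamma>)"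
    by (auto intro: laurent_expand)
  have "wmap \<phi> (f * g) = wmap \<phi> (\<Sum>a\<in>keys f. \<Sum>b\<in>keys g. of_int (lookup f a) * (of_int (lookup g b) * xmon (a + b)))"
  proof -
    have "f * g = (\<Sum>\<gamma>\<in>keys f. of_int (lookup f \<gamma>) * xmon \<gamma>) * (\<Sum>\<gamma>\<in>keys g. of_int (lookup g \<gamma>) * xmon \<gamma>)"
      using f g by simp
    then show ?thesis by (simp add: sum_product xmon_add mult_ac)
  qed
  also have "\<dots> = (\<Sum>a\<in>keys f. \<Sum>b\<in>keys g. of_int (lookup f a) * (of_int (lookup g b) * xmon (\<phi> (a + b))))"
    by (simp add: wmap_sum wmap_of_int_mult)
  also have "\<dots> = (\<Sum>a\<in>keys f. of_int (lookup f a) * xmon (\<phi> a)) * (\<Sum>b\<in>keys g. of_int (lookup g b) * xmon (\<phi> b))"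
    by (simp add: sum_product add xmon_add mult_ac)
  also have "\<dots> = wmap \<phi> f * wmap \<phi> g"
  proof -
    have "wmap \<phi> f * wmap \<phi> g = wmap \<phi> (\<Sum>\<gamma>\<in>keys f. of_int (lookup f \<gamma>) * xmon \<gamma>) * wmap \<phi> (\<Sum>\<gamma>\<in>keys g. of_int (lookup g \<gamma>) * xmon \<gamma>)"
      using f g by simp
    then show ?thesis by (simp add: wmap_sum wmap_of_int_mult)
  qed
  finally show ?thesis .
qed

lemma lookup_wmap:
  assumes "inj \<phi>"
  shows "lookup (wmap \<phi> f) (\<phi> \<kappa>) = lookup f \<kappa>"
proof -
  have "lookup (wmap \<phi> f) (\<phi> \<kappa>) = (\<Sum>\<gamma>\<in>keys f. if \<gamma> = \<kappa> then lookup f \<gamma> else 0)"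
    unfolding wmap_def lookup_sum
    by (rule sum.cong) (auto simp: lookup_single when_def inj_eq[OF assms])
  then show ?thesis by (simp add: in_keys_iff)
qed

lemma keys_wmap: "keys (wmap \<phi> f) \<subseteq> \<phi> ` keys f"
proof
  fix k assume "k \<in> keys (wmap \<phi> f)"
  then have "(\<Sum>\<gamma>\<in>keys f. lookup (single (\<phi> \<gamma>) (lookup f \<gamma>)) k) \<noteq> 0"
    by (simp add: wmap_def lookup_sum in_keys_iff)
  then obtain \<gamma> where "\<gamma> \<in> keys f" "lookup (single (\<phi> \<gamma>) (lookup f \<gamma>)) k \<noteq> 0"
    by (rule sum.not_neutral_contains_not_neutral)
  then show "k \<in> \<phi> ` keys f" by (auto simp: lookup_single when_def split: if_splits)
qed

section \<open>Action of permutations\<close>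

abbreviation perm_weight :: "(nat \<Rightarrow> nat) \<Rightarrow> weight \<Rightarrow> weight" where
  "perm_weight w \<equiv> Poly_Mapping.map_key (pinv w)"

lemma perm_act_eq_wmap: "perm_act w = wmap (perm_weight w)"
  by (rule ext) (simp add: perm_act_def wmap_def)

lemma lookup_map_key: "inj f \<Longrightarrow> lookup (Poly_Mapping.map_key f \<gamma>) i = lookup \<gamma> (f i)"
  by (simp add: Poly_Mapping.map_key.rep_eq)

lemma bij_pinv: "bij w \<Longrightarrow> inj w \<and> inj (pinv w) \<and> bij (pinv w) \<and> pinv (pinv w) = w \<and> (\<forall>i. w (pinv w i) = i) \<and> (\<forall>i. pinv w (w i) = i)"
  by (simp add: bij_imp_bij_inv inv_inv_eq bij_is_inj bij_is_surj inv_f_f surj_f_inv_f)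

context
  fixes w :: "nat \<Rightarrow> nat"
  assumes w: "bij w"
begin

lemma inj_pinv: "inj (pinv w)" using w by (simp add: bij_imp_bij_inv bij_is_inj)

lemma lookup_perm_weight: "lookup (perm_weight w \<gamma>) i = lookup \<gamma> (pinv w i)"
  by (simp add: Poly_Mapping.map_key.rep_eq[OF inj_pinv])

lemma lookup_perm_weight': "lookup (perm_weight w \<gamma>) (w i) = lookup \<gamma> i"
  using w by (simp add: lookup_perm_weight bij_is_inj inv_f_f)

lemma perm_weight_add: "perm_weight w (a + b) = perm_weight w a + perm_weight w b"
  by (rule map_key_plus[OF inj_pinv])

lemma perm_weight_0: "perm_weight w 0 = 0"
  by (rule map_key_zero[OF inj_pinv])

lemma perm_weight_single: "perm_weight w (single i c) = single (w i) c"
  using map_key_single[OF inj_pinv, of "w i" c] w by (simp add: bij_is_inj inv_f_f)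

lemma perm_weight_sum: "perm_weight w (\<Sum>i\<in>S. f i) = (\<Sum>i\<in>S. perm_weight w (f i))"
  by (induction S rule: infinite_finite_induct) (auto simp: perm_weight_add perm_weight_0)

lemma inj_perm_weight: "inj (perm_weight w)"
proof (rule injI)
  fix a b assume "perm_weight w a = perm_weight w b"
  then have "lookup (perm_weight w a) (w i) = lookup (perm_weight w b) (w i)" for i by simp
  then show "a = b" by (intro poly_mapping_eqI) (simp add: lookup_perm_weight')
qed

lemma lookup_perm_act: "lookup (perm_act w f) (perm_weight w \<kappa>) = lookup f \<kappa>"
  unfolding perm_act_eq_wmap by (rule lookup_wmap[OF inj_perm_weight])

end

lemma perm_weight_comp:
  assumes "bij u" "bij w"
  shows "perm_weight (u \<circ> w) \<gamma> = perm_weight u (perm_weight w \<gamma>)"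
  using assms bij_pinv[OF assms(1)] bij_pinv[OF assms(2)]
  by (intro poly_mapping_eqI) (simp add: lookup_map_key o_inv_distrib inj_compose)

lemma perm_weight_inv [simp]:
  assumes "bij w"
  shows "perm_weight w (perm_weight (pinv w) \<gamma>) = \<gamma>" "perm_weight (pinv w) (perm_weight w \<gamma>) = \<gamma>"
  using bij_pinv[OF assms] by (auto intro!: poly_mapping_eqI simp: lookup_map_key)

lemma weight_expand:
  assumes "finite S" "keys \<gamma> \<subseteq> S"
  shows "\<gamma> = (\<Sum>i\<in>S. single i (lookup \<gamma> i))"
  using sum_single_lookup[OF assms] by simp

section \<open>Alternants and their quotients\<close>

definition antisymmetrizer :: "nat \<Rightarrow> laurent \<Rightarrow> laurent" where
  "antisymmetrizer n f = (\<Sum>w | w permutes {..<n}. of_int (sign w) * perm_act w f)"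

lemma alternant_eq_antisymmetrizer: "alternant n f = antisymmetrizer n (xmon (delta n) * f)"
  by (simp add: alternant_def antisymmetrizer_def)

definition var :: "nat \<Rightarrow> laurent" where "var i = xmon (single i 1)"

lemma lookup_delta: "lookup (delta n) i = (if i < n then int (n - 1 - i) else 0)"
  by (auto simp: delta_def weight_of_def nth_default_def rev_nth)

lemma keys_delta: "keys (delta n) \<subseteq> {..<n}"
  by (auto simp: in_keys_iff lookup_delta split: if_splits)

lemma prod_permutes:
  assumes "w permutes S" shows "(\<Prod>i\<in>S. f (w i)) = (\<Prod>i\<in>S. f i)"
  using prod.permute[OF assms, of f] by (simp add: o_def)

lemma xmon_single_nat: "xmon (single i (int e)) = var i ^ e"
  by (induction e) (simp_all add: var_def single_add xmon_add)

lemma antisymmetrizer_xmon: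
  assumes "keys \<gamma> \<subseteq> {..<n}" "\<And>i. i < n \<Longrightarrow> lookup \<gamma> i = int (e i) - int c"
  shows "antisymmetrizer n (xmon \<gamma>) = (\<Prod>i<n. xmon (single i (- int c))) * alt_sum n var e"
  unfolding antisymmetrizer_def alt_sum_def sum_distrib_left
proof (rule sum.cong[OF refl])
  fix w assume "w \<in> {w. w permutes {..<n}}"
  then have w: "w permutes {..<n}" and bw: "bij w" by (auto intro: permutes_bij)
  have "perm_weight w \<gamma> = perm_weight w (\<Sum>i<n. single i (lookup \<gamma> i))"
    using weight_expand[OF _ assms(1)] by simp
  also have "\<dots> = (\<Sum>i<n. single (w i) (lookup \<gamma> i))"
    by (simp add: perm_weight_sum[OF bw] perm_weight_single[OF bw])
  also have "\<dots> = (\<Sum>i<n. single (w i) (int (e i)) + single (w i) (- int c))"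
    by (rule sum.cong) (simp_all add: assms(2) flip: single_add)
  finally have "perm_weight w \<gamma> = (\<Sum>i<n. single (w i) (int (e i)) + single (w i) (- int c))" .
  then have "xmon (perm_weight w \<gamma>) = (\<Prod>i<n. var (w i) ^ e i) * (\<Prod>i<n. xmon (single (w i) (- int c)))"
    by (simp add: xmon_sum xmon_add xmon_single_nat prod.distrib)
  also have "(\<Prod>i<n. xmon (single (w i) (- int c))) = (\<Prod>i<n. xmon (single i (- int c)))"
    by (rule prod_permutes[OF w])
  finally show "of_int (sign w) * perm_act w (xmon \<gamma>) =
      (\<Prod>i<n. xmon (single i (- int c))) * (of_int (sign w) * (\<Prod>i<n. var (w i) ^ e i))"
    by (simp add: perm_act_eq_wmap mult_ac)
qed

lemma alternant_1: "alternant n 1 = of_int (sign (mirror n)) * vandermonde n var"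
  using antisymmetrizer_xmon[of "delta n" n "\<lambda>i. n - 1 - i" 0]
  by (simp add: alternant_eq_antisymmetrizer keys_delta lookup_delta alt_sum_decreasing_sign[simplified])

lemma alternant_1_dvd_xmon:
  assumes "keys \<gamma> \<subseteq> {..<n}"
  shows "alternant n 1 dvd alternant n (xmon \<gamma>)"
proof -
  \<comment> \<open>Multiplying by \<open>(\<Prod>i<n. x\<^sub>i) ^ c\<close> makes all exponents nonnegative and commutes with permutations.\<close>
  define c where "c = nat (\<Sum>i<n. \<bar>lookup (delta n + \<gamma>) i\<bar>)"
  have "int (nat (lookup (delta n + \<gamma>) i + int c)) = lookup (delta n + \<gamma>) i + int c" if "i < n" for i
  proof -
    have "\<bar>lookup (delta n + \<gamma>) i\<bar> \<le> (\<Sum>i<n. \<bar>lookup (delta n + \<gamma>) i\<bar>)"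
      using that by (intro member_le_sum) auto
    then show ?thesis by (simp add: c_def)
  qed
  moreover have "keys (delta n + \<gamma>) \<subseteq> {..<n}"
    using keys_add[of "delta n" \<gamma>] keys_delta[of n] assms by blast
  ultimately have "antisymmetrizer n (xmon (delta n + \<gamma>)) = (\<Prod>i<n. xmon (single i (- int c))) *
     alt_sum n var (\<lambda>i. nat (lookup (delta n + \<gamma>) i + int c))"
    by (intro antisymmetrizer_xmon) auto
  then have "vandermonde n var dvd alternant n (xmon \<gamma>)"
    using vandermonde_dvd_alt_sum[of n var] by (simp add: alternant_eq_antisymmetrizer xmon_add)
  moreover have "alternant n 1 dvd vandermonde n var"
    by (rule dvdI[of _ _ "of_int (sign (mirror n))"])
       (simp add: alternant_1 mult_ac flip: mult.assoc of_int_mult)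
  ultimately show ?thesis by (rule dvd_trans[rotated])
qed

lemma antisymmetrizer_sum: "antisymmetrizer n (\<Sum>i\<in>S. f i) = (\<Sum>i\<in>S. antisymmetrizer n (f i))"
  unfolding antisymmetrizer_def perm_act_eq_wmap wmap_sum sum_distrib_left by (rule sum.swap)

lemma antisymmetrizer_of_int_mult: "antisymmetrizer n (of_int c * f) = of_int c * antisymmetrizer n f"
  unfolding antisymmetrizer_def perm_act_eq_wmap wmap_of_int_mult sum_distrib_left by (simp add: mult_ac)

lemma alternant_expand:
  "alternant n f = (\<Sum>\<gamma>\<in>keys f. of_int (lookup f \<gamma>) * alternant n (xmon \<gamma>))"
proof -
  have "xmon (delta n) * f = (\<Sum>\<gamma>\<in>keys f. of_int (lookup f \<gamma>) * (xmon (delta n) * xmon \<gamma>))"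
  proof -
    have "xmon (delta n) * f = xmon (delta n) * (\<Sum>\<gamma>\<in>keys f. of_int (lookup f \<gamma>) * xmon \<gamma>)"
      using laurent_expand[of "keys f" f] by simp
    then show ?thesis by (simp add: sum_distrib_left mult.left_commute)
  qed
  then show ?thesis
    by (simp add: alternant_eq_antisymmetrizer antisymmetrizer_sum antisymmetrizer_of_int_mult)
qed

definition in_vars :: "nat \<Rightarrow> laurent \<Rightarrow> bool" where
  "in_vars n f \<longleftrightarrow> (\<forall>\<gamma>\<in>keys f. keys \<gamma> \<subseteq> {..<n})"

lemma alternant_1_dvd: "in_vars n f \<Longrightarrow> alternant n 1 dvd alternant n f"
  unfolding alternant_expand[of n f] in_vars_def by (intro dvd_sum dvd_mult alternant_1_dvd_xmon) auto

lemma wmap_wmap: "wmap \<phi> (wmap \<psi> f) = wmap (\<phi> \<circ> \<psi>) f"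
  by (simp add: wmap_def[of \<psi>] wmap_sum) (simp add: wmap_def)

lemma perm_act_comp:
  assumes "bij u" "bij w"
  shows "perm_act u (perm_act w f) = perm_act (u \<circ> w) f"
proof -
  have "perm_weight u \<circ> perm_weight w = perm_weight (u \<circ> w)"
    using assms by (intro ext) (simp add: perm_weight_comp)
  then show ?thesis by (simp add: perm_act_eq_wmap wmap_wmap)
qed

lemma sign_permutes_comp:
  "p permutes S \<Longrightarrow> q permutes S \<Longrightarrow> finite S \<Longrightarrow> sign (p \<circ> q) = sign p * sign q"
  by (intro sign_compose) (auto intro: permutes_imp_permutation)

lemma perm_act_sum: "perm_act w (\<Sum>i\<in>S. f i) = (\<Sum>i\<in>S. perm_act w (f i))"
  by (simp add: perm_act_eq_wmap wmap_sum)

lemma perm_act_of_int_mult: "perm_act w (of_int c * f) = of_int c * perm_act w f"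
  by (simp add: perm_act_eq_wmap wmap_of_int_mult)

lemma perm_act_antisymmetrizer:
  assumes v: "v permutes {..<n}"
  shows "perm_act v (antisymmetrizer n f) = of_int (sign v) * antisymmetrizer n f"
proof -
  have "perm_act v (antisymmetrizer n f) = (\<Sum>w | w permutes {..<n}. of_int (sign w) * perm_act (v \<circ> w) f)"
    by (auto simp: antisymmetrizer_def perm_act_sum perm_act_of_int_mult perm_act_comp permutes_bij[OF v] permutes_bij
        intro!: sum.cong)
  also have "\<dots> = (\<Sum>w | w permutes {..<n}. of_int (sign v) * (of_int (sign (v \<circ> w)) * perm_act (v \<circ> w) f))"
    by (rule sum.cong) (auto simp: sign_permutes_comp[OF v] simp flip: mult.assoc of_int_mult)
  also have "\<dots> = of_int (sign v) * antisymmetrizer n f"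
    unfolding antisymmetrizer_def sum_distrib_left
    by (rule setum_permutations_compose_left[OF v, symmetric])
  finally show ?thesis .
qed

lemma lookup_antisymmetrizer_perm:
  assumes v: "v permutes {..<n}"
  shows "lookup (antisymmetrizer n f) (perm_weight v \<kappa>) = sign v * lookup (antisymmetrizer n f) \<kappa>"
proof -
  have "lookup (antisymmetrizer n f) \<kappa> = sign v * lookup (antisymmetrizer n f) (perm_weight v \<kappa>)"
    using lookup_perm_act[OF permutes_bij[OF v], of "antisymmetrizer n f" \<kappa>]
    by (simp add: perm_act_antisymmetrizer[OF v] lookup_of_int_mult)
  then show ?thesis by simp
qed

subsection \<open>Supports\<close>

section \<open>Expansion into alternants\<close>

definition supp :: "(weight \<Rightarrow> bool) \<Rightarrow> laurent \<Rightarrow> bool" where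
  "supp Q f \<longleftrightarrow> (\<forall>\<gamma>\<in>keys f. Q \<gamma>)"

lemma supp_add: "supp Q f \<Longrightarrow> supp Q g \<Longrightarrow> supp Q (f + g)"
  using keys_add[of f g] by (auto simp: supp_def)

lemma supp_0 [simp]: "supp Q 0"
  by (simp add: supp_def)

lemma supp_sum: "(\<And>i. i \<in> S \<Longrightarrow> supp Q (f i)) \<Longrightarrow> supp Q (sum f S)"
  by (induction S rule: infinite_finite_induct) (auto simp: supp_add)

lemma supp_mult:
  assumes "supp P f" "supp Q g" "\<And>a b. P a \<Longrightarrow> Q b \<Longrightarrow> R (a + b)"
  shows "supp R (f * g)"
  using assms keys_mult[of f g] by (fastforce simp: supp_def)

lemma supp_xmon [simp]: "supp Q (xmon \<gamma>) \<longleftrightarrow> Q \<gamma>"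
  by (simp add: supp_def xmon_def)

lemma lookup_eq_0_supp: "supp Q f \<Longrightarrow> \<not> Q \<kappa> \<Longrightarrow> lookup f \<kappa> = 0"
  by (auto simp: supp_def in_keys_iff)

abbreviation vars_lt :: "nat \<Rightarrow> weight \<Rightarrow> bool" where
  "vars_lt n \<gamma> \<equiv> keys \<gamma> \<subseteq> {..<n}"

lemma in_vars_eq_supp: "in_vars n = supp (vars_lt n)"
  by (simp add: in_vars_def supp_def fun_eq_iff)

lemma vars_lt_iff: "vars_lt n \<gamma> \<longleftrightarrow> (\<forall>i\<ge>n. lookup \<gamma> i = 0)"
  by (auto simp: in_keys_iff subset_iff) (meson not_le)

lemma vars_lt_add: "vars_lt n a \<Longrightarrow> vars_lt n b \<Longrightarrow> vars_lt n (a + b)"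
  by (simp add: vars_lt_iff lookup_add)

lemma vars_lt_perm: "w permutes {..<n} \<Longrightarrow> vars_lt n (perm_weight w \<gamma>) \<longleftrightarrow> vars_lt n \<gamma>"
proof -
  assume w: "w permutes {..<n}"
  have "pinv w i = i" if "i \<ge> n" for i
    using permutes_not_in[OF permutes_inv[OF w], of i] that by simp
  then show ?thesis
    unfolding vars_lt_iff by (simp add: lookup_perm_weight[OF permutes_bij[OF w]])
qed

lemma supp_antisymmetrizer:
  assumes "supp (vars_lt n) f"
  shows "supp (vars_lt n) (antisymmetrizer n f)"
  unfolding antisymmetrizer_def
proof (rule supp_sum)
  fix w assume w: "w \<in> {w. w permutes {..<n}}"
  have "supp (vars_lt n) (perm_act w f)"
    unfolding supp_def
  proof
    fix \<kappa> assume "\<kappa> \<in> keys (perm_act w f)"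
    then obtain \<gamma> where "\<gamma> \<in> keys f" "\<kappa> = perm_weight w \<gamma>"
      using keys_wmap unfolding perm_act_eq_wmap by blast
    then show "vars_lt n \<kappa>"
      using assms w vars_lt_perm[of w n \<gamma>] by (simp add: supp_def)
  qed
  then show "supp (vars_lt n) (of_int (sign w) * perm_act w f)"
    by (auto simp: supp_def in_keys_iff lookup_of_int_mult)
qed

subsection \<open>Strictly decreasing exponents\<close>

definition strict_dec :: "nat \<Rightarrow> weight \<Rightarrow> bool" where
  "strict_dec n \<kappa> \<longleftrightarrow> vars_lt n \<kappa> \<and> (\<forall>i j. i < j \<and> j < n \<longrightarrow> lookup \<kappa> j < lookup \<kappa> i)"

lemma strict_dec_delta: "strict_dec n (delta n + \<gamma>) \<longleftrightarrow> \<gamma> \<in> dominant_weights n"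
proof
  assume s: "strict_dec n (delta n + \<gamma>)"
  have "lookup \<gamma> j \<le> lookup \<gamma> i" if "i \<le> j" "j < n" for i j
    using that
  proof (induction j rule: dec_induct)
    case (step m)
    then have "lookup (delta n + \<gamma>) (Suc m) < lookup (delta n + \<gamma>) m"
      using s unfolding strict_dec_def by (metis lessI)
    then have "lookup \<gamma> (Suc m) \<le> lookup \<gamma> m"
      using step.prems by (auto simp: lookup_add lookup_delta of_nat_diff)
    then show ?case using step by simp
  qed simp
  then show "\<gamma> \<in> dominant_weights n"
    using s by (auto simp: strict_dec_def dominant_weights_def vars_lt_iff lookup_add lookup_delta)
next
  assume "\<gamma> \<in> dominant_weights n"
  then have v: "vars_lt n \<gamma>" and d: "\<And>i j. i \<le> j \<Longrightarrow> j < n \<Longrightarrow> lookup \<gamma> j \<le> lookup \<gamma> i"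
    by (auto simp: dominant_weights_def)
  have "lookup (delta n + \<gamma>) j < lookup (delta n + \<gamma>) i" if "i < j" "j < n" for i j
    using d[of i j] that by (simp add: lookup_add lookup_delta of_nat_diff)
  then show "strict_dec n (delta n + \<gamma>)"
    unfolding strict_dec_def using vars_lt_add[OF keys_delta v] by blast
qed

lemma permutes_strict_mono_eq_id:
  assumes v: "v permutes {..<n :: nat}" and mono: "\<And>i j. i < j \<Longrightarrow> j < n \<Longrightarrow> v i < v j"
  shows "v = id"
proof (rule permutes_natset_ge[OF v], rule ballI)
  fix i assume "i \<in> {..<n}"
  then show "i \<le> v i"
  proof (induction i)
    case (Suc i)
    then show ?case using mono[of i "Suc i"] by auto
  qed simp
qed

lemma strict_dec_perm_eq_id:
  assumes "strict_dec n \<kappa>" "strict_dec n (perm_weight w \<kappa>)" and w: "w permutes {..<n}"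
  shows "w = id"
proof -
  have bw: "bij w" using w by (rule permutes_bij)
  have pw: "pinv w permutes {..<n}" using w by (rule permutes_inv)
  have "pinv w i < pinv w j" if "i < j" "j < n" for i j
  proof (rule ccontr)
    assume "\<not> pinv w i < pinv w j"
    moreover have "pinv w i \<noteq> pinv w j"
      using that bij_pinv[OF bw] by (metis less_irrefl)
    ultimately have "pinv w j < pinv w i" by simp
    moreover have "pinv w i < n"
      using that permutes_in_image[OF pw, of i] by auto
    ultimately have "lookup \<kappa> (pinv w i) < lookup \<kappa> (pinv w j)"
      using assms(1) by (auto simp: strict_dec_def)
    moreover have "lookup \<kappa> (pinv w j) < lookup \<kappa> (pinv w i)"
      using assms(2) that by (auto simp: strict_dec_def lookup_perm_weight[OF bw])
    ultimately show False by simp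
  qed
  then have "pinv w = id" by (rule permutes_strict_mono_eq_id[OF pw])
  then show ?thesis using bij_pinv[OF bw] by (metis inv_id)
qed

text \<open>
  No permutation but the identity maps a strictly decreasing exponent vector to a strictly
  decreasing one.
\<close>

lemma lookup_alternant_xmon:
  assumes "\<gamma> \<in> dominant_weights n" "strict_dec n \<kappa>"
  shows "lookup (alternant n (xmon \<gamma>)) \<kappa> = (if \<kappa> = delta n + \<gamma> then 1 else 0)"
proof -
  have s: "strict_dec n (delta n + \<gamma>)" using assms(1) strict_dec_delta by simp
  have "lookup (alternant n (xmon \<gamma>)) \<kappa> =
    (\<Sum>w | w permutes {..<n}. sign w * (if perm_weight w (delta n + \<gamma>) = \<kappa> then 1 else 0))"
  proof -
    have "perm_act w (xmon (delta n) * xmon \<gamma>) = xmon (perm_weight w (delta n + \<gamma>))" for w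
      by (simp add: perm_act_eq_wmap flip: xmon_add)
    then show ?thesis
      unfolding alternant_eq_antisymmetrizer antisymmetrizer_def lookup_sum lookup_of_int_mult
      by (intro sum.cong refl) (simp add: xmon_def lookup_single when_def)
  qed
  also have "\<dots> = (\<Sum>w | w permutes {..<n}. if w = id then (if \<kappa> = delta n + \<gamma> then 1 else 0) else 0)"
  proof (rule sum.cong[OF refl])
    fix w assume "w \<in> {w. w permutes {..<n}}"
    then have w: "w permutes {..<n}" by simp
    show "sign w * (if perm_weight w (delta n + \<gamma>) = \<kappa> then 1 else 0) =
      (if w = id then (if \<kappa> = delta n + \<gamma> then 1 else 0) else 0)"
    proof (cases "w = id")
      case True
      have "perm_weight id (delta n + \<gamma>) = delta n + \<gamma>"
        by (rule poly_mapping_eqI) (simp add: lookup_map_key)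
      then show ?thesis using True by auto
    next
      case False
      then have "perm_weight w (delta n + \<gamma>) \<noteq> \<kappa>"
        using strict_dec_perm_eq_id[OF s _ w] assms(2) by auto
      then show ?thesis using False by simp
    qed
  qed
  also have "\<dots> = (if \<kappa> = delta n + \<gamma> then 1 else 0)"
    by (simp add: finite_permutations permutes_id)
  finally show ?thesis .
qed

lemma exists_sorting_permutation:
  assumes "vars_lt n \<kappa>" "inj_on (lookup \<kappa>) {..<n}"
  obtains w where "w permutes {..<n}" "strict_dec n (perm_weight w \<kappa>)"
proof -
  define ys where "ys = map (lookup \<kappa>) [0..<n]"
  define xs where "xs = rev (sort ys)"
  have "mset xs = mset ys" by (simp add: xs_def)
  then obtain p where p: "p permutes {..<length ys}" "permute_list p ys = xs"
    by (rule mset_eq_permutation)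
  have len: "length ys = n" "length xs = n" by (simp_all add: ys_def xs_def)
  have pn: "p permutes {..<n}" using p len by simp
  have bp: "bij p" by (rule permutes_bij[OF pn])
  have dist: "distinct (sort ys)"
    using assms(2) by (simp add: ys_def distinct_map atLeast0LessThan)
  have xs_nth: "xs ! i = lookup \<kappa> (p i)" if "i < n" for i
  proof -
    have "permute_list p ys ! i = ys ! p i"
      using that len by (intro permute_list_nth[OF p(1)]) simp
    then show ?thesis
      using that p(2) permutes_in_image[OF pn, of i] by (simp add: ys_def)
  qed
  have "xs ! j < xs ! i" if "i < j" "j < n" for i j
  proof -
    have "sorted (sort ys)" by simp
    have "sort ys ! (n - Suc j) \<le> sort ys ! (n - Suc i)"
      by (rule sorted_nth_mono) (use that len in \<open>auto simp: xs_def\<close>)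
    moreover have "sort ys ! (n - Suc j) \<noteq> sort ys ! (n - Suc i)"
      using that len dist by (subst nth_eq_iff_index_eq) auto
    ultimately show ?thesis
      using that len by (simp add: xs_def rev_nth)
  qed
  then have "strict_dec n (perm_weight (pinv p) \<kappa>)"
    using assms(1) vars_lt_perm[OF permutes_inv[OF pn], of \<kappa>] bij_pinv[OF bp] xs_nth
    by (auto simp: strict_dec_def lookup_map_key)
  with permutes_inv[OF pn] show thesis by (rule that)
qed

lemma lookup_alternant_repeated:
  assumes "i < n" "j < n" "i \<noteq> j" "lookup \<kappa> i = lookup \<kappa> j"
  shows "lookup (antisymmetrizer n f) \<kappa> = 0"
proof -
  let ?t = "Transposition.transpose i j"
  have t: "?t permutes {..<n}" using assms by (intro permutes_swap_id) auto
  have "perm_weight ?t \<kappa> = \<kappa>"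
    using assms(4) by (intro poly_mapping_eqI)
       (auto simp: lookup_map_key Transposition.transpose_def)
  then show ?thesis
    using lookup_antisymmetrizer_perm[OF t, of f \<kappa>] assms(3) by (simp add: sign_swap_id)
qed

lemma alternant_1_nonzero: "alternant n 1 \<noteq> 0"
proof -
  have "0 \<in> dominant_weights n" by (simp add: dominant_weights_def)
  then have "lookup (alternant n (xmon 0)) (delta n) = 1"
    using strict_dec_delta[of n 0] by (subst lookup_alternant_xmon) auto
  then show ?thesis by auto
qed

lemma pi_op_eq:
  assumes "in_vars n f"
  shows "alternant n 1 * pi_op n f = alternant n f"
proof -
  obtain g where g: "alternant n f = alternant n 1 * g"
    using alternant_1_dvd[OF assms] by (elim dvdE)
  show ?thesis
    unfolding pi_op_def by (rule theI[of _ g]) (use g alternant_1_nonzero in auto)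
qed

lemma in_vars_xmon_dominant: "\<gamma> \<in> dominant_weights n \<Longrightarrow> in_vars n (xmon \<gamma>)"
  by (simp add: in_vars_eq_supp dominant_weights_def)

lemma alternant_1_mult_schur_sum:
  assumes "keys c \<subseteq> dominant_weights n"
  shows "alternant n 1 * (\<Sum>\<gamma>\<in>keys c. of_int (lookup c \<gamma>) * schur n \<gamma>) =
    (\<Sum>\<gamma>\<in>keys c. of_int (lookup c \<gamma>) * alternant n (xmon \<gamma>))"
  unfolding sum_distrib_left
  by (rule sum.cong) (use assms in \<open>auto simp: schur_def mult.left_commute[of "alternant n 1"]
      pi_op_eq in_vars_xmon_dominant\<close>)

lemma lookup_sum_alternant:
  assumes "keys c \<subseteq> dominant_weights n" "\<gamma> \<in> dominant_weights n"
  shows "lookup (\<Sum>\<beta>\<in>keys c. of_int (lookup c \<beta>) * alternant n (xmon \<beta>)) (delta n + \<gamma>) = lookup c \<gamma>"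
proof -
  have "lookup (\<Sum>\<beta>\<in>keys c. of_int (lookup c \<beta>) * alternant n (xmon \<beta>)) (delta n + \<gamma>) =
      (\<Sum>\<beta>\<in>keys c. if \<beta> = \<gamma> then lookup c \<beta> else 0)"
    unfolding lookup_sum lookup_of_int_mult
    by (rule sum.cong) (use assms in \<open>auto simp: lookup_alternant_xmon strict_dec_delta\<close>)
  then show ?thesis by (simp add: in_keys_iff)
qed

text \<open>
  An antisymmetric Laurent polynomial is determined by its coefficients at strictly decreasing
  exponents: an exponent with a repeated entry has coefficient 0, because the transposition of the
  two positions changes the sign, and any other exponent can be sorted. So it is
  enough to match the coefficients at the exponents \<open>\<delta> + \<gamma>\<close> with \<open>\<gamma>\<close> dominant.
\<close>

lemma alternant_expansion:
  assumes f: "in_vars n f"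
  obtains c where "keys c \<subseteq> dominant_weights n"
    "alternant n f = (\<Sum>\<gamma>\<in>keys c. of_int (lookup c \<gamma>) * alternant n (xmon \<gamma>))"
proof -
  define A where "A = antisymmetrizer n (xmon (delta n) * f)"
  have A: "supp (vars_lt n) A"
    unfolding A_def
    by (intro supp_antisymmetrizer supp_mult[where P = "vars_lt n" and Q = "vars_lt n"] vars_lt_add)
       (use f in \<open>auto simp: in_vars_eq_supp keys_delta\<close>)
  define S where "S = {\<gamma> \<in> dominant_weights n. lookup A (delta n + \<gamma>) \<noteq> 0}"
  have "S \<subseteq> (\<lambda>\<kappa>. \<kappa> - delta n) ` keys A"
    by (force simp: S_def in_keys_iff image_iff intro!: bexI[of _ "delta n + _"])
  then have finS: "finite S" by (rule finite_subset) simp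
  define c where "c = (\<Sum>\<gamma>\<in>S. single \<gamma> (lookup A (delta n + \<gamma>)))"
  have c: "lookup c \<gamma> = (if \<gamma> \<in> S then lookup A (delta n + \<gamma>) else 0)" for \<gamma>
  proof -
    have "lookup c \<gamma> = (\<Sum>\<beta>\<in>S. if \<beta> = \<gamma> then lookup A (delta n + \<beta>) else 0)"
      unfolding c_def lookup_sum by (rule sum.cong) (auto simp: lookup_single when_def)
    then show ?thesis using finS by simp
  qed
  have kc: "keys c \<subseteq> dominant_weights n"
    by (auto simp: in_keys_iff c S_def split: if_splits)
  define B where "B = (\<Sum>\<gamma>\<in>keys c. of_int (lookup c \<gamma>) * alternant n (xmon \<gamma>))"
  have B_eq: "B = antisymmetrizer n (\<Sum>\<gamma>\<in>keys c. of_int (lookup c \<gamma>) * (xmon (delta n) * xmon \<gamma>))"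
    by (simp add: B_def antisymmetrizer_sum antisymmetrizer_of_int_mult alternant_eq_antisymmetrizer)
  have B: "supp (vars_lt n) B"
    unfolding B_eq using kc
    by (intro supp_antisymmetrizer supp_sum)
       (auto simp: of_int_times_xmon supp_def dominant_weights_def simp flip: xmon_add
          split: if_splits dest!: subsetD[OF keys_add] subsetD[OF keys_delta])
  have dec: "lookup B \<kappa> = lookup A \<kappa>" if "strict_dec n \<kappa>" for \<kappa>
  proof -
    define \<gamma> where "\<gamma> = \<kappa> - delta n"
    have \<gamma>: "\<kappa> = delta n + \<gamma>" by (simp add: \<gamma>_def)
    then have d: "\<gamma> \<in> dominant_weights n" using that strict_dec_delta by simp
    show ?thesis
      using lookup_sum_alternant[OF kc d] c[of \<gamma>] d by (simp add: \<gamma> S_def flip: B_def)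
  qed
  have "B = A"
  proof (rule poly_mapping_eqI)
    fix \<kappa>
    consider "\<not> vars_lt n \<kappa>" | "vars_lt n \<kappa>" "\<not> inj_on (lookup \<kappa>) {..<n}"
      | "vars_lt n \<kappa>" "inj_on (lookup \<kappa>) {..<n}" by blast
    then show "lookup B \<kappa> = lookup A \<kappa>"
    proof cases
      case 1
      then show ?thesis using A B by (simp add: lookup_eq_0_supp)
    next
      case 2
      then obtain i j where ij: "i < n" "j < n" "i \<noteq> j" "lookup \<kappa> i = lookup \<kappa> j"
        by (auto simp: inj_on_def)
      show ?thesis
        unfolding A_def B_eq using lookup_alternant_repeated[OF ij] by simp
    next
      case 3
      then obtain w where w: "w permutes {..<n}" "strict_dec n (perm_weight w \<kappa>)"
        by (rule exists_sorting_permutation)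
      have "sign w * lookup B \<kappa> = sign w * lookup A \<kappa>"
        using dec[OF w(2)] unfolding A_def B_eq lookup_antisymmetrizer_perm[OF w(1)] .
      then show ?thesis by simp
    qed
  qed
  then show thesis
    using that[OF kc] by (simp add: A_def B_def alternant_eq_antisymmetrizer)
qed

text \<open>
  Multiplication by \<open>J(1)\<close>, which is nonzero, turns an expansion into Schur functions into an
  expansion into alternants, so the coefficients can be read off at the exponents \<open>\<delta> + \<gamma>\<close>.
\<close>

lemma lookup_schur_expansion:
  assumes f: "in_vars n f" and \<gamma>: "\<gamma> \<in> dominant_weights n"
  shows "lookup (schur_expansion n (pi_op n f)) \<gamma> = lookup (alternant n f) (delta n + \<gamma>)"
proof -
  obtain c where c: "keys c \<subseteq> dominant_weights n"
    "alternant n f = (\<Sum>\<gamma>\<in>keys c. of_int (lookup c \<gamma>) * alternant n (xmon \<gamma>))"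
    using alternant_expansion[OF f] .
  let ?P = "\<lambda>c. keys c \<subseteq> dominant_weights n \<and>
      pi_op n f = (\<Sum>\<gamma>\<in>keys c. of_int (lookup c \<gamma>) * schur n \<gamma>)"
  have iff: "pi_op n f = (\<Sum>\<gamma>\<in>keys b. of_int (lookup b \<gamma>) * schur n \<gamma>) \<longleftrightarrow>
     alternant n f = (\<Sum>\<gamma>\<in>keys b. of_int (lookup b \<gamma>) * alternant n (xmon \<gamma>))"
    if "keys b \<subseteq> dominant_weights n" for b
    unfolding alternant_1_mult_schur_sum[OF that, symmetric] pi_op_eq[OF f, symmetric]
    using alternant_1_nonzero by simp
  have "schur_expansion n (pi_op n f) = c"
    unfolding schur_expansion_def
  proof (rule the_equality)
    show "?P c" using c iff[OF c(1)] by simp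
    fix b assume b: "?P b"
    then have "alternant n f = (\<Sum>\<gamma>\<in>keys b. of_int (lookup b \<gamma>) * alternant n (xmon \<gamma>))"
      using iff[of b] by blast
    then have "lookup b \<beta> = lookup c \<beta>" if "\<beta> \<in> dominant_weights n" for \<beta>
      using that b c lookup_sum_alternant[of b n \<beta>] lookup_sum_alternant[of c n \<beta>] by simp
    moreover have "lookup b \<beta> = lookup c \<beta>" if "\<beta> \<notin> dominant_weights n" for \<beta>
      using that b c by (metis in_keys_iff subsetD)
    ultimately show "b = c" by (intro poly_mapping_eqI) blast
  qed
  then show ?thesis
    using lookup_sum_alternant[OF c(1) \<gamma>] c(2) by simp
qed

section \<open>Constant terms\<close>

definition fps_wmap :: "(weight \<Rightarrow> weight) \<Rightarrow> laurent fps \<Rightarrow> laurent fps" where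
  "fps_wmap \<phi> F = Abs_fps (\<lambda>d. wmap \<phi> (F $ d))"

definition ct :: "laurent fps \<Rightarrow> int fps" where
  "ct F = Abs_fps (\<lambda>d. lookup (F $ d) 0)"

lemma fps_wmap_nth [simp]: "fps_wmap \<phi> F $ d = wmap \<phi> (F $ d)"
  by (simp add: fps_wmap_def)

lemma ct_nth [simp]: "ct F $ d = lookup (F $ d) 0"
  by (simp add: ct_def)

lemma fps_nth_of_int_mult: "(of_int c * F) $ d = of_int c * (F $ d :: 'a::comm_ring_1)"
  by (simp flip: fps_of_int)

lemma ct_sum: "ct (\<Sum>i\<in>S. f i) = (\<Sum>i\<in>S. ct (f i))"
  by (rule fps_ext) (simp add: fps_sum_nth lookup_sum)

lemma ct_add: "ct (F + G) = ct F + ct G"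
  by (rule fps_ext) (simp add: lookup_add)

lemma ct_of_int_mult: "ct (of_int c * F) = of_int c * ct F"
  by (rule fps_ext) (simp add: fps_nth_of_int_mult lookup_of_int_mult)

lemma ct_X_power_mult: "ct (fps_X ^ k * F) = fps_X ^ k * ct F"
  by (rule fps_ext) (simp add: fps_X_power_mult_nth)

lemma ct_fps_wmap: "inj \<phi> \<Longrightarrow> \<phi> 0 = 0 \<Longrightarrow> ct (fps_wmap \<phi> F) = ct F"
  by (rule fps_ext) (simp, metis lookup_wmap)

lemma fps_wmap_const: "fps_wmap \<phi> (fps_const f) = fps_const (wmap \<phi> f)"
  by (rule fps_ext) simp

context
  fixes \<phi> :: "weight \<Rightarrow> weight"
  assumes \<phi>: "\<And>a b. \<phi> (a + b) = \<phi> a + \<phi> b"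
begin

lemma additive_0: "\<phi> 0 = 0"
  using \<phi>[of 0 0] by simp

lemma wmap_1: "wmap \<phi> 1 = 1"
  using wmap_xmon[of \<phi> 0] by (simp add: additive_0)

lemma fps_wmap_mult: "fps_wmap \<phi> (F * G) = fps_wmap \<phi> F * fps_wmap \<phi> G"
  by (rule fps_ext) (simp add: fps_mult_nth wmap_sum wmap_mult[OF \<phi>])

lemma fps_wmap_1: "fps_wmap \<phi> 1 = 1"
  by (rule fps_ext) (simp add: wmap_1)

lemma fps_wmap_prod: "fps_wmap \<phi> (\<Prod>i\<in>S. f i) = (\<Prod>i\<in>S. fps_wmap \<phi> (f i))"
  by (induction S rule: infinite_finite_induct) (simp_all add: fps_wmap_mult fps_wmap_1)

lemma wmap_power: "wmap \<phi> (u ^ d) = wmap \<phi> u ^ d"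
  by (induction d) (simp_all add: wmap_1 wmap_mult[OF \<phi>])

lemma wmap_prod: "wmap \<phi> (\<Prod>i\<in>S. f i) = (\<Prod>i\<in>S. wmap \<phi> (f i))"
  by (induction S rule: infinite_finite_induct) (simp_all add: wmap_1 wmap_mult[OF \<phi>])

lemma fps_wmap_geo: "fps_wmap \<phi> (geo u) = geo (wmap \<phi> u)"
  by (rule fps_ext) (simp add: wmap_power)

end

subsection \<open>Supports of power series\<close>

definition fsupp :: "(weight \<Rightarrow> bool) \<Rightarrow> laurent fps \<Rightarrow> bool" where
  "fsupp Q F \<longleftrightarrow> (\<forall>d. supp Q (F $ d))"

lemma fsupp_const: "supp Q f \<Longrightarrow> fsupp Q (fps_const f)"
  by (simp add: fsupp_def)

lemma fsupp_mult:
  assumes "fsupp P F" "fsupp Q G" "\<And>a b. P a \<Longrightarrow> Q b \<Longrightarrow> R (a + b)"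
  shows "fsupp R (F * G)"
  using assms unfolding fsupp_def fps_mult_nth by (intro allI supp_sum supp_mult[of P _ Q]) auto

lemma fsupp_add: "fsupp Q F \<Longrightarrow> fsupp Q G \<Longrightarrow> fsupp Q (F + G)"
  by (auto simp: fsupp_def intro: supp_add)

lemma fsupp_1: "Q 0 \<Longrightarrow> fsupp Q 1"
  unfolding fps_const_1_eq_1[symmetric] by (rule fsupp_const) (simp add: supp_def)

lemma ct_eq_0: "fsupp Q F \<Longrightarrow> \<not> Q 0 \<Longrightarrow> ct F = 0"
  by (rule fps_ext) (metis ct_nth fps_zero_nth fsupp_def lookup_eq_0_supp)

lemma fsupp_geo:
  assumes "Q 0" "\<And>a b. Q a \<Longrightarrow> Q b \<Longrightarrow> Q (a + b)" "Q \<gamma>"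
  shows "fsupp Q (geo (xmon \<gamma>))"
  unfolding fsupp_def
proof
  fix d show "supp Q (geo (xmon \<gamma>) $ d)"
  proof (induction d)
    case (Suc d)
    then show ?case using assms by (auto intro: supp_mult[of Q _ Q])
  qed (use assms in \<open>simp add: supp_def\<close>)
qed

lemma fsupp_prod:
  assumes "Q 0" "\<And>a b. Q a \<Longrightarrow> Q b \<Longrightarrow> Q (a + b)" "\<And>i. i \<in> S \<Longrightarrow> fsupp Q (f i)"
  shows "fsupp Q (\<Prod>i\<in>S. f i)"
  using assms(3)
  by (induction S rule: infinite_finite_induct)
     (auto intro: fsupp_mult[of Q _ Q] assms(2) fsupp_1 assms(1))

section \<open>Parabolic Kostka polynomials as signed constant terms\<close>

definition mon :: "nat \<Rightarrow> (nat \<Rightarrow> nat) \<Rightarrow> (nat \<Rightarrow> int) \<Rightarrow> laurent" where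
  "mon n v e = (\<Prod>i<n. xmon (single (v i) (e i)))"

definition root_series :: "(nat \<times> nat) set \<Rightarrow> laurent fps" where
  "root_series \<Phi> = (\<Prod>(i, j)\<in>\<Phi>. geo (xmon (single i 1 - single j 1)))"

text \<open>
  The expression for the Kostka polynomial with \<open>\<kappa> = \<lambda> + \<delta>\<close> and \<open>\<nu> = \<mu> + \<delta>\<close>. It is defined for
  arbitrary vectors, since restrictions of \<open>\<lambda> + \<delta>\<close> to a group of variables have the form
  \<open>\<lambda>' + \<delta>'\<close> only up to a constant.
\<close>

definition weyl_sum :: "nat \<Rightarrow> (nat \<times> nat) set \<Rightarrow> (nat \<Rightarrow> int) \<Rightarrow> (nat \<Rightarrow> int) \<Rightarrow> int fps" where
  "weyl_sum N \<Phi> \<kappa> \<nu> = (\<Sum>w | w permutes {..<N}. of_int (sign w) *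
     ct (fps_const (mon N id \<nu> * mon N w (\<lambda>i. - \<kappa> i)) * root_series \<Phi>))"

lemma mon_eq_xmon: "mon n v e = xmon (\<Sum>i<n. single (v i) (e i))"
  by (simp add: mon_def xmon_sum)

lemma mon_cong: "(\<And>i. i < n \<Longrightarrow> v i = v' i) \<Longrightarrow> (\<And>i. i < n \<Longrightarrow> e i = e' i) \<Longrightarrow> mon n v e = mon n v' e'"
  unfolding mon_def by (intro prod.cong) auto

lemma mon_mult: "mon n v e * mon n v e' = mon n v (\<lambda>i. e i + e' i)"
  by (simp add: mon_def single_add xmon_add flip: prod.distrib)

lemma mon_permutes: "p permutes {..<n} \<Longrightarrow> mon n (\<lambda>i. v (p i)) (\<lambda>i. e (p i)) = mon n v e"
  unfolding mon_def by (rule prod_permutes[where f = "\<lambda>i. xmon (single (v i) (e i))"])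

lemma mon_0 [simp]: "mon n v (\<lambda>i. 0) = 1"
  by (simp add: mon_def)

lemma finite_Phi [simp]: "finite (Phi \<eta>)"
proof (rule finite_subset)
  show "Phi \<eta> \<subseteq> {..<sum_list \<eta>} \<times> {..<sum_list \<eta>}"
  proof
    fix z assume "z \<in> Phi \<eta>"
    then obtain i j u where z: "z = (i, j)" "j < sum_list \<eta>" "i < sum_list (take u \<eta>)"
      by (auto simp: Phi_def)
    have "sum_list (take u \<eta>) \<le> sum_list \<eta>"
      using arg_cong[OF append_take_drop_id[of u \<eta>], of sum_list] unfolding sum_list_append by linarith
    then show "z \<in> {..<sum_list \<eta>} \<times> {..<sum_list \<eta>}" using z by simp
  qed
qed simp

lemma Phi_bounds: "(i, j) \<in> Phi \<eta> \<Longrightarrow> i < j \<and> j < sum_list \<eta>"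
  by (auto simp: Phi_def)

lemma vars_lt_single: "i < n \<Longrightarrow> vars_lt n (single i c)"
  by (auto simp: vars_lt_iff lookup_single when_def)

lemma vars_lt_root: "i < n \<Longrightarrow> j < n \<Longrightarrow> vars_lt n (single i 1 - single j 1)"
  by (auto simp: vars_lt_iff lookup_minus lookup_single when_def)

lemma fsupp_root_series:
  assumes "Q 0" "\<And>a b. Q a \<Longrightarrow> Q b \<Longrightarrow> Q (a + b)" "\<And>i j. (i, j) \<in> \<Phi> \<Longrightarrow> Q (single i 1 - single j 1)"
  shows "fsupp Q (root_series \<Phi>)"
  unfolding root_series_def by (intro fsupp_prod assms) (auto intro!: fsupp_geo assms)

lemma kostka_gen_eq: "kostka_gen \<mu> \<eta> = fps_const (xmon \<mu>) * root_series (Phi \<eta>)"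
  by (simp add: kostka_gen_def root_series_def geom_factor_def geo_def)

text \<open>
  The left-hand side is a coefficient of \<open>J(f)\<close>. Moving the permutations from the polynomial to the
  exponent turns each summand into a constant term.
\<close>

lemma parabolic_kostka_eq_weyl_sum:
  fixes \<eta> :: "nat list"
  defines "N \<equiv> sum_list \<eta>"
  assumes \<mu>: "vars_lt N \<mu>" and \<gamma>: "\<gamma> \<in> dominant_weights N"
  shows "parabolic_kostka \<gamma> \<mu> \<eta> =
    weyl_sum N (Phi \<eta>) (lookup (delta N + \<gamma>)) (lookup (delta N + \<mu>))"
proof (rule fps_ext)
  fix d
  define f where "f = kostka_gen \<mu> \<eta> $ d"
  define \<kappa> where "\<kappa> = delta N + \<gamma>"
  have "vars_lt N (single i 1 - single j 1)" if "(i, j) \<in> Phi \<eta>" for i j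
    using Phi_bounds[OF that] by (intro vars_lt_root) (auto simp: N_def)
  then have "fsupp (vars_lt N) (root_series (Phi \<eta>))"
    by (intro fsupp_root_series vars_lt_add) auto
  then have "fsupp (vars_lt N) (kostka_gen \<mu> \<eta>)"
    unfolding kostka_gen_eq
    by (intro fsupp_mult[of "vars_lt N" _ "vars_lt N"] fsupp_const vars_lt_add) (simp_all add: \<mu>)
  then have f: "in_vars N f" by (simp add: fsupp_def in_vars_eq_supp f_def)
  have \<kappa>: "vars_lt N \<kappa>"
    unfolding \<kappa>_def using \<gamma> by (intro vars_lt_add keys_delta) (simp add: dominant_weights_def)
  have "parabolic_kostka \<gamma> \<mu> \<eta> $ d = lookup (alternant N f) \<kappa>"
    using lookup_schur_expansion[OF f \<gamma>] by (simp add: parabolic_kostka_def Let_def f_def \<kappa>_def flip: N_def)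
  also have "\<dots> = (\<Sum>w | w permutes {..<N}. sign w * lookup (perm_act w (xmon (delta N) * f)) \<kappa>)"
    by (simp add: alternant_def lookup_sum lookup_of_int_mult)
  also have "\<dots> = (\<Sum>w | w permutes {..<N}. sign (pinv w) * lookup (perm_act (pinv w) (xmon (delta N) * f)) \<kappa>)"
    by (rule sum_permutations_inverse)
  also have "\<dots> = (\<Sum>w | w permutes {..<N}. sign w *
      lookup (xmon (delta N + \<mu>) * xmon (- perm_weight w \<kappa>) * (root_series (Phi \<eta>) $ d)) 0)"
  proof (rule sum.cong[OF refl])
    fix w assume "w \<in> {w. w permutes {..<N}}"
    then have w: "w permutes {..<N}" by simp
    have bw: "bij (pinv w)" "bij w" using w bij_pinv permutes_bij by blast+
    have "lookup (perm_act (pinv w) (xmon (delta N) * f)) \<kappa> = lookup (xmon (delta N) * f) (perm_weight w \<kappa>)"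
      using lookup_perm_act[OF bw(1), of "xmon (delta N) * f" "perm_weight w \<kappa>"]
      by (simp only: perm_weight_inv[OF bw(2)])
    also have "\<dots> = lookup (xmon (- perm_weight w \<kappa>) * (xmon (delta N) * f)) 0"
      by (simp only: lookup_xmon_mult[of "- _"]) simp
    also have "xmon (- perm_weight w \<kappa>) * (xmon (delta N) * f) =
        xmon (delta N + \<mu>) * xmon (- perm_weight w \<kappa>) * (root_series (Phi \<eta>) $ d)"
      by (simp add: f_def kostka_gen_eq xmon_add mult_ac)
    finally show "sign (pinv w) * lookup (perm_act (pinv w) (xmon (delta N) * f)) \<kappa> = sign w *
      lookup (xmon (delta N + \<mu>) * xmon (- perm_weight w \<kappa>) * (root_series (Phi \<eta>) $ d)) 0"
      using sign_inverse[OF permutes_imp_permutation[OF _ w]] by simp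
  qed
  also have "\<dots> = weyl_sum N (Phi \<eta>) (lookup (delta N + \<gamma>)) (lookup (delta N + \<mu>)) $ d"
    unfolding weyl_sum_def fps_sum_nth
  proof (rule sum.cong[OF refl])
    fix w assume "w \<in> {w. w permutes {..<N}}"
    then have bw: "bij w" by (auto intro: permutes_bij)
    have "delta N + \<mu> = (\<Sum>i<N. single i (lookup (delta N + \<mu>) i))"
      by (intro weight_expand vars_lt_add keys_delta \<mu>) simp
    then have 1: "xmon (delta N + \<mu>) = mon N id (lookup (delta N + \<mu>))"
      by (simp add: mon_eq_xmon)
    have "perm_weight w \<kappa> = perm_weight w (\<Sum>i<N. single i (lookup \<kappa> i))"
      using weight_expand[OF _ \<kappa>] by simp
    also have "\<dots> = (\<Sum>i<N. single (w i) (lookup \<kappa> i))"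
      by (simp add: perm_weight_sum[OF bw] perm_weight_single[OF bw])
    finally have 2: "xmon (- perm_weight w \<kappa>) = mon N w (\<lambda>i. - lookup \<kappa> i)"
      by (simp add: mon_eq_xmon single_uminus sum_negf)
    show "sign w * lookup (xmon (delta N + \<mu>) * xmon (- perm_weight w \<kappa>) * (root_series (Phi \<eta>) $ d)) 0 =
      (of_int (sign w) * ct (fps_const (mon N id (lookup (delta N + \<mu>)) *
         mon N w (\<lambda>i. - lookup (delta N + \<gamma>) i)) * root_series (Phi \<eta>))) $ d"
      unfolding 1 2 fps_nth_of_int_mult by (simp add: \<kappa>_def)
  qed
  finally show "parabolic_kostka \<gamma> \<mu> \<eta> $ d =
    weyl_sum N (Phi \<eta>) (lookup (delta N + \<gamma>)) (lookup (delta N + \<mu>)) $ d" .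
qed

lemma weyl_sum_cong:
  assumes "\<And>i. i < N \<Longrightarrow> \<kappa> i = \<kappa>' i" "\<And>i. i < N \<Longrightarrow> \<nu> i = \<nu>' i"
  shows "weyl_sum N \<Phi> \<kappa> \<nu> = weyl_sum N \<Phi> \<kappa>' \<nu>'"
  unfolding weyl_sum_def
  by (intro sum.cong refl arg_cong2[where f = "(*)"] arg_cong[where f = ct] arg_cong[where f = fps_const] mon_cong)
     (use assms in auto)

lemma length_rects_mu: "length (rects_mu R) = sum_list (rects_eta R)"
  by (induction R) (auto simp: rects_mu_def rects_eta_def)

lemma kostka_rects_eq_weyl_sum:
  assumes "is_partition xs" and len: "length xs = N" and N: "N = sum_list (rects_eta R)"
  shows "kostka_rects xs R = weyl_sum N (Phi (rects_eta R))
    (\<lambda>i. int (xs ! i) + int (N - 1 - i)) (\<lambda>i. int (rects_mu R ! i) + int (N - 1 - i))"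
proof -
  have v: "vars_lt N (weight_of ys)" if "length ys = N" for ys
    unfolding vars_lt_iff using that by (simp add: weight_of_def nth_default_def)
  have "weight_of xs \<in> dominant_weights N"
    unfolding dominant_weights_def
  proof (intro CollectI conjI allI impI v len)
    fix i j assume "i \<le> j \<and> j < N"
    then show "lookup (weight_of xs) j \<le> lookup (weight_of xs) i"
      using assms(1) len unfolding is_partition_def sorted_wrt_iff_nth_less
      by (cases "i = j") (auto simp: weight_of_def nth_default_def)
  qed
  then show ?thesis
    using parabolic_kostka_eq_weyl_sum[of "weight_of (rects_mu R)" "rects_eta R" "weight_of xs"]
      v[of "rects_mu R"] len N
    by (auto simp: kostka_rects_def length_rects_mu lookup_add lookup_delta weight_of_def nth_default_def
        intro!: weyl_sum_cong)
qed

text \<open>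
  Both shifts multiply by powers of the product of all variables, which no permutation changes.
\<close>

lemma weyl_sum_shift:
  "weyl_sum N \<Phi> (\<lambda>i. \<kappa> i + c) (\<lambda>i. \<nu> i + c) = weyl_sum N \<Phi> \<kappa> \<nu>"
  unfolding weyl_sum_def
proof (rule sum.cong[OF refl])
  fix w assume "w \<in> {w. w permutes {..<N}}"
  then have w: "w permutes {..<N}" by simp
  have "mon N w (\<lambda>i. - c) = mon N id (\<lambda>i. - c)"
    using mon_permutes[OF w, of id "\<lambda>i. - c"] by simp
  moreover have "mon N id (\<lambda>i. \<nu> i + c) = mon N id \<nu> * mon N id (\<lambda>i. c)"
    by (simp only: mon_mult)
  moreover have "mon N w (\<lambda>i. - (\<kappa> i + c)) = mon N w (\<lambda>i. - \<kappa> i) * mon N w (\<lambda>i. - c)"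
    by (simp add: mon_mult)
  ultimately have "mon N id (\<lambda>i. \<nu> i + c) * mon N w (\<lambda>i. - (\<kappa> i + c)) =
     mon N id \<nu> * mon N w (\<lambda>i. - \<kappa> i) * (mon N id (\<lambda>i. c) * mon N id (\<lambda>i. - c))"
    by (simp only: mult_ac)
  also have "mon N id (\<lambda>i. c) * mon N id (\<lambda>i. - c) = 1"
    by (simp add: mon_mult)
  finally show "of_int (sign w) * ct (fps_const (mon N id (\<lambda>i. \<nu> i + c) * mon N w (\<lambda>i. - (\<kappa> i + c))) * root_series \<Phi>)
    = of_int (sign w) * ct (fps_const (mon N id \<nu> * mon N w (\<lambda>i. - \<kappa> i)) * root_series \<Phi>)"
    by (simp only: mult_1_right)
qed

section \<open>Separated groups of variables\<close>

definition partial_deg :: "nat set \<Rightarrow> weight \<Rightarrow> int" where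
  "partial_deg S \<gamma> = (\<Sum>i\<in>S. lookup \<gamma> i)"

lemma partial_deg_add: "partial_deg S (a + b) = partial_deg S a + partial_deg S b"
  by (simp add: partial_deg_def lookup_add sum.distrib)

lemma partial_deg_diff: "partial_deg S (a - b) = partial_deg S a - partial_deg S b"
  by (simp add: partial_deg_def lookup_minus sum_subtractf)

lemma partial_deg_0 [simp]: "partial_deg S 0 = 0"
  by (simp add: partial_deg_def)

lemma partial_deg_single: "finite S \<Longrightarrow> partial_deg S (single i c) = (if i \<in> S then c else 0)"
  by (simp add: partial_deg_def lookup_single when_def)

lemma partial_deg_sum: "partial_deg S (\<Sum>i\<in>I. f i) = (\<Sum>i\<in>I. partial_deg S (f i))"
  by (induction I rule: infinite_finite_induct) (auto simp: partial_deg_add)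

text \<open>
  Each exchange of an index below \<open>a\<close> for another one decreases the sum by at least \<open>g\<close>.
\<close>

lemma sum_exchange_le:
  fixes \<kappa> :: "nat \<Rightarrow> int"
  assumes S: "S \<subseteq> {..<N}" "card S = a" "S \<noteq> {..<a}" and "0 \<le> g"
    and hi: "\<And>i. i < a \<Longrightarrow> \<theta> \<le> \<kappa> i" and lo: "\<And>i. a \<le> i \<Longrightarrow> i < N \<Longrightarrow> \<kappa> i \<le> \<theta> - g"
  shows "sum \<kappa> S \<le> sum \<kappa> {..<a} - g"
proof -
  have fin: "finite S" using S(1) finite_subset by blast
  define A B where "A = {..<a} - S" and "B = S - {..<a}"
  have fAB: "finite A" "finite B" using fin by (auto simp: A_def B_def)
  have "card A = card B"
    using card_Diff_subset_Int[of "{..<a}" S] card_Diff_subset_Int[of S "{..<a}"] fin S(2)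
    by (simp add: A_def B_def Int_commute)
  moreover have "B \<noteq> {}"
  proof
    assume "B = {}"
    then have "S \<subseteq> {..<a}" by (auto simp: B_def)
    then show False using card_subset_eq[of "{..<a}" S] S by simp
  qed
  ultimately have c: "1 \<le> card B" "card A = card B" using fAB by (auto simp: Suc_le_eq card_gt_0_iff)
  have "sum \<kappa> {..<a} = sum \<kappa> ({..<a} \<inter> S) + sum \<kappa> A"
    unfolding A_def by (rule sum.Int_Diff) simp
  moreover have "sum \<kappa> S = sum \<kappa> ({..<a} \<inter> S) + sum \<kappa> B"
    unfolding B_def using sum.Int_Diff[OF fin, of \<kappa> "{..<a}"] by (simp add: Int_commute)
  moreover have "(\<Sum>i\<in>A. \<theta>) \<le> sum \<kappa> A" by (rule sum_mono) (auto simp: A_def hi)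
  moreover have "sum \<kappa> B \<le> (\<Sum>i\<in>B. \<theta> - g)" by (rule sum_mono) (use S in \<open>auto simp: B_def intro!: lo\<close>)
  moreover have "g \<le> int (card B) * g"
    using c \<open>0 \<le> g\<close> mult_right_mono[of 1 "int (card B)" g] by simp
  ultimately show ?thesis using c by (simp add: algebra_simps)
qed

text \<open>
  The degree in the first \<open>a\<close> variables is nonnegative on the monomials of the root series. On the
  monomial in front it equals the sum of \<open>\<nu>\<close> over the first \<open>a\<close> indices minus the sum of \<open>\<kappa>\<close> over the preimage
  of these indices under \<open>w\<close>, which is positive by \<open>sum_exchange_le\<close>.
\<close>

lemma ct_eq_0_unless_stabilizing:
  fixes \<kappa> \<nu> :: "nat \<Rightarrow> int"
  assumes w: "w permutes {..<N}" "w ` {..<a} \<noteq> {..<a}" and "a \<le> N" "0 \<le> g"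
    and \<Phi>: "\<And>i j. (i, j) \<in> \<Phi> \<Longrightarrow> i < j"
    and hi: "\<And>i. i < a \<Longrightarrow> \<theta> \<le> \<kappa> i" and lo: "\<And>i. a \<le> i \<Longrightarrow> i < N \<Longrightarrow> \<kappa> i \<le> \<theta> - g"
    and gap: "sum \<kappa> {..<a} < sum \<nu> {..<a} + g"
  shows "ct (fps_const (mon N id \<nu> * mon N w (\<lambda>i. - \<kappa> i)) * root_series \<Phi>) = 0"
proof -
  define S where "S = {i\<in>{..<N}. w i < a}"
  have inj: "inj w" by (rule permutes_inj[OF w(1)])
  have img: "w ` S = {..<a}"
  proof -
    have "x \<in> w ` S" if "x < a" for x
    proof -
      have "x < N" using that \<open>a \<le> N\<close> by simp
      then obtain i where "i < N" "w i = x"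
        using permutes_image[OF w(1)] by (metis imageE lessThan_iff)
      then show ?thesis using that by (auto simp: S_def)
    qed
    then show ?thesis by (auto simp: S_def)
  qed
  have "card S = a" using card_image[of w S] inj img by (simp add: inj_on_subset)
  moreover have "S \<noteq> {..<a}" using img w(2) by auto
  ultimately have S: "sum \<kappa> S \<le> sum \<kappa> {..<a} - g"
    using \<open>0 \<le> g\<close> hi lo by (intro sum_exchange_le[of S N a g \<theta>]) (auto simp: S_def)
  let ?D = "partial_deg {..<a}"
  have "?D (\<Sum>i<N. single (w i) (- \<kappa> i)) = (\<Sum>i<N. if w i < a then - \<kappa> i else 0)"
    by (simp add: partial_deg_sum partial_deg_single)
  also have "\<dots> = - sum \<kappa> S"
    by (simp add: S_def sum.If_cases sum_negf Int_def)
  finally have 1: "?D (\<Sum>i<N. single (w i) (- \<kappa> i)) = - sum \<kappa> S" .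
  have "?D (\<Sum>i<N. single i (\<nu> i)) = (\<Sum>i<N. if i < a then \<nu> i else 0)"
    by (simp add: partial_deg_sum partial_deg_single)
  also have "\<dots> = sum \<nu> {..<a}"
    using \<open>a \<le> N\<close> by (intro sum.mono_neutral_cong_right) auto
  finally have 2: "?D (\<Sum>i<N. single i (\<nu> i)) = sum \<nu> {..<a}" .
  have r: "fsupp (\<lambda>\<gamma>. 0 \<le> ?D \<gamma>) (root_series \<Phi>)"
    by (rule fsupp_root_series) (use \<Phi> in \<open>force simp: partial_deg_add partial_deg_diff partial_deg_single\<close>)+
  have m: "fsupp (\<lambda>\<gamma>. 0 < ?D \<gamma>) (fps_const (mon N id \<nu> * mon N w (\<lambda>i. - \<kappa> i)))"
    using S gap by (intro fsupp_const) (simp add: mon_eq_xmon partial_deg_add 1 2 flip: xmon_add)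
  have "fsupp (\<lambda>\<gamma>. 0 < ?D \<gamma>) (fps_const (mon N id \<nu> * mon N w (\<lambda>i. - \<kappa> i)) * root_series \<Phi>)"
    by (rule fsupp_mult[OF m r]) (simp add: partial_deg_add)
  then show ?thesis by (rule ct_eq_0) simp
qed

definition shift_perm :: "nat \<Rightarrow> (nat \<Rightarrow> nat) \<Rightarrow> nat \<Rightarrow> nat" where
  "shift_perm s r i = (if i < s then i else s + r (i - s))"

lemma shift_perm_permutes:
  assumes r: "r permutes {..<b}"
  shows "shift_perm s r permutes {s..<s + b}" "shift_perm s r permutes {..<s + b}"
    and "sign (shift_perm s r) = sign r"
proof -
  have img: "(+) s ` {..<b} = {s..<s + b}"
    by (simp add: lessThan_atLeast0 add.commute)
  have eq: "map_permutation {..<b} ((+) s) r = shift_perm s r"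
  proof
    fix i
    show "map_permutation {..<b} ((+) s) r i = shift_perm s r i"
    proof (cases "i \<in> {s..<s + b}")
      case True
      then obtain j where j: "i = s + j" "j < b" by (metis img imageE lessThan_iff)
      then show ?thesis
        by (simp add: map_permutation_apply shift_perm_def)
    next
      case False
      then show ?thesis
        using permutes_not_in[OF r, of "i - s"]
        by (auto simp: map_permutation_def restrict_id_def img shift_perm_def)
    qed
  qed
  show p: "shift_perm s r permutes {s..<s + b}"
    using map_permutation_permutes[of "(+) s" "{..<b}" "{s..<s + b}" r] r img
    by (simp add: eq bij_betw_def)
  show "shift_perm s r permutes {..<s + b}"
    by (rule permutes_subset[OF p]) auto
  show "sign (shift_perm s r) = sign r"
    using sign_map_permutation[of "(+) s" "{..<b}" r] r by (simp add: eq)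
qed

text \<open>
  Permutations that stabilize \<open>{..<a}\<close> are pairs of a permutation of this set and one of its
  complement.
\<close>

lemma sum_block_permutations:
  "(\<Sum>w | w permutes {..<a + b} \<and> w ` {..<a} = {..<a}. f w) =
    (\<Sum>p | p permutes {..<a}. \<Sum>r | r permutes {..<b}. f (p \<circ> shift_perm a r))"
proof -
  define lo where "lo w i = (if i < a then w i else i)" for w :: "nat \<Rightarrow> nat" and i
  define up where "up w i = (if i < b then w (a + i) - a else i)" for w :: "nat \<Rightarrow> nat" and i
  have "(\<Sum>w | w permutes {..<a + b} \<and> w ` {..<a} = {..<a}. f w) =
    (\<Sum>(p, r)\<in>{p. p permutes {..<a}} \<times> {r. r permutes {..<b}}. f (p \<circ> shift_perm a r))"
  proof (rule sum.reindex_bij_witness[of _ "\<lambda>(p, r). p \<circ> shift_perm a r" "\<lambda>w. (lo w, up w)"])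
    fix w assume "w \<in> {w. w permutes {..<a + b} \<and> w ` {..<a} = {..<a}}"
    then have w: "w permutes {..<a + b}" and wa: "w ` {..<a} = {..<a}" by auto
    have inj: "inj w" by (rule permutes_inj[OF w])
    have lt: "w i < a \<longleftrightarrow> i < a" for i
      using wa inj by (metis image_eqI imageE injD lessThan_iff)
    have ltb: "w i < a + b \<longleftrightarrow> i < a + b" for i
      using permutes_in_image[OF w, of i] by simp
    have 1: "lo w permutes {..<a}"
    proof (rule bij_imp_permutes)
      have "inj_on (lo w) {..<a}" by (auto simp: lo_def inj_on_def dest: injD[OF inj])
      moreover have "lo w ` {..<a} = {..<a}" using wa by (auto simp: lo_def)
      ultimately show "bij_betw (lo w) {..<a} {..<a}" by (simp add: bij_betw_def)
    qed (simp add: lo_def)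
    have 2: "up w permutes {..<b}"
    proof (rule inj_imp_permutes)
      show "inj_on (up w) {..<b}"
      proof (rule inj_onI)
        fix i j assume ij: "i \<in> {..<b}" "j \<in> {..<b}" "up w i = up w j"
        have "a \<le> w (a + i)" "a \<le> w (a + j)" using lt[of "a + i"] lt[of "a + j"] by auto
        then have "w (a + i) = w (a + j)" using ij by (auto simp: up_def)
        then show "i = j" using injD[OF inj] by fastforce
      qed
      show "up w i \<in> {..<b}" if "i \<in> {..<b}" for i
        using that ltb[of "a + i"] lt[of "a + i"] by (auto simp: up_def)
    qed (auto simp: up_def)
    show "(lo w, up w) \<in> {p. p permutes {..<a}} \<times> {r. r permutes {..<b}}" using 1 2 by simp
    show "(case (lo w, up w) of (p, r) \<Rightarrow> p \<circ> shift_perm a r) = w"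
    proof
      fix i
      have "w i = i" if "\<not> i < a + b" using permutes_not_in[OF w, of i] that by simp
      then show "(case (lo w, up w) of (p, r) \<Rightarrow> p \<circ> shift_perm a r) i = w i"
        using lt[of i] by (auto simp: shift_perm_def lo_def up_def)
    qed
    then show "(case (lo w, up w) of (p, r) \<Rightarrow> f (p \<circ> shift_perm a r)) = f w" by simp
  next
    fix z assume "z \<in> {p. p permutes {..<a}} \<times> {r. r permutes {..<b}}"
    then obtain p r where z: "z = (p, r)" and p: "p permutes {..<a}" and r: "r permutes {..<b}" by auto
    have pa: "p permutes {..<a + b}" by (rule permutes_subset[OF p]) auto
    have "p \<circ> shift_perm a r permutes {..<a + b}"
      by (rule permutes_compose[OF shift_perm_permutes(2)[OF r] pa])
    moreover have "(p \<circ> shift_perm a r) ` {..<a} = p ` {..<a}"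
      by (intro image_cong) (auto simp: shift_perm_def)
    ultimately show "(case z of (p, r) \<Rightarrow> p \<circ> shift_perm a r) \<in>
        {w. w permutes {..<a + b} \<and> w ` {..<a} = {..<a}}"
      using permutes_image[OF p] by (simp add: z)
    have "p i = i" if "\<not> i < a" for i using permutes_not_in[OF p, of i] that by simp
    moreover have "r i = i" if "\<not> i < b" for i using permutes_not_in[OF r, of i] that by simp
    ultimately show "(lo (case z of (p, r) \<Rightarrow> p \<circ> shift_perm a r), up (case z of (p, r) \<Rightarrow> p \<circ> shift_perm a r)) = z"
      by (auto simp: z lo_def up_def shift_perm_def fun_eq_iff)
  qed
  then show ?thesis by (simp add: sum.cartesian_product)
qed

lemma prod_lessThan_add:
  "(\<Prod>i<a + b. f i) = (\<Prod>i<a. f i) * (\<Prod>i<b. f (a + i :: nat) :: 'a::comm_monoid_mult)"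
  by (induction b) (simp_all add: mult_ac)

lemma mon_split: "mon (a + b) v e = mon a v e * mon b (\<lambda>i. v (a + i)) (\<lambda>i. e (a + i))"
  by (simp add: mon_def prod_lessThan_add)

lemma sign_block_permutation:
  assumes "p permutes {..<a}" "r permutes {..<b}"
  shows "sign (p \<circ> shift_perm a r) = sign p * sign r"
  using assms shift_perm_permutes[OF assms(2), of a]
  by (subst sign_compose) (auto intro: permutes_imp_permutation[rotated])

lemma sum_stabilizing:
  assumes "\<And>w. w permutes {..<a + b} \<Longrightarrow> w ` {..<a} \<noteq> {..<a} \<Longrightarrow> f w = 0"
  shows "(\<Sum>w | w permutes {..<a + b}. f w) =
    (\<Sum>p | p permutes {..<a}. \<Sum>r | r permutes {..<b}. f (p \<circ> shift_perm a r))"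
proof -
  have "(\<Sum>w | w permutes {..<a + b}. f w) = (\<Sum>w | w permutes {..<a + b} \<and> w ` {..<a} = {..<a}. f w)"
    using assms by (intro sum.mono_neutral_right) (auto simp: finite_permutations)
  then show ?thesis by (simp only: sum_block_permutations)
qed

lemma mon_block_permutation:
  assumes "r permutes {..<b}"
  shows "mon (a + b) (p \<circ> shift_perm a r) e = mon a p e * mon b (\<lambda>i. p (a + r i)) (\<lambda>i. e (a + i))"
  unfolding mon_split by (intro arg_cong2[where f = "(*)"] mon_cong) (auto simp: shift_perm_def)

section \<open>Products of Kostka polynomials\<close>

definition shift_weight :: "nat \<Rightarrow> weight \<Rightarrow> weight" where
  "shift_weight a \<gamma> = Abs_poly_mapping (\<lambda>i. if i < a then 0 else lookup \<gamma> (i - a))"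

lemma lookup_shift_weight: "lookup (shift_weight a \<gamma>) i = (if i < a then 0 else lookup \<gamma> (i - a))"
proof -
  have "{i. (if i < a then 0 else lookup \<gamma> (i - a)) \<noteq> 0} \<subseteq> (+) a ` keys \<gamma>"
  proof
    fix i assume "i \<in> {i. (if i < a then 0 else lookup \<gamma> (i - a)) \<noteq> 0}"
    then have "i = a + (i - a)" "i - a \<in> keys \<gamma>" by (auto simp: in_keys_iff split: if_splits)
    then show "i \<in> (+) a ` keys \<gamma>" by blast
  qed
  then have "finite {i. (if i < a then 0 else lookup \<gamma> (i - a)) \<noteq> 0}"
    by (rule finite_subset) simp
  then show ?thesis by (simp add: shift_weight_def)
qed

lemma shift_weight_add: "shift_weight a (x + y) = shift_weight a x + shift_weight a y"
  by (rule poly_mapping_eqI) (simp add: lookup_shift_weight lookup_add)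

lemma shift_weight_0: "shift_weight a 0 = 0"
  by (rule poly_mapping_eqI) (simp add: lookup_shift_weight)

lemma shift_weight_single: "shift_weight a (single i c) = single (a + i) c"
  by (rule poly_mapping_eqI) (auto simp: lookup_shift_weight lookup_single when_def)

lemma shift_weight_diff: "shift_weight a (x - y) = shift_weight a x - shift_weight a y"
  by (rule poly_mapping_eqI) (simp add: lookup_shift_weight lookup_minus)

lemma inj_shift_weight: "inj (shift_weight a)"
proof (rule injI)
  fix x y assume "shift_weight a x = shift_weight a y"
  then have "lookup (shift_weight a x) (a + i) = lookup (shift_weight a y) (a + i)" for i by simp
  then show "x = y" by (intro poly_mapping_eqI) (simp add: lookup_shift_weight)
qed

lemma wmap_shift_mon: "wmap (shift_weight a) (mon b v e) = mon b (\<lambda>i. a + v i) e"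
  by (simp add: mon_def wmap_prod[OF shift_weight_add] shift_weight_single)

lemma fps_wmap_shift_root_series:
  "fps_wmap (shift_weight a) (root_series \<Phi>) = root_series ((\<lambda>(i, j). (a + i, a + j)) ` \<Phi>)"
proof -
  have "inj_on (\<lambda>(i, j). (a + i, a + j)) \<Phi>" by (auto simp: inj_on_def)
  then show ?thesis
    by (simp add: root_series_def fps_wmap_prod[OF shift_weight_add] prod.reindex case_prod_unfold
        fps_wmap_geo[OF shift_weight_add] shift_weight_diff shift_weight_single)
qed

abbreviation vars_ge :: "nat \<Rightarrow> weight \<Rightarrow> bool" where
  "vars_ge a \<gamma> \<equiv> (\<forall>i<a. lookup \<gamma> i = 0)"

lemma vars_lt_sum: "(\<And>i. i \<in> S \<Longrightarrow> vars_lt n (f i)) \<Longrightarrow> vars_lt n (sum f S)"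
  unfolding vars_lt_iff lookup_sum by (auto intro: sum.neutral)

lemma lookup_mult_disjoint:
  assumes "supp (vars_lt a) f" "supp (vars_ge a) g"
  shows "lookup (f * g) 0 = lookup f 0 * lookup g 0"
proof -
  have "f * g = (\<Sum>\<gamma>\<in>keys f. of_int (lookup f \<gamma>) * (xmon \<gamma> * g))"
  proof -
    have "f * g = (\<Sum>\<gamma>\<in>keys f. of_int (lookup f \<gamma>) * xmon \<gamma>) * g"
      using laurent_expand[of "keys f" f] by simp
    then show ?thesis by (simp add: sum_distrib_right mult.assoc)
  qed
  then have "lookup (f * g) 0 = (\<Sum>\<gamma>\<in>keys f. lookup f \<gamma> * lookup g (- \<gamma>))"
    by (simp add: lookup_sum lookup_of_int_mult lookup_xmon_mult)
  also have "\<dots> = (\<Sum>\<gamma>\<in>keys f. if \<gamma> = 0 then lookup f 0 * lookup g 0 else 0)"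
  proof (rule sum.cong[OF refl])
    fix \<gamma> assume "\<gamma> \<in> keys f"
    then have f: "\<forall>i\<ge>a. lookup \<gamma> i = 0" using assms(1) unfolding supp_def vars_lt_iff by blast
    show "lookup f \<gamma> * lookup g (- \<gamma>) = (if \<gamma> = 0 then lookup f 0 * lookup g 0 else 0)"
    proof (cases "- \<gamma> \<in> keys g")
      case True
      then have "\<forall>i<a. lookup \<gamma> i = 0" using assms(2) by (force simp: supp_def)
      then have "\<gamma> = 0" using f by (intro poly_mapping_eqI) (metis lookup_zero not_le)
      then show ?thesis by simp
    qed (auto simp: in_keys_iff)
  qed
  also have "\<dots> = lookup f 0 * lookup g 0" by (simp add: in_keys_iff)
  finally show ?thesis .
qed

lemma ct_mult_disjoint:
  assumes "fsupp (vars_lt a) F" "fsupp (vars_ge a) G"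
  shows "ct (F * G) = ct F * ct G"
  using assms by (intro fps_ext) (simp add: fps_mult_nth lookup_sum fsupp_def lookup_mult_disjoint[of a])

lemma geo_Suc: "geo u = 1 + fps_X * fps_const u * geo u"
  using geo_inverse[of u] by (simp add: algebra_simps)

lemma root_series_minus_1:
  assumes "finite \<Phi>" "\<And>i j. (i, j) \<in> \<Phi> \<Longrightarrow> i < a \<and> a \<le> j"
  obtains E where "root_series \<Phi> = 1 + E" "fsupp (\<lambda>\<gamma>. 1 \<le> partial_deg {..<a} \<gamma>) E"
proof -
  let ?D = "partial_deg {..<a}"
  have "\<exists>E. root_series \<Phi> = 1 + E \<and> fsupp (\<lambda>\<gamma>. 1 \<le> ?D \<gamma>) E"
    using assms
  proof (induction \<Phi> rule: finite_induct)
    case empty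
    show ?case by (rule exI[of _ 0]) (simp add: root_series_def fsupp_def)
  next
    case (insert z \<Phi>)
    obtain i j where z: "z = (i, j)" by force
    obtain E where E: "root_series \<Phi> = 1 + E" "fsupp (\<lambda>\<gamma>. 1 \<le> ?D \<gamma>) E"
      using insert by blast
    define \<gamma> :: weight where "\<gamma> = single i 1 - single j 1"
    have D: "?D \<gamma> = 1" using insert.prems[of i j] by (simp add: z \<gamma>_def partial_deg_diff partial_deg_single)
    define H where "H = fps_X * fps_const (xmon \<gamma>) * geo (xmon \<gamma>)"
    have "fsupp (\<lambda>\<gamma>. 0 \<le> ?D \<gamma>) (geo (xmon \<gamma>))"
      by (rule fsupp_geo) (auto simp: partial_deg_add D)
    moreover have "fsupp (\<lambda>\<gamma>. 1 \<le> ?D \<gamma>) (fps_const (xmon \<gamma>))"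
      by (rule fsupp_const) (simp add: D)
    ultimately have "fsupp (\<lambda>\<gamma>. 1 \<le> ?D \<gamma>) (fps_const (xmon \<gamma>) * geo (xmon \<gamma>))"
      by (intro fsupp_mult[of "\<lambda>\<gamma>. 1 \<le> ?D \<gamma>" _ "\<lambda>\<gamma>. 0 \<le> ?D \<gamma>"]) (auto simp: partial_deg_add)
    then have H: "fsupp (\<lambda>\<gamma>. 1 \<le> ?D \<gamma>) H"
      unfolding H_def fsupp_def mult.assoc by (auto simp: fps_X_mult_nth)
    have "root_series (insert z \<Phi>) = (1 + H) * (1 + E)"
      using insert.hyps E(1) geo_Suc[of "xmon \<gamma>"] by (simp add: root_series_def z H_def \<gamma>_def)
    also have "\<dots> = 1 + (H + E + H * E)" by (simp add: algebra_simps)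
    finally show ?case
      using H E(2)
      by (intro exI[of _ "H + E + H * E"] conjI fsupp_add fsupp_mult[of "\<lambda>\<gamma>. 1 \<le> ?D \<gamma>" _ "\<lambda>\<gamma>. 1 \<le> ?D \<gamma>"])
         (auto simp: partial_deg_add)
  qed
  then show thesis using that by blast
qed

text \<open>
  Every term of the root series but the constant term 1 has positive degree in the first \<open>a\<close>
  variables, and nothing in \<open>F\<close> can compensate for it.
\<close>

lemma ct_mult_root_series_across:
  assumes "fsupp (\<lambda>\<gamma>. partial_deg {..<a} \<gamma> = 0) F"
    and "finite \<Phi>" "\<And>i j. (i, j) \<in> \<Phi> \<Longrightarrow> i < a \<and> a \<le> j"
  shows "ct (F * root_series \<Phi>) = ct F"
proof -
  obtain E where E: "root_series \<Phi> = 1 + E" "fsupp (\<lambda>\<gamma>. 1 \<le> partial_deg {..<a} \<gamma>) E"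
    using root_series_minus_1[OF assms(2,3)] .
  have "fsupp (\<lambda>\<gamma>. 1 \<le> partial_deg {..<a} \<gamma>) (F * E)"
    by (rule fsupp_mult[OF assms(1) E(2)]) (simp add: partial_deg_add)
  then have "ct (F * E) = 0" by (rule ct_eq_0) simp
  then show ?thesis by (simp add: E(1) algebra_simps ct_add)
qed

lemma root_series_Un:
  "finite A \<Longrightarrow> finite B \<Longrightarrow> A \<inter> B = {} \<Longrightarrow> root_series (A \<union> B) = root_series A * root_series B"
  unfolding root_series_def by (rule prod.union_disjoint)

text \<open>
  A gap of 1 in \<open>\<kappa>\<close> is enough here, because \<open>\<kappa>\<close> and \<open>\<nu>\<close> have the same partial sum. For a block
  permutation the part of the constant term without the crossing roots has degree 0 in the first
  group, so that the crossing roots disappear and the two groups have no variable in common.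
\<close>

lemma weyl_sum_product:
  fixes \<kappa> \<nu> :: "nat \<Rightarrow> int"
  assumes \<Phi>: "\<Phi> = \<Phi>1 \<union> (\<lambda>(i, j). (a + i, a + j)) ` \<Phi>2 \<union> {..<a} \<times> {a..<a + b}"
    and \<Phi>1: "finite \<Phi>1" "\<And>i j. (i, j) \<in> \<Phi>1 \<Longrightarrow> i < j \<and> j < a"
    and \<Phi>2: "finite \<Phi>2" "\<And>i j. (i, j) \<in> \<Phi>2 \<Longrightarrow> i < j \<and> j < b"
    and hi: "\<And>i. i < a \<Longrightarrow> \<theta> \<le> \<kappa> i" and lo: "\<And>i. a \<le> i \<Longrightarrow> i < a + b \<Longrightarrow> \<kappa> i < \<theta>"
    and sums: "sum \<kappa> {..<a} = sum \<nu> {..<a}"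
  shows "weyl_sum (a + b) \<Phi> \<kappa> \<nu> = weyl_sum a \<Phi>1 \<kappa> \<nu> * weyl_sum b \<Phi>2 (\<lambda>i. \<kappa> (a + i)) (\<lambda>i. \<nu> (a + i))"
proof -
  define t where "t w = of_int (sign w) * ct (fps_const (mon (a + b) id \<nu> * mon (a + b) w (\<lambda>i. - \<kappa> i)) * root_series \<Phi>)" for w
  define t1 where "t1 p = fps_const (mon a id \<nu> * mon a p (\<lambda>i. - \<kappa> i)) * root_series \<Phi>1" for p
  define t2 where "t2 r = fps_const (mon b id (\<lambda>i. \<nu> (a + i)) * mon b r (\<lambda>i. - \<kappa> (a + i))) * root_series \<Phi>2" for r
  define \<Phi>X where "\<Phi>X = {..<a} \<times> {a..<a + b}"
  have \<Phi>_lt: "i < j" if "(i, j) \<in> \<Phi>" for i j using that \<Phi>1(2) \<Phi>2(2) by (auto simp: \<Phi>)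
  have series: "root_series \<Phi> = root_series \<Phi>1 * fps_wmap (shift_weight a) (root_series \<Phi>2) * root_series \<Phi>X"
  proof -
    have "\<Phi>1 \<inter> (\<lambda>(i, j). (a + i, a + j)) ` \<Phi>2 = {}" using \<Phi>1(2) \<Phi>2(2) by fastforce
    moreover have "(\<Phi>1 \<union> (\<lambda>(i, j). (a + i, a + j)) ` \<Phi>2) \<inter> \<Phi>X = {}"
      using \<Phi>1(2) \<Phi>2(2) by (fastforce simp: \<Phi>X_def)
    ultimately show ?thesis
      unfolding fps_wmap_shift_root_series \<Phi> \<Phi>X_def[symmetric] using \<Phi>1(1) \<Phi>2(1)
      by (simp add: root_series_Un \<Phi>X_def)
  qed
  have "weyl_sum (a + b) \<Phi> \<kappa> \<nu> = (\<Sum>w | w permutes {..<a + b}. t w)"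
    by (simp add: weyl_sum_def t_def)
  also have "\<dots> = (\<Sum>p | p permutes {..<a}. \<Sum>r | r permutes {..<b}. t (p \<circ> shift_perm a r))"
  proof (rule sum_stabilizing)
    fix w assume w: "w permutes {..<a + b}" "w ` {..<a} \<noteq> {..<a}"
    have "ct (fps_const (mon (a + b) id \<nu> * mon (a + b) w (\<lambda>i. - \<kappa> i)) * root_series \<Phi>) = 0"
      by (rule ct_eq_0_unless_stabilizing[OF w, of 1 _ \<theta>])
         (use \<Phi>_lt hi sums in \<open>auto simp: zle_diff1_eq intro: lo\<close>)
    then show "t w = 0" by (simp add: t_def)
  qed
  also have "\<dots> = (\<Sum>p | p permutes {..<a}. \<Sum>r | r permutes {..<b}.
      (of_int (sign p) * ct (t1 p)) * (of_int (sign r) * ct (t2 r)))"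
  proof (intro sum.cong refl)
    fix p r assume "p \<in> {p. p permutes {..<a}}" "r \<in> {r. r permutes {..<b}}"
    then have p: "p permutes {..<a}" and r: "r permutes {..<b}" by auto
    have pa: "p (a + i) = a + i" for i using permutes_not_in[OF p, of "a + i"] by simp
    have monw: "mon (a + b) (p \<circ> shift_perm a r) (\<lambda>i. - \<kappa> i) =
        mon a p (\<lambda>i. - \<kappa> i) * wmap (shift_weight a) (mon b r (\<lambda>i. - \<kappa> (a + i)))"
      by (simp add: mon_block_permutation[OF r] wmap_shift_mon pa)
    have monid: "mon (a + b) id \<nu> = mon a id \<nu> * wmap (shift_weight a) (mon b id (\<lambda>i. \<nu> (a + i)))"
      by (simp add: mon_split wmap_shift_mon)
    have "fps_const (mon (a + b) id \<nu> * mon (a + b) (p \<circ> shift_perm a r) (\<lambda>i. - \<kappa> i)) * root_series \<Phi>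
       = t1 p * fps_wmap (shift_weight a) (t2 r) * root_series \<Phi>X"
      by (simp add: series t1_def t2_def monw monid fps_wmap_mult[OF shift_weight_add]
          fps_wmap_const wmap_mult[OF shift_weight_add] mult_ac flip: fps_const_mult)
    also have "ct \<dots> = ct (t1 p * fps_wmap (shift_weight a) (t2 r))"
    proof (rule ct_mult_root_series_across)
      let ?D = "partial_deg {..<a}"
      have "fsupp (\<lambda>\<gamma>. ?D \<gamma> = 0) (root_series \<Phi>1)"
        by (rule fsupp_root_series)
           (use \<Phi>1(2) in \<open>force simp: partial_deg_add partial_deg_diff partial_deg_single\<close>)+
      moreover have "?D (\<Sum>i<a. single i (\<nu> i)) + ?D (\<Sum>i<a. single (p i) (- \<kappa> i)) = 0"
      proof -
        have pl: "p i < a" if "i < a" for i using permutes_in_image[OF p, of i] that by simp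
        have "?D (\<Sum>i<a. single (p i) (- \<kappa> i)) = (\<Sum>i<a. - \<kappa> i)"
          unfolding partial_deg_sum by (intro sum.cong) (simp_all add: partial_deg_single pl)
        moreover have "?D (\<Sum>i<a. single i (\<nu> i)) = (\<Sum>i<a. \<nu> i)"
          unfolding partial_deg_sum by (intro sum.cong) (auto simp: partial_deg_single)
        ultimately show ?thesis by (simp add: sums sum_negf)
      qed
      ultimately have t1: "fsupp (\<lambda>\<gamma>. ?D \<gamma> = 0) (t1 p)"
        unfolding t1_def
        by (intro fsupp_mult[of "\<lambda>\<gamma>. ?D \<gamma> = 0" _ "\<lambda>\<gamma>. ?D \<gamma> = 0"] fsupp_const)
           (auto simp: mon_eq_xmon partial_deg_add simp flip: xmon_add)
      have "?D (shift_weight a \<gamma>) = 0" for \<gamma>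
        by (simp add: partial_deg_def lookup_shift_weight)
      then have "fsupp (\<lambda>\<gamma>. ?D \<gamma> = 0) (fps_wmap (shift_weight a) (t2 r))"
        using keys_wmap by (fastforce simp: fsupp_def supp_def)
      with t1 show "fsupp (\<lambda>\<gamma>. ?D \<gamma> = 0) (t1 p * fps_wmap (shift_weight a) (t2 r))"
        by (rule fsupp_mult) (simp add: partial_deg_add)
    qed (auto simp: \<Phi>X_def)
    also have "\<dots> = ct (t1 p) * ct (fps_wmap (shift_weight a) (t2 r))"
    proof (rule ct_mult_disjoint)
      have pl: "p i < a" if "i < a" for i using permutes_in_image[OF p, of i] that by simp
      have "vars_lt a (single i 1 - single j 1)" if "(i, j) \<in> \<Phi>1" for i j
        using \<Phi>1(2)[OF that] by (intro vars_lt_root) auto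
      then have "fsupp (vars_lt a) (root_series \<Phi>1)" by (intro fsupp_root_series vars_lt_add) auto
      moreover have "vars_lt a (\<Sum>i<a. single i (\<nu> i) :: weight)" "vars_lt a (\<Sum>i<a. single (p i) (- \<kappa> i) :: weight)"
        by (auto intro!: vars_lt_sum vars_lt_single pl)
      ultimately show "fsupp (vars_lt a) (t1 p)"
        unfolding t1_def
        by (intro fsupp_mult[of "vars_lt a" _ "vars_lt a"] fsupp_const vars_lt_add)
           (simp_all add: mon_eq_xmon vars_lt_add flip: xmon_add)
      show "fsupp (vars_ge a) (fps_wmap (shift_weight a) (t2 r))"
        using keys_wmap by (fastforce simp: fsupp_def supp_def lookup_shift_weight)
    qed
    also have "ct (fps_wmap (shift_weight a) (t2 r)) = ct (t2 r)"
      by (rule ct_fps_wmap) (simp_all add: inj_shift_weight shift_weight_0)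
    finally show "t (p \<circ> shift_perm a r) = (of_int (sign p) * ct (t1 p)) * (of_int (sign r) * ct (t2 r))"
      unfolding t_def sign_block_permutation[OF p r] by (simp only: of_int_mult mult_ac)
  qed
  also have "\<dots> = weyl_sum a \<Phi>1 \<kappa> \<nu> * weyl_sum b \<Phi>2 (\<lambda>i. \<kappa> (a + i)) (\<lambda>i. \<nu> (a + i))"
    by (simp add: weyl_sum_def t1_def t2_def sum_product)
  finally show ?thesis .
qed

lemma Phi_append:
  fixes \<eta>1 \<eta>2 :: "nat list"
  defines "a \<equiv> sum_list \<eta>1" and "b \<equiv> sum_list \<eta>2"
  shows "Phi (\<eta>1 @ \<eta>2) = Phi \<eta>1 \<union> (\<lambda>(i, j). (a + i, a + j)) ` Phi \<eta>2 \<union> {..<a} \<times> {a..<a + b}" (is "?L = ?R")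
proof (intro equalityI subsetI)
  have take_le: "sum_list (take u xs) \<le> sum_list xs" for u and xs :: "nat list"
    using arg_cong[OF append_take_drop_id[of u xs], of sum_list] unfolding sum_list_append by linarith
  fix z assume "z \<in> ?L"
  then obtain i j u where z: "z = (i, j)" "j < a + b" "u \<le> length \<eta>1 + length \<eta>2"
    "i < sum_list (take u (\<eta>1 @ \<eta>2))" "sum_list (take u (\<eta>1 @ \<eta>2)) \<le> j"
    by (auto simp: Phi_def a_def b_def)
  consider "u \<le> length \<eta>1" | "u > length \<eta>1" by linarith
  then show "z \<in> ?R"
  proof cases
    case 1
    then show ?thesis using z take_le[of u \<eta>1] by (cases "j < a") (auto simp: Phi_def a_def b_def)
  next
    case 2
    define v where "v = u - length \<eta>1"
    have v: "i < a + sum_list (take v \<eta>2)" "a + sum_list (take v \<eta>2) \<le> j" "v \<le> length \<eta>2"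
      using 2 z by (auto simp: v_def a_def)
    show ?thesis
    proof (cases "i < a")
      case False
      then have "(i - a, j - a) \<in> Phi \<eta>2"
        using v z by (auto simp: Phi_def b_def intro!: exI[of _ v])
      moreover have "z = (\<lambda>(i, j). (a + i, a + j)) (i - a, j - a)" using False v z by auto
      ultimately show ?thesis by blast
    qed (use v z in auto)
  qed
next
  fix z assume "z \<in> ?R"
  then consider "z \<in> Phi \<eta>1" | i j where "z = (a + i, a + j)" "(i, j) \<in> Phi \<eta>2"
    | i j where "z = (i, j)" "i < a" "a \<le> j" "j < a + b" by auto
  then show "z \<in> ?L"
  proof cases
    case 1
    then obtain i j u where z: "z = (i, j)" "j < a" "u \<le> length \<eta>1" "i < sum_list (take u \<eta>1)" "sum_list (take u \<eta>1) \<le> j"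
      by (auto simp: Phi_def a_def)
    then show ?thesis by (auto simp: Phi_def a_def intro!: exI[of _ u])
  next
    case 2
    then obtain u where "j < b" "u \<le> length \<eta>2" "i < sum_list (take u \<eta>2)" "sum_list (take u \<eta>2) \<le> j"
      by (auto simp: Phi_def b_def)
    then show ?thesis using 2 by (auto simp: Phi_def a_def b_def intro!: exI[of _ "length \<eta>1 + u"])
  next
    case 3
    then show ?thesis by (auto simp: Phi_def a_def b_def intro!: exI[of _ "length \<eta>1"])
  qed
qed

text \<open>
  Realizability by a partition with the maximal number of parts and of the same size as the
  rectangles. These two conditions are what makes partial sums match when two realizations are put
  one after the other. Writing \<open>K = q\<^sup>T * P\<close> with a natural number \<open>T\<close> loses nothing, because \<open>K\<close> is a
  power series and the constant term of \<open>P\<close> is going to be nonzero.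
\<close>

definition kostka_realizable :: "int poly \<Rightarrow> bool" where
  "kostka_realizable P \<longleftrightarrow> (\<exists>xs R T. is_partition xs \<and> dominant_rects R \<and>
     length xs = sum_list (rects_eta R) \<and> sum_list xs = sum_list (rects_mu R) \<and>
     kostka_rects xs R = fps_X ^ T * fps_of_poly P)"

lemma sum_list_map_add: "sum_list (map ((+) c) xs) = length xs * c + sum_list (xs :: nat list)"
  by (induction xs) auto

text \<open>
  The partition and the rectangles of the first factor are raised by \<open>c\<close>, which is at least as large
  as all parts of the second factor, so that the concatenations are again decreasing.
\<close>

lemma kostka_realizable_mult:
  assumes "kostka_realizable P" "kostka_realizable Q"
  shows "kostka_realizable (P * Q)"
proof -
  obtain xs R S where P: "is_partition xs" "dominant_rects R" "length xs = sum_list (rects_eta R)"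
    "sum_list xs = sum_list (rects_mu R)" "kostka_rects xs R = fps_X ^ S * fps_of_poly P"
    using assms(1) unfolding kostka_realizable_def by blast
  obtain ys R' T where Q: "is_partition ys" "dominant_rects R'" "length ys = sum_list (rects_eta R')"
    "sum_list ys = sum_list (rects_mu R')" "kostka_rects ys R' = fps_X ^ T * fps_of_poly Q"
    using assms(2) unfolding kostka_realizable_def by blast
  define c where "c = sum_list ys + sum_list (map fst R')"
  define zs where "zs = map ((+) c) xs @ ys"
  define U where "U = map (\<lambda>(m, h). (c + m, h)) R @ R'"
  define a b where "a = sum_list (rects_eta R)" and "b = sum_list (rects_eta R')"
  have c_ys: "y \<le> c" if "y \<in> set ys" for y
    using member_le_sum_list[OF that] by (simp add: c_def)
  have c_R': "m \<le> c" if "(m, h) \<in> set R'" for m h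
    using member_le_sum_list[of m "map fst R'"] that by (force simp: c_def)
  have eta: "rects_eta U = rects_eta R @ rects_eta R'"
    by (auto simp: U_def rects_eta_def)
  have mu: "rects_mu U = map ((+) c) (rects_mu R) @ rects_mu R'"
    by (auto simp: U_def rects_mu_def map_concat o_def case_prod_unfold)
  have zs: "is_partition zs"
    unfolding is_partition_def zs_def
  proof (intro conjI ballI)
    have "sorted_wrt (\<ge>) (map ((+) c) xs)" "sorted_wrt (\<ge>) ys"
      using P(1) Q(1) by (simp_all add: is_partition_def sorted_wrt_map)
    moreover have "y \<le> c + x" if "y \<in> set ys" for x y
      using c_ys[OF that] by simp
    ultimately show "sorted_wrt (\<ge>) (map ((+) c) xs @ ys)"
      by (auto simp: sorted_wrt_append)
    show "0 < x" if "x \<in> set (map ((+) c) xs @ ys)" for x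
      using that P(1) Q(1) by (auto simp: is_partition_def)
  qed
  have U: "dominant_rects U"
    unfolding dominant_rects_def
  proof (intro conjI ballI)
    have "sorted_wrt (\<ge>) (map ((+) c) (map fst R))" "sorted_wrt (\<ge>) (map fst R')"
      using P(2) Q(2) by (simp_all add: dominant_rects_def sorted_wrt_map)
    moreover have "map fst U = map ((+) c) (map fst R) @ map fst R'"
      by (auto simp: U_def)
    moreover have "m \<le> c + x" if "m \<in> fst ` set R'" for m x
      using that c_R' by (auto intro: trans_le_add1)
    ultimately show "sorted_wrt (\<ge>) (map fst U)"
      by (auto simp: sorted_wrt_append)
    show "case z of (m, h) \<Rightarrow> 0 < m \<and> 0 < h" if "z \<in> set U" for z
      using that P(2) Q(2) by (auto simp: dominant_rects_def U_def)
  qed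
  have len: "length zs = a + b" "sum_list (rects_eta U) = a + b"
    using P(3) Q(3) by (simp_all add: zs_def eta a_def b_def)
  have sums: "sum_list zs = sum_list (rects_mu U)"
    using P(3,4) Q(4) by (simp add: zs_def mu sum_list_map_add length_rects_mu)
  define \<kappa> where "\<kappa> i = int (zs ! i) + int (a + b - 1 - i)" for i
  define \<nu> where "\<nu> i = int (rects_mu U ! i) + int (a + b - 1 - i)" for i
  have la: "length xs = a" "length (rects_mu R) = a" using P(3) by (simp_all add: a_def length_rects_mu)
  have lb: "length ys = b" "length (rects_mu R') = b" using Q(3) by (simp_all add: b_def length_rects_mu)
  have \<kappa>1: "\<kappa> i = (int (xs ! i) + int (a - 1 - i)) + int (b + c)" and
    \<nu>1: "\<nu> i = (int (rects_mu R ! i) + int (a - 1 - i)) + int (b + c)" if "i < a" for i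
    using that la by (auto simp: \<kappa>_def \<nu>_def zs_def mu nth_append)
  have \<kappa>2: "\<kappa> (a + i) = int (ys ! i) + int (b - 1 - i)" and
    \<nu>2: "\<nu> (a + i) = int (rects_mu R' ! i) + int (b - 1 - i)" for i
    using la by (auto simp: \<kappa>_def \<nu>_def zs_def mu nth_append)
  have "kostka_rects zs U = weyl_sum (a + b) (Phi (rects_eta U)) \<kappa> \<nu>"
    unfolding \<kappa>_def[abs_def] \<nu>_def[abs_def] by (rule kostka_rects_eq_weyl_sum) (use zs len in auto)
  also have "\<dots> = weyl_sum a (Phi (rects_eta R)) \<kappa> \<nu> *
      weyl_sum b (Phi (rects_eta R')) (\<lambda>i. \<kappa> (a + i)) (\<lambda>i. \<nu> (a + i))"
  proof (rule weyl_sum_product[where \<theta> = "int (b + c)"])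
    show "Phi (rects_eta U) = Phi (rects_eta R) \<union> (\<lambda>(i, j). (a + i, a + j)) ` Phi (rects_eta R') \<union> {..<a} \<times> {a..<a + b}"
      unfolding eta a_def b_def by (rule Phi_append)
    show "\<kappa> i < int (b + c)" if "a \<le> i" "i < a + b" for i
    proof -
      define j where "j = i - a"
      then have j: "i = a + j" "j < b" using that by auto
      then show ?thesis using c_ys[of "ys ! j"] lb by (simp add: \<kappa>2 of_nat_diff)
    qed
    have "sum \<kappa> {..<a} = int (sum_list xs) + (\<Sum>i<a. int (a - 1 - i) + int (b + c))"
      using la by (simp add: \<kappa>1 sum_list_sum_nth atLeast0LessThan sum.distrib)
    moreover have "sum \<nu> {..<a} = int (sum_list (rects_mu R)) + (\<Sum>i<a. int (a - 1 - i) + int (b + c))"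
      using la by (simp add: \<nu>1 sum_list_sum_nth atLeast0LessThan sum.distrib)
    ultimately show "sum \<kappa> {..<a} = sum \<nu> {..<a}" using P(4) by simp
    show "int (b + c) \<le> \<kappa> i" if "i < a" for i using \<kappa>1[OF that] by simp
    show "i < j \<and> j < a" if "(i, j) \<in> Phi (rects_eta R)" for i j
      using Phi_bounds[OF that] by (simp only: a_def)
    show "i < j \<and> j < b" if "(i, j) \<in> Phi (rects_eta R')" for i j
      using Phi_bounds[OF that] by (simp only: b_def)
  qed simp_all
  also have "weyl_sum a (Phi (rects_eta R)) \<kappa> \<nu> =
     weyl_sum a (Phi (rects_eta R)) (\<lambda>i. (int (xs ! i) + int (a - 1 - i)) + int (b + c))
       (\<lambda>i. (int (rects_mu R ! i) + int (a - 1 - i)) + int (b + c))"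
    by (rule weyl_sum_cong) (simp_all only: \<kappa>1 \<nu>1)
  also have "\<dots> = kostka_rects xs R"
    unfolding weyl_sum_shift using kostka_rects_eq_weyl_sum[OF P(1), of a R] la by (simp add: a_def)
  also have "weyl_sum b (Phi (rects_eta R')) (\<lambda>i. \<kappa> (a + i)) (\<lambda>i. \<nu> (a + i)) = kostka_rects ys R'"
    unfolding \<kappa>2 \<nu>2 using kostka_rects_eq_weyl_sum[OF Q(1), of b R'] lb by (simp add: b_def)
  finally have "kostka_rects zs U = fps_X ^ (S + T) * fps_of_poly (P * Q)"
    by (simp add: P(5) Q(5) power_add fps_of_poly_mult mult_ac)
  then show ?thesis
    unfolding kostka_realizable_def using zs U len sums by (intro exI[of _ zs] exI[of _ U] exI[of _ "S + T"]) simp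
qed

section \<open>Blocks of variables\<close>

abbreviation block_act :: "nat \<Rightarrow> (nat \<Rightarrow> nat) \<Rightarrow> laurent fps \<Rightarrow> laurent fps" where
  "block_act s p \<equiv> fps_wmap (perm_weight (shift_perm s p))"

definition block_sym :: "nat \<Rightarrow> nat \<Rightarrow> laurent fps \<Rightarrow> bool" where
  "block_sym s n H \<longleftrightarrow> (\<forall>p. p permutes {..<n} \<longrightarrow> block_act s p H = H)"

definition block_antisym :: "nat \<Rightarrow> nat \<Rightarrow> laurent fps \<Rightarrow> bool" where
  "block_antisym s n H \<longleftrightarrow> (\<forall>p. p permutes {..<n} \<longrightarrow> block_act s p H = of_int (sign p) * H)"

text \<open>
  The inverse of the variable \<open>x\<^sub>i\<close>.
\<close>

definition ivar :: "nat \<Rightarrow> laurent" where "ivar i = xmon (single i (- 1))"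

lemma bij_shift_perm: "p permutes {..<n} \<Longrightarrow> bij (shift_perm s p)"
  using shift_perm_permutes(1) permutes_bij by blast

context
  fixes w :: "nat \<Rightarrow> nat"
  assumes w: "bij w"
begin

lemmas act_mult = fps_wmap_mult[of "perm_weight w", OF perm_weight_add[OF w]]
lemmas act_prod = fps_wmap_prod[of "perm_weight w", OF perm_weight_add[OF w]]
lemmas act_geo = fps_wmap_geo[of "perm_weight w", OF perm_weight_add[OF w]]
lemmas wact_mult = wmap_mult[of "perm_weight w", OF perm_weight_add[OF w]]
lemmas wact_prod = wmap_prod[of "perm_weight w", OF perm_weight_add[OF w]]
lemmas wact_power = wmap_power[of "perm_weight w", OF perm_weight_add[OF w]]

lemma wact_single: "wmap (perm_weight w) (xmon (single i c)) = xmon (single (w i) c)"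
  by (simp add: perm_weight_single[OF w])

lemma ct_act: "ct (fps_wmap (perm_weight w) F) = ct F"
  using inj_perm_weight[OF w] perm_weight_0[OF w] by (rule ct_fps_wmap)

lemma act_root_series:
  "fps_wmap (perm_weight w) (root_series \<Phi>) = root_series ((\<lambda>(i, j). (w i, w j)) ` \<Phi>)"
proof -
  have inj: "inj_on (\<lambda>(i, j). (w i, w j)) \<Phi>"
    using bij_is_inj[OF w] by (intro inj_onI) (simp add: case_prod_unfold inj_eq prod_eq_iff)
  have root: "perm_weight w (single i 1 - single j 1) = single (w i) 1 - single (w j) 1" for i j
    unfolding perm_weight_single[OF w, symmetric]
    by (rule poly_mapping_eqI) (simp add: lookup_perm_weight[OF w] lookup_minus)
  show ?thesis
    unfolding root_series_def act_prod prod.reindex[OF inj]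
    by (rule prod.cong) (auto simp: act_geo root)
qed

lemma act_alt_sum:
  assumes q: "q permutes {..<n}" and wq: "\<And>i. i < n \<Longrightarrow> w (t + i) = t + q i"
  shows "wmap (perm_weight w) (alt_sum n (\<lambda>i. xmon (single (t + i) c)) e) =
    of_int (sign q) * alt_sum n (\<lambda>i. xmon (single (t + i) c)) e"
proof -
  have "wmap (perm_weight w) (alt_sum n (\<lambda>i. xmon (single (t + i) c)) e) =
      (\<Sum>p | p permutes {..<n}. of_int (sign p) * (\<Prod>i<n. xmon (single (t + (q \<circ> p) i) c) ^ e i))"
    unfolding alt_sum_def wmap_sum wmap_of_int_mult wact_prod wact_power wact_single
  proof (intro sum.cong prod.cong refl arg_cong2[where f = "(*)"])
    fix p i assume "p \<in> {p. p permutes {..<n}}" "i \<in> {..<n}"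
    then have "p i < n" using permutes_in_image[of p "{..<n}" i] by simp
    then show "xmon (single (w (t + p i)) c) ^ e i = xmon (single (t + (q \<circ> p) i) c) ^ e i"
      by (simp add: wq)
  qed
  also have "\<dots> = (\<Sum>p | p permutes {..<n}. of_int (sign q) *
      (of_int (sign (q \<circ> p)) * (\<Prod>i<n. xmon (single (t + (q \<circ> p) i) c) ^ e i)))"
    by (rule sum.cong) (auto simp: sign_permutes_comp[OF q] simp flip: mult.assoc of_int_mult)
  also have "\<dots> = of_int (sign q) * alt_sum n (\<lambda>i. xmon (single (t + i) c)) e"
    unfolding alt_sum_def sum_distrib_left
    by (rule setum_permutations_compose_left[OF q, symmetric])
  finally show ?thesis .
qed

lemma act_mon: "wmap (perm_weight w) (mon n v e) = mon n (\<lambda>i. w (v i)) e"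
  by (simp add: mon_def wact_prod perm_weight_single[OF w])

end

lemma block_sym_mult: "block_sym s n F \<Longrightarrow> block_sym s n G \<Longrightarrow> block_sym s n (F * G)"
  by (simp add: block_sym_def act_mult[OF bij_shift_perm])

lemma block_antisym_mult_sym: "block_antisym s n F \<Longrightarrow> block_sym s n G \<Longrightarrow> block_antisym s n (F * G)"
  by (simp add: block_sym_def block_antisym_def act_mult[OF bij_shift_perm] mult.assoc)

lemma block_sym_prod: "(\<And>i. i \<in> S \<Longrightarrow> block_sym s n (f i)) \<Longrightarrow> block_sym s n (\<Prod>i\<in>S. f i)"
  by (simp add: block_sym_def act_prod[OF bij_shift_perm])

abbreviation apart :: "nat \<Rightarrow> nat \<Rightarrow> nat \<Rightarrow> nat \<Rightarrow> bool" where
  "apart s n t m \<equiv> s + n \<le> t \<or> t + m \<le> s"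

lemma shift_perm_fixes:
  assumes "p permutes {..<n}" "i < s \<or> s + n \<le> i"
  shows "shift_perm s p i = i"
  using assms(2) permutes_not_in[OF assms(1), of "i - s"] by (auto simp: shift_perm_def)

lemma shift_perm_block: "shift_perm s p (s + i) = s + p i"
  by (simp add: shift_perm_def)

lemma block_sym_alt_sum_apart:
  assumes "apart s n t m"
  shows "block_sym s n (fps_const (alt_sum m (\<lambda>i. xmon (single (t + i) c)) e))"
  unfolding block_sym_def
proof (intro allI impI)
  fix p assume p: "p permutes {..<n}"
  have "wmap (perm_weight (shift_perm s p)) (alt_sum m (\<lambda>i. xmon (single (t + i) c)) e) =
     of_int (sign (id :: nat \<Rightarrow> nat)) * alt_sum m (\<lambda>i. xmon (single (t + i) c)) e"
    by (rule act_alt_sum[OF bij_shift_perm[OF p] permutes_id])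
       (use assms shift_perm_fixes[OF p] in auto)
  then show "block_act s p (fps_const (alt_sum m (\<lambda>i. xmon (single (t + i) c)) e)) =
      fps_const (alt_sum m (\<lambda>i. xmon (single (t + i) c)) e)"
    by (simp add: fps_wmap_const)
qed

lemma block_antisym_alt_sum:
  assumes "t \<le> s" "s + n \<le> t + m"
  shows "block_antisym s n (fps_const (alt_sum m (\<lambda>i. xmon (single (t + i) c)) e))"
  unfolding block_antisym_def
proof (intro allI impI)
  fix p assume p: "p permutes {..<n}"
  have q: "shift_perm (s - t) p permutes {..<m}"
    by (rule permutes_subset[OF shift_perm_permutes(2)[OF p]]) (use assms in auto)
  have "wmap (perm_weight (shift_perm s p)) (alt_sum m (\<lambda>i. xmon (single (t + i) c)) e) =
     of_int (sign (shift_perm (s - t) p)) * alt_sum m (\<lambda>i. xmon (single (t + i) c)) e"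
  proof (rule act_alt_sum[OF bij_shift_perm[OF p] q])
    fix i
    have "t + i - s = i - (s - t)" using assms by simp
    then show "shift_perm s p (t + i) = t + shift_perm (s - t) p i"
      using assms by (auto simp: shift_perm_def)
  qed
  then show "block_act s p (fps_const (alt_sum m (\<lambda>i. xmon (single (t + i) c)) e)) =
      of_int (sign p) * fps_const (alt_sum m (\<lambda>i. xmon (single (t + i) c)) e)"
    by (simp add: fps_wmap_const shift_perm_permutes(3)[OF p] flip: fps_of_int fps_const_mult)
qed

lemma block_sym_mon_apart: "apart s n t m \<Longrightarrow> block_sym s n (fps_const (mon m (\<lambda>i. t + i) e))"
  unfolding block_sym_def fps_wmap_const
  by (auto simp: act_mon[OF bij_shift_perm] shift_perm_fixes intro!: mon_cong arg_cong[where f = fps_const])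

lemma block_sym_mon_const: "block_sym s n (fps_const (mon n (\<lambda>i. s + i) (\<lambda>i. c)))"
  unfolding block_sym_def
proof (intro allI impI)
  fix p assume p: "p permutes {..<n}"
  show "block_act s p (fps_const (mon n (\<lambda>i. s + i) (\<lambda>i. c))) = fps_const (mon n (\<lambda>i. s + i) (\<lambda>i. c))"
    using mon_permutes[OF p, of "\<lambda>i. s + i" "\<lambda>i. c"]
    by (simp add: fps_wmap_const act_mon[OF bij_shift_perm[OF p]] shift_perm_block)
qed

lemma shift_perm_image:
  assumes p: "p permutes {..<n}" and "apart s n t m \<or> (t \<le> s \<and> s + n \<le> t + m)"
  shows "shift_perm s p ` {t..<t + m} = {t..<t + m}"
  using assms(2)
proof
  assume "apart s n t m"
  then have "shift_perm s p i = i" if "i \<in> {t..<t + m}" for i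
    using shift_perm_fixes[OF p, of i] that by auto
  then show ?thesis by force
next
  assume "t \<le> s \<and> s + n \<le> t + m"
  then have "shift_perm s p permutes {t..<t + m}"
    by (intro permutes_subset[OF shift_perm_permutes(1)[OF p]]) auto
  then show ?thesis by (rule permutes_image)
qed

lemma block_sym_root_series:
  assumes "apart s n t m \<or> (t \<le> s \<and> s + n \<le> t + m)" "apart s n t' m' \<or> (t' \<le> s \<and> s + n \<le> t' + m')"
  shows "block_sym s n (root_series ({t..<t + m} \<times> {t'..<t' + m'}))"
  unfolding block_sym_def
proof (intro allI impI)
  fix p assume p: "p permutes {..<n}"
  have "(\<lambda>(i, j). (shift_perm s p i, shift_perm s p j)) ` ({t..<t + m} \<times> {t'..<t' + m'}) =
     (shift_perm s p ` {t..<t + m}) \<times> (shift_perm s p ` {t'..<t' + m'})"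
    by (rule image_paired_Times)
  then show "block_act s p (root_series ({t..<t + m} \<times> {t'..<t' + m'})) = root_series ({t..<t + m} \<times> {t'..<t' + m'})"
    by (simp add: act_root_series[OF bij_shift_perm[OF p]] shift_perm_image[OF p assms(1)] shift_perm_image[OF p assms(2)])
qed

lemma block_sym_geo:
  assumes "i < s \<or> s + n \<le> i" "j < s \<or> s + n \<le> j"
  shows "block_sym s n (geo (var i * ivar j))"
  unfolding block_sym_def
proof (intro allI impI)
  fix p assume p: "p permutes {..<n}"
  show "block_act s p (geo (var i * ivar j)) = geo (var i * ivar j)"
    unfolding act_geo[OF bij_shift_perm[OF p]] wact_mult[OF bij_shift_perm[OF p]] var_def ivar_def
      wact_single[OF bij_shift_perm[OF p]]
    by (simp only: shift_perm_fixes[OF p assms(1)] shift_perm_fixes[OF p assms(2)])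
qed

lemma var_ivar: "var i * ivar i = 1"
  by (simp add: var_def ivar_def flip: xmon_add single_add)

lemma ivar_var: "ivar i * var i = 1"
  using var_ivar[of i] by (simp only: mult.commute)

lemma prod_interval: "(\<Prod>i\<in>{s..<s + n}. f i) = (\<Prod>i<n. f (s + i :: nat) :: 'a::comm_monoid_mult)"
  by (induction n) (simp_all add: mult.commute)

lemma root_series_block:
  "root_series ({s..<s + n} \<times> {t..<t + m}) = (\<Prod>i<n. \<Prod>j<m. geo (var (s + i) * ivar (t + j)))"
proof -
  have "root_series ({s..<s + n} \<times> {t..<t + m}) =
     (\<Prod>i\<in>{s..<s + n}. \<Prod>j\<in>{t..<t + m}. geo (xmon (single i 1 - single j 1)))"
    by (simp add: root_series_def prod.cartesian_product)
  also have "\<dots> = (\<Prod>i<n. \<Prod>j<m. geo (xmon (single (s + i) 1 - single (t + j) 1)))"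
    by (simp only: prod_interval)
  also have "\<dots> = (\<Prod>i<n. \<Prod>j<m. geo (var (s + i) * ivar (t + j)))"
    by (simp add: var_def ivar_def single_uminus flip: xmon_add)
  finally show ?thesis .
qed

text \<open>The alternants \<open>a\<^sub>\<delta>\<close> of the variables of a block and of their inverses.\<close>

abbreviation block_alt :: "nat \<Rightarrow> nat \<Rightarrow> laurent" where
  "block_alt s n \<equiv> alt_sum n (\<lambda>i. var (s + i)) (\<lambda>i. n - 1 - i)"

abbreviation block_ialt :: "nat \<Rightarrow> nat \<Rightarrow> laurent" where
  "block_ialt s n \<equiv> alt_sum n (\<lambda>i. ivar (s + i)) (\<lambda>i. n - 1 - i)"

text \<open>
  The monomials \<open>(\<Prod>i<n. x\<^sub>s\<^sub>+\<^sub>i) ^ c\<close> and \<open>x\<^sup>\<delta>\<close> of a block.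
\<close>

abbreviation cmon :: "nat \<Rightarrow> nat \<Rightarrow> int \<Rightarrow> laurent" where
  "cmon s n c \<equiv> mon n (\<lambda>i. s + i) (\<lambda>i. c)"

abbreviation dmon :: "nat \<Rightarrow> nat \<Rightarrow> laurent" where
  "dmon s n \<equiv> mon n (\<lambda>i. s + i) (\<lambda>i. int (n - 1 - i))"

lemma xmon_single_neg_nat: "xmon (single i (- int e)) = ivar i ^ e"
proof (induction e)
  case (Suc e)
  have "xmon (single i (- int (Suc e))) = xmon (single i (- 1)) * xmon (single i (- int e))"
    by (simp flip: xmon_add single_add)
  then show ?case by (simp add: Suc ivar_def)
qed simp

lemma mon_nat: "mon n v (\<lambda>i. int (e i)) = (\<Prod>i<n. var (v i) ^ e i)"
  by (simp add: mon_def xmon_single_nat)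

lemma cmon_nat: "cmon s n (int c) = (\<Prod>i<n. var (s + i)) ^ c"
  by (simp add: mon_def xmon_single_nat prod_power_distrib)

lemma cmon_neg_nat: "cmon s n (- int c) = (\<Prod>i<n. ivar (s + i)) ^ c"
  by (simp add: mon_def xmon_single_neg_nat prod_power_distrib)

lemma block_alt_inverse: "block_alt s n = cmon s n (int (n - 1)) * vandermonde n (\<lambda>i. ivar (s + i))"
  unfolding cmon_nat by (rule alt_sum_inverse) (simp add: var_ivar)

lemma block_ialt_inverse: "block_ialt s n = cmon s n (- int (n - 1)) * vandermonde n (\<lambda>i. var (s + i))"
  unfolding cmon_neg_nat by (rule alt_sum_inverse) (simp add: ivar_var)

lemma block_cauchy:
  assumes \<sigma>: "\<sigma> permutes {..<n}" and \<tau>: "\<tau> permutes {..<n}"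
  shows "fps_X ^ (\<Sum>i<n. i) * fps_const (vandermonde n (\<lambda>i. var (s + \<sigma> i)) * vandermonde n (\<lambda>i. ivar (t + \<tau> i))) *
      root_series ({s..<s + n} \<times> {t..<t + n}) =
    (\<Sum>u | u permutes {..<n}. of_int (sign u) * (\<Prod>i<n. geo (var (s + \<sigma> i) * ivar (t + \<tau> (u i)))))"
proof -
  have "(\<Prod>i<n. \<Prod>j<n. geo (var (s + \<sigma> i) * ivar (t + \<tau> j))) = root_series ({s..<s + n} \<times> {t..<t + n})"
    unfolding root_series_block
    by (subst prod_permutes[OF \<tau>, where f = "\<lambda>j. geo (var _ * ivar (t + j))"])
       (rule prod_permutes[OF \<sigma>, where f = "\<lambda>i. \<Prod>j<n. geo (var (s + i) * ivar (t + j))"])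
  then show ?thesis
    using cauchy_determinant[of n "\<lambda>i. var (s + \<sigma> i)" "\<lambda>i. ivar (t + \<tau> i)"] by simp
qed

text \<open>
  The constant term is invariant under the permutations of the block, and \<open>H\<close> picks up the sign
  that belongs to each term of the alternant.
\<close>

lemma ct_antisymmetrize:
  assumes H: "block_antisym s n H"
  shows "of_nat (fact n) * ct (H * fps_const (dmon s n)) = ct (H * fps_const (block_alt s n))"
proof -
  have "ct (H * fps_const (block_alt s n)) =
    (\<Sum>p | p permutes {..<n}. ct (of_int (sign p) * (H * fps_const (\<Prod>i<n. var (s + p i) ^ (n - 1 - i)))))"
    unfolding alt_sum_def fps_const_sum sum_distrib_left ct_sum
    by (intro sum.cong refl) (simp add: fps_of_int mult_ac flip: fps_const_mult)
  also have "\<dots> = (\<Sum>p | p permutes {..<n}. ct (H * fps_const (dmon s n)))"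
  proof (rule sum.cong[OF refl])
    fix p assume "p \<in> {p. p permutes {..<n}}"
    then have p: "p permutes {..<n}" by simp
    have "block_act s p (H * fps_const (dmon s n)) =
        of_int (sign p) * H * fps_const (mon n (\<lambda>i. s + p i) (\<lambda>i. int (n - 1 - i)))"
      using H p by (simp add: block_antisym_def act_mult[OF bij_shift_perm[OF p]] fps_wmap_const
          act_mon[OF bij_shift_perm[OF p]] shift_perm_block)
    then show "ct (of_int (sign p) * (H * fps_const (\<Prod>i<n. var (s + p i) ^ (n - 1 - i)))) = ct (H * fps_const (dmon s n))"
      using ct_act[OF bij_shift_perm[OF p], of s "H * fps_const (dmon s n)"]
      by (simp only: mon_nat mult.assoc)
  qed
  also have "\<dots> = of_nat (fact n) * ct (H * fps_const (dmon s n))"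
    by (simp add: card_permutations)
  finally show ?thesis ..
qed

lemma block_antisym_sign_ct:
  assumes "block_antisym t n H" and "p permutes {..<n}"
  shows "of_int (sign p) * ct (H * block_act t p F) = ct (H * F)"
  using ct_act[OF bij_shift_perm[OF assms(2)], of t "H * F"] assms
  by (simp add: block_antisym_def act_mult[OF bij_shift_perm[OF assms(2)]] mult.assoc ct_of_int_mult)

text \<open>
  After antisymmetrizing \<open>x\<^sup>\<delta>\<close> on the block at \<open>t\<close>, both alternants for Cauchy's determinant are
  available. In the resulting sum over matchings \<open>u\<close> all terms have the same constant term, since
  permuting the block at \<open>t\<close> by \<open>u\<close> yields a sign that cancels the sign of \<open>u\<close>. So a single
  matching remains, and the factors \<open>n!\<close> on both sides cancel.
\<close>

lemma ct_block_cauchy: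
  assumes H: "block_antisym t n H" and \<sigma>: "\<sigma> permutes {..<n}" and st: "apart t n s n"
  shows "fps_X ^ (\<Sum>i<n. i) * ct (H * fps_const (vandermonde n (\<lambda>i. var (s + \<sigma> i)) * dmon t n) *
      root_series ({s..<s + n} \<times> {t..<t + n})) =
    ct (H * fps_const (cmon t n (int (n - 1))) * (\<Prod>i<n. geo (var (s + \<sigma> i) * ivar (t + i))))" (is "?L = ?R")
proof -
  define V where "V = vandermonde n (\<lambda>i. var (s + \<sigma> i))"
  define G where "G = root_series ({s..<s + n} \<times> {t..<t + n})"
  define C where "C = fps_const (cmon t n (int (n - 1)))"
  have \<sigma>lt: "\<sigma> i < n" if "i < n" for i using permutes_in_image[OF \<sigma>, of i] that by simp
  have symV: "block_sym t n (fps_const V)"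
    unfolding block_sym_def
  proof (intro allI impI)
    fix p assume p: "p permutes {..<n}"
    have fx: "shift_perm t p (s + \<sigma> i) = s + \<sigma> i" if "i < n" for i
      using \<sigma>lt[OF that] st by (intro shift_perm_fixes[OF p]) auto
    have "wmap (perm_weight (shift_perm t p)) V = V"
      unfolding V_def alt_sum_def wmap_sum wmap_of_int_mult wact_prod[OF bij_shift_perm[OF p]]
        wact_power[OF bij_shift_perm[OF p]] var_def wact_single[OF bij_shift_perm[OF p]]
    proof (intro sum.cong prod.cong refl arg_cong2[where f = "(*)"])
      fix q i assume "q \<in> {q. q permutes {..<n}}" "i \<in> {..<n}"
      then have "q i < n" using permutes_in_image[of q "{..<n}" i] by simp
      then show "xmon (single (shift_perm t p (s + \<sigma> (q i))) 1) ^ i = xmon (single (s + \<sigma> (q i)) 1) ^ i"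
        by (simp add: fx)
    qed
    then show "block_act t p (fps_const V) = fps_const V" by (simp add: fps_wmap_const)
  qed
  have "block_antisym t n (H * fps_const V * G)"
    unfolding G_def by (intro block_antisym_mult_sym H symV block_sym_root_series) (use st in auto)
  from ct_antisymmetrize[OF this]
  have "of_nat (fact n) * ?L = fps_X ^ (\<Sum>i<n. i) * ct (H * fps_const V * G * fps_const (block_alt t n))"
    by (simp add: V_def G_def mult_ac flip: fps_const_mult)
  also have "\<dots> = ct (H * C * (fps_X ^ (\<Sum>i<n. i) * fps_const (V * vandermonde n (\<lambda>i. ivar (t + id i))) * G))"
    unfolding block_alt_inverse C_def ct_X_power_mult[symmetric]
    by (simp add: mult_ac flip: fps_const_mult)
  also have "\<dots> = (\<Sum>u | u permutes {..<n}. of_int (sign u) *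
      ct (H * C * (\<Prod>i<n. geo (var (s + \<sigma> i) * ivar (t + u i)))))"
    unfolding V_def G_def block_cauchy[OF \<sigma> permutes_id]
    unfolding sum_distrib_left ct_sum mult.left_commute[of "H * C" "of_int _"] ct_of_int_mult id_apply ..
  also have "\<dots> = (\<Sum>u | u permutes {..<n}. ?R)"
  proof (rule sum.cong[OF refl])
    fix u assume "u \<in> {u. u permutes {..<n}}"
    then have u: "u permutes {..<n}" by simp
    have eq: "block_act t u (\<Prod>i<n. geo (var (s + \<sigma> i) * ivar (t + i))) = (\<Prod>i<n. geo (var (s + \<sigma> i) * ivar (t + u i)))"
      unfolding act_prod[OF bij_shift_perm[OF u]] act_geo[OF bij_shift_perm[OF u]]
        wact_mult[OF bij_shift_perm[OF u]] var_def ivar_def wact_single[OF bij_shift_perm[OF u]] shift_perm_block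
    proof (intro prod.cong refl)
      fix i assume "i \<in> {..<n}"
      then have "shift_perm t u (s + \<sigma> i) = s + \<sigma> i"
        using \<sigma>lt[of i] st by (intro shift_perm_fixes[OF u]) auto
      then show "geo (xmon (single (shift_perm t u (s + \<sigma> i)) 1) * xmon (single (t + u i) (- 1))) =
        geo (xmon (single (s + \<sigma> i) 1) * xmon (single (t + u i) (- 1)))" by simp
    qed
    have anti: "block_antisym t n (H * C)"
      unfolding C_def by (intro block_antisym_mult_sym H block_sym_mon_const)
    show "of_int (sign u) * ct (H * C * (\<Prod>i<n. geo (var (s + \<sigma> i) * ivar (t + u i)))) = ?R"
      using block_antisym_sign_ct[OF anti u, of "\<Prod>i<n. geo (var (s + \<sigma> i) * ivar (t + i))"]
      unfolding eq C_def .
  qed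
  also have "\<dots> = of_nat (fact n) * ?R"
    by (simp add: card_permutations)
  finally show ?thesis by simp
qed

section \<open>Constant terms as numbers of flows\<close>

text \<open>
  Assignments of total size \<open>d\<close> of natural numbers to the edges \<open>I\<close> of a graph.
\<close>

definition flows :: "'i set \<Rightarrow> nat \<Rightarrow> ('i \<Rightarrow> nat) set" where
  "flows I d = {f \<in> I \<rightarrow>\<^sub>E UNIV. sum f I = d}"

lemma finite_flows: "finite I \<Longrightarrow> finite (flows I d)"
proof (rule finite_subset)
  assume I: "finite I"
  show "flows I d \<subseteq> I \<rightarrow>\<^sub>E {..d}"
  proof
    fix f assume "f \<in> flows I d"
    then have f: "f \<in> I \<rightarrow>\<^sub>E UNIV" "sum f I = d" by (auto simp: flows_def)
    have "f i \<le> d" if "i \<in> I" for i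
      using member_le_sum[OF that _ I, of f] f(2) by simp
    then show "f \<in> I \<rightarrow>\<^sub>E {..d}" using f(1) by (auto simp: PiE_def)
  qed
  show "finite (I \<rightarrow>\<^sub>E {..d})" using I by (intro finite_PiE) auto
qed

lemma xmon_power_frag: "xmon \<gamma> ^ k = xmon (frag_cmul (int k) \<gamma>)"
  by (induction k) (simp_all add: frag_cmul_distrib xmon_add)

lemma prod_geo_nth:
  fixes I :: "'i set"
  assumes "finite I"
  shows "(\<Prod>i\<in>I. geo (xmon (\<gamma> i))) $ d = (\<Sum>f\<in>flows I d. xmon (\<Sum>i\<in>I. frag_cmul (int (f i)) (\<gamma> i)))"
  using assms
proof (induction I arbitrary: d rule: finite_induct)
  case empty
  have "flows ({} :: 'i set) d = (if d = 0 then {\<lambda>_. undefined} else {})" by (auto simp: flows_def)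
  then show ?case by simp
next
  case (insert x I)
  let ?m = "\<lambda>f I. \<Sum>i\<in>I. frag_cmul (int (f i)) (\<gamma> i)"
  have "(\<Prod>i\<in>insert x I. geo (xmon (\<gamma> i))) $ d =
     (\<Sum>k=0..d. \<Sum>f\<in>flows I (d - k). xmon (frag_cmul (int k) (\<gamma> x) + ?m f I))"
    using insert by (simp add: fps_mult_nth xmon_power_frag sum_distrib_left xmon_add)
  also have "\<dots> = (\<Sum>(k, f)\<in>Sigma {0..d} (\<lambda>k. flows I (d - k)). xmon (frag_cmul (int k) (\<gamma> x) + ?m f I))"
    using insert by (subst sum.Sigma) (auto simp: finite_flows)
  also have "\<dots> = (\<Sum>f\<in>flows (insert x I) d. xmon (?m f (insert x I)))"
  proof (rule sum.reindex_bij_witness[of _ "\<lambda>f. (f x, f(x := undefined))" "\<lambda>(k, f). f(x := k)"])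
    fix z assume "z \<in> Sigma {0..d} (\<lambda>k. flows I (d - k))"
    then obtain k f where z: "z = (k, f)" "k \<le> d" "f \<in> I \<rightarrow>\<^sub>E UNIV" "sum f I = d - k"
      by (auto simp: flows_def)
    have s: "sum (f(x := k)) I = sum f I" and m: "?m (f(x := k)) I = ?m f I"
      using insert by (auto intro!: sum.cong)
    have fx: "f x = undefined" using z insert by (auto simp: PiE_def extensional_def)
    show "(case z of (k, f) \<Rightarrow> f(x := k)) \<in> flows (insert x I) d"
      using z insert s by (auto simp: flows_def intro!: PiE_fun_upd)
    show "((case z of (k, f) \<Rightarrow> f(x := k)) x, (case z of (k, f) \<Rightarrow> f(x := k))(x := undefined)) = z"
      using z fx by auto
    show "xmon (?m (case z of (k, f) \<Rightarrow> f(x := k)) (insert x I)) =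
       (case z of (k, f) \<Rightarrow> xmon (frag_cmul (int k) (\<gamma> x) + ?m f I))"
      using z m insert by simp
  next
    fix f assume "f \<in> flows (insert x I) d"
    then have f: "f \<in> insert x I \<rightarrow>\<^sub>E UNIV" "f x + sum f I = d" using insert by (auto simp: flows_def)
    have s: "sum (f(x := undefined)) I = sum f I"
      using insert by (auto intro!: sum.cong)
    show "(f x, f(x := undefined)) \<in> Sigma {0..d} (\<lambda>k. flows I (d - k))"
      using f s insert fun_upd_in_PiE[of x I f "\<lambda>_. UNIV"] by (auto simp: flows_def)
    show "(case (f x, f(x := undefined)) of (k, f) \<Rightarrow> f(x := k)) = f" by auto
  qed
  finally show ?case .
qed

definition outflow :: "'i set \<Rightarrow> ('i \<Rightarrow> nat) \<Rightarrow> ('i \<Rightarrow> nat) \<Rightarrow> nat \<Rightarrow> int" where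
  "outflow I u f x = (\<Sum>z | z \<in> I \<and> u z = x. int (f z))"

lemma lookup_frag_cmul_sum:
  assumes "finite I"
  shows "lookup (\<Sum>z\<in>I. frag_cmul (int (f z)) (single (u z) c)) x = c * outflow I u f x"
proof -
  have "lookup (\<Sum>z\<in>I. frag_cmul (int (f z)) (single (u z) c)) x = (\<Sum>z\<in>I. if u z = x then c * int (f z) else 0)"
    unfolding lookup_sum by (rule sum.cong) (auto simp: lookup_single when_def)
  also have "\<dots> = c * outflow I u f x"
    using assms by (simp add: outflow_def sum_distrib_left sum.inter_filter if_distrib cong: if_cong)
  finally show ?thesis .
qed

text \<open>
  An edge \<open>z\<close> runs from \<open>u z\<close> to \<open>v z\<close>. Choosing the power \<open>f z\<close> of \<open>q x\<^sub>u / x\<^sub>v\<close> from each factor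
  gives a constant monomial if and only if the flow \<open>f\<close> is conserved at each vertex \<open>x\<close>, where
  \<open>- lookup \<gamma>0 x\<close> units enter from outside.
\<close>

lemma ct_prod_geo:
  assumes I: "finite I"
  shows "ct (fps_const (xmon \<gamma>0) * (\<Prod>z\<in>I. geo (var (u z) * ivar (v z)))) $ d =
    int (card {f \<in> flows I d. \<forall>x. lookup \<gamma>0 x + outflow I u f x = outflow I v f x})"
proof -
  have geo: "var (u z) * ivar (v z) = xmon (single (u z) 1 + single (v z) (- 1))" for z
    by (simp add: var_def ivar_def xmon_add)
  have "ct (fps_const (xmon \<gamma>0) * (\<Prod>z\<in>I. geo (var (u z) * ivar (v z)))) $ d =
     (\<Sum>f\<in>flows I d. lookup (xmon (\<gamma>0 + (\<Sum>z\<in>I. frag_cmul (int (f z)) (single (u z) 1 + single (v z) (- 1))))) 0)"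
    unfolding geo by (simp add: prod_geo_nth[OF I] sum_distrib_left lookup_sum flip: xmon_add)
  also have "\<dots> = (\<Sum>f\<in>flows I d. if \<forall>x. lookup \<gamma>0 x + outflow I u f x = outflow I v f x then 1 else 0)"
  proof (rule sum.cong[OF refl])
    fix f
    define \<beta> where "\<beta> = \<gamma>0 + (\<Sum>z\<in>I. frag_cmul (int (f z)) (single (u z) 1 + single (v z) (- 1)))"
    have "lookup \<beta> x = lookup \<gamma>0 x + outflow I u f x - outflow I v f x" for x
      unfolding \<beta>_def frag_cmul_distrib2 sum.distrib lookup_add lookup_frag_cmul_sum[OF I] by simp
    then have "\<beta> = 0 \<longleftrightarrow> (\<forall>x. lookup \<gamma>0 x + outflow I u f x = outflow I v f x)"
      by (auto simp: poly_mapping_eq_iff fun_eq_iff)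
    then show "lookup (xmon \<beta>) 0 = (if \<forall>x. lookup \<gamma>0 x + outflow I u f x = outflow I v f x then 1 else 0)"
      by (auto simp: xmon_def lookup_single when_def)
  qed
  also have "\<dots> = int (card {f \<in> flows I d. \<forall>x. lookup \<gamma>0 x + outflow I u f x = outflow I v f x})"
    using finite_flows[OF I, of d] by (simp flip: sum.inter_filter)
  finally show ?thesis .
qed

section \<open>Signed sums over permutations\<close>

lemma sum_sign_eq_0:
  fixes t :: "nat \<Rightarrow> nat"
  assumes t: "t permutes {..<n}" "sign t = - 1" "t \<circ> t = id"
    and P: "\<And>w. w permutes {..<n} \<Longrightarrow> P w \<Longrightarrow> P (w \<circ> t)"
  shows "(\<Sum>w | w permutes {..<n} \<and> P w. sign w) = 0"
proof -
  have tt: "w \<circ> t \<circ> t = w" for w :: "nat \<Rightarrow> nat" using t(3) by (simp add: o_assoc[symmetric])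
  have "(\<Sum>w | w permutes {..<n} \<and> P w. sign w) = (\<Sum>w | w permutes {..<n} \<and> P w. sign (w \<circ> t))"
    by (rule sum.reindex_bij_witness[of _ "\<lambda>w. w \<circ> t" "\<lambda>w. w \<circ> t"])
       (use P t(1) tt in \<open>auto intro: permutes_compose\<close>)
  also have "\<dots> = - (\<Sum>w | w permutes {..<n} \<and> P w. sign w)"
    unfolding sum_negf[symmetric]
    by (rule sum.cong) (use t in \<open>auto simp: sign_permutes_comp[OF _ t(1)]\<close>)
  finally show ?thesis by simp
qed

text \<open>
  If \<open>e\<close> takes the same value at two places, then the transposition of these places is a
  sign-reversing involution on the permutations that fix \<open>e\<close>.
\<close>

lemma sum_sign_fixing:
  fixes n :: nat
  shows "(\<Sum>w | w permutes {..<n} \<and> (\<forall>j<n. e (w j) = e j). sign w) = (if inj_on e {..<n} then 1 else 0)"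
proof (cases "inj_on e {..<n}")
  case True
  have "{w. w permutes {..<n} \<and> (\<forall>j<n. e (w j) = e j)} = {id}"
  proof (intro equalityI subsetI)
    fix w assume "w \<in> {w. w permutes {..<n} \<and> (\<forall>j<n. e (w j) = e j)}"
    then have w: "w permutes {..<n}" "\<And>j. j < n \<Longrightarrow> e (w j) = e j" by auto
    have "w j = j" for j
    proof (cases "j < n")
      case True
      then have "w j < n" using permutes_in_image[OF w(1), of j] by simp
      then show ?thesis using \<open>inj_on e {..<n}\<close> w(2)[OF True] True by (auto dest: inj_onD)
    next
      case False
      then show ?thesis using permutes_not_in[OF w(1), of j] by simp
    qed
    then show "w \<in> {id}" by auto
  qed (auto simp: permutes_id)
  then show ?thesis using True by simp
next
  case False
  then obtain i j where ij: "i < n" "j < n" "i \<noteq> j" "e i = e j" by (auto simp: inj_on_def)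
  let ?t = "Transposition.transpose i j"
  have et: "e (?t k) = e k" for k using ij by (auto simp: Transposition.transpose_def)
  have t: "?t permutes {..<n}" using ij by (intro permutes_swap_id) auto
  have "(\<Sum>w | w permutes {..<n} \<and> (\<forall>j<n. e (w j) = e j). sign w) = 0"
  proof (rule sum_sign_eq_0[OF t])
    fix w assume w: "\<forall>j<n. e (w j) = e j"
    show "\<forall>j<n. e ((w \<circ> ?t) j) = e j"
      using w et permutes_in_image[OF t] by (metis comp_apply lessThan_iff)
  qed (use ij in \<open>simp_all add: sign_swap_id\<close>)
  then show ?thesis using False by simp
qed

lemma sum_injections:
  fixes g :: "nat \<Rightarrow> 'a::comm_ring_1"
  shows "(\<Sum>e | e \<in> {..<n} \<rightarrow>\<^sub>E {..<M} \<and> inj_on e {..<n}. g (\<Sum>i<n. e i)) =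
    of_nat (fact n) * (\<Sum>S | S \<subseteq> {..<M} \<and> card S = n. g (\<Sum>S))"
proof -
  define E where "E = {e. e \<in> {..<n} \<rightarrow>\<^sub>E {..<M} \<and> inj_on e {..<n}}"
  define T where "T = {S. S \<subseteq> {..<M} \<and> card S = n}"
  have fE: "finite E" unfolding E_def
    by (rule finite_subset[of _ "{..<n} \<rightarrow>\<^sub>E {..<M}"]) (auto intro: finite_PiE)
  have fT: "finite T" unfolding T_def by (rule finite_subset[of _ "Pow {..<M}"]) auto
  have img: "(\<lambda>e. e ` {..<n}) ` E \<subseteq> T"
    by (auto simp: E_def T_def card_image PiE_def Pi_def)
  have "(\<Sum>e\<in>E. g (\<Sum>i<n. e i)) = (\<Sum>S\<in>T. \<Sum>e | e \<in> E \<and> e ` {..<n} = S. g (\<Sum>i<n. e i))"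
    by (rule sum.group[OF fE fT img, symmetric])
  also have "\<dots> = (\<Sum>S\<in>T. of_nat (fact n) * g (\<Sum>S))"
  proof (rule sum.cong[OF refl])
    fix S assume "S \<in> T"
    then have S: "S \<subseteq> {..<M}" "card S = n" "finite S" by (auto simp: T_def intro: finite_subset)
    have "{e. e \<in> E \<and> e ` {..<n} = S} = {e \<in> {..<n} \<rightarrow>\<^sub>E S. inj_on e {..<n}}"
    proof (intro equalityI subsetI)
      fix e assume "e \<in> {e \<in> {..<n} \<rightarrow>\<^sub>E S. inj_on e {..<n}}"
      then have e: "e \<in> {..<n} \<rightarrow>\<^sub>E S" "inj_on e {..<n}" by auto
      then have "e ` {..<n} = S"
        using S by (intro card_subset_eq) (auto simp: card_image)
      then show "e \<in> {e. e \<in> E \<and> e ` {..<n} = S}"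
        using e S by (auto simp: E_def PiE_def Pi_def)
    qed (auto simp: E_def PiE_def Pi_def)
    moreover have "card {e \<in> {..<n} \<rightarrow>\<^sub>E S. inj_on e {..<n}} = fact n"
      using S by (subst card_inj_on_subset_funcset) (simp_all add: fact_prod_rev)
    moreover have "(\<Sum>e | e \<in> E \<and> e ` {..<n} = S. g (\<Sum>i<n. e i)) = (\<Sum>e | e \<in> E \<and> e ` {..<n} = S. g (\<Sum>S))"
    proof (rule sum.cong[OF refl])
      fix e assume "e \<in> {e. e \<in> E \<and> e ` {..<n} = S}"
      then have "inj_on e {..<n}" "e ` {..<n} = S" by (auto simp: E_def)
      then have "(\<Sum>i<n. e i) = \<Sum>S" using sum.reindex[of e "{..<n}" "\<lambda>x. x"] by simp
      then show "g (\<Sum>i<n. e i) = g (\<Sum>S)" by simp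
    qed
    ultimately show "(\<Sum>e | e \<in> E \<and> e ` {..<n} = S. g (\<Sum>i<n. e i)) = of_nat (fact n) * g (\<Sum>S)"
      by simp
  qed
  finally show ?thesis by (simp add: E_def T_def sum_distrib_left)
qed

definition subset_series :: "nat \<Rightarrow> nat \<Rightarrow> nat \<Rightarrow> int fps" where
  "subset_series r n M = (\<Sum>S | S \<subseteq> {..<M} \<and> card S = n. fps_X ^ (r * \<Sum>S))"

section \<open>Flows on three blocks\<close>

lemma mirror_lt [simp]: "mirror n i < n \<longleftrightarrow> i < n"
  using permutes_in_image[OF mirror_permutes, of n i] by simp

lemma mirror_eq_iff [simp]: "mirror n i = mirror n j \<longleftrightarrow> i = j"
  by (metis mirror_mirror)

text \<open>
  The vertices are \<open>a\<^sub>i\<close>, \<open>b\<^sub>i\<close>, \<open>c\<^sub>i\<close> for \<open>i < n\<close>, where \<open>b\<^sub>i\<close> and \<open>c\<^sub>i\<close> are numbered backwards within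
  their blocks. The edges are \<open>a\<^sub>i \<rightarrow> b\<^sub>i\<close>, \<open>b\<^sub>i \<rightarrow> c\<^sub>i\<close> and \<open>a\<^sub>i \<rightarrow> c\<^sub>w\<^sub>i\<close>; each \<open>a\<^sub>i\<close> emits
  \<open>K\<close> units and each \<open>c\<^sub>i\<close> absorbs \<open>K\<close> units. A flow is determined by the amounts \<open>e\<^sub>i\<close> that pass through the
  vertices \<open>b\<^sub>i\<close>; then \<open>K - e\<^sub>i\<close> goes directly to \<open>c\<^sub>w\<^sub>i\<close>, which receives \<open>K\<close> units if and only if
  the amount through \<open>b\<^sub>w\<^sub>i\<close> is \<open>e\<^sub>i\<close>.
\<close>

lemma three_block_flows:
  fixes w :: "nat \<Rightarrow> nat" and n K :: nat
  assumes w: "w permutes {..<n}"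
  shows "ct (fps_const (cmon 0 n (- int K) * cmon (2 * n) n (int K)) *
      (\<Prod>i<n. geo (var i * ivar (n + mirror n i))) *
      (\<Prod>i<n. geo (var (n + mirror n i) * ivar (2 * n + mirror n i))) *
      (\<Prod>i<n. geo (var i * ivar (2 * n + mirror n (w i))))) =
    (\<Sum>e | e \<in> {..<n} \<rightarrow>\<^sub>E {..<Suc K} \<and> (\<forall>j<n. e (w j) = e j). fps_X ^ (n * K + (\<Sum>i<n. e i)))"
    (is "?L = ?R")
proof (rule fps_ext)
  fix d
  define I where "I = {0, 1, 2 :: nat} \<times> {..<n}"
  define u where "u = (\<lambda>(c :: nat, i). if c = 1 then n + mirror n i else i)"
  define v where "v = (\<lambda>(c :: nat, i). if c = 0 then n + mirror n i else if c = 1 then 2 * n + mirror n i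
     else 2 * n + mirror n (w i))"
  define \<gamma>0 :: weight where "\<gamma>0 = (\<Sum>i<n. single i (- int K)) + (\<Sum>i<n. single (2 * n + i) (int K))"
  have wl: "w i < n \<longleftrightarrow> i < n" for i using permutes_in_image[OF w, of i] by simp
  have winj: "w i = w j \<longleftrightarrow> i = j" for i j using permutes_inj[OF w] by (auto dest: injD)
  have finI: "finite I" by (simp add: I_def)
  have sumI: "(\<Sum>z\<in>I. g z) = (\<Sum>i<n. g (0, i)) + (\<Sum>i<n. g (1, i)) + (\<Sum>i<n. g (2, i))"
    for g :: "nat \<times> nat \<Rightarrow> nat"
  proof -
    have "(\<Sum>z\<in>I. g z) = (\<Sum>c\<in>{0, 1, 2}. \<Sum>i<n. g (c, i))"
      by (simp only: I_def sum.cartesian_product case_prod_unfold prod.collapse)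
    then show ?thesis by (simp add: add.assoc)
  qed
  have prodI: "(\<Prod>z\<in>I. g z) = (\<Prod>i<n. g (0, i)) * (\<Prod>i<n. g (1, i)) * (\<Prod>i<n. g (2, i))"
    for g :: "nat \<times> nat \<Rightarrow> laurent fps"
  proof -
    have "(\<Prod>z\<in>I. g z) = (\<Prod>c\<in>{0, 1, 2}. \<Prod>i<n. g (c, i))"
      by (simp only: I_def prod.cartesian_product case_prod_unfold prod.collapse)
    then show ?thesis by (simp add: mult.assoc)
  qed
  have "?L = ct (fps_const (xmon \<gamma>0) * (\<Prod>z\<in>I. geo (var (u z) * ivar (v z))))"
    unfolding prodI by (simp add: u_def v_def mon_eq_xmon \<gamma>0_def xmon_add mult.assoc)
  then have "?L $ d = int (card {f \<in> flows I d. \<forall>x. lookup \<gamma>0 x + outflow I u f x = outflow I v f x})"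
    by (simp only: ct_prod_geo[OF finI])
  also have "{f \<in> flows I d. \<forall>x. lookup \<gamma>0 x + outflow I u f x = outflow I v f x} =
    {f \<in> flows I d. \<forall>j<n. f (0, j) + f (2, j) = K \<and> f (1, j) = f (0, j) \<and> f (1, w j) + f (2, j) = K}"
  proof (intro Collect_cong conj_cong refl)
    fix f
    have g1: "lookup \<gamma>0 j = - int K" if "j < n" for j
      using that by (simp add: \<gamma>0_def lookup_add lookup_sum lookup_single when_def)
    have g2: "lookup \<gamma>0 (n + j) = 0" if "j < n" for j
      using that by (auto simp: \<gamma>0_def lookup_add lookup_sum lookup_single when_def intro!: sum.neutral)
    have g3: "lookup \<gamma>0 (2 * n + j) = int K" if "j < n" for j
      using that by (simp add: \<gamma>0_def lookup_add lookup_sum lookup_single when_def)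
    have g4: "lookup \<gamma>0 x = 0" if "3 * n \<le> x" for x
      using that by (auto simp: \<gamma>0_def lookup_add lookup_sum lookup_single when_def intro!: sum.neutral)
    have u1: "{z. z \<in> I \<and> u z = j} = {(0, j), (2, j)}" and v1: "{z. z \<in> I \<and> v z = j} = {}" if "j < n" for j
      using that by (auto simp: I_def u_def v_def)
    have ml: "mirror n j < n" if "j < n" for j using that by simp
    have u2: "{z. z \<in> I \<and> u z = n + mirror n j} = {(1, j)}" and
      v2: "{z. z \<in> I \<and> v z = n + mirror n j} = {(0, j)}" if "j < n" for j
    proof -
      have "2 * n + k \<noteq> n + mirror n j" "k < n \<Longrightarrow> k \<noteq> n + mirror n j" for k
        using ml[OF that] by linarith+
      then show "{z. z \<in> I \<and> u z = n + mirror n j} = {(1, j)}" "{z. z \<in> I \<and> v z = n + mirror n j} = {(0, j)}"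
        using that by (auto simp: I_def u_def v_def simp del: mult_2 split: if_splits)
    qed
    have u3: "{z. z \<in> I \<and> u z = 2 * n + mirror n (w j)} = {}" if "j < n" for j
    proof -
      have "i \<noteq> 2 * n + mirror n (w j)" "n + mirror n i \<noteq> 2 * n + mirror n (w j)" if "i < n" for i
        using that ml[OF that] by linarith+
      then show ?thesis by (auto simp: I_def u_def)
    qed
    have v3: "{z. z \<in> I \<and> v z = 2 * n + mirror n (w j)} = {(1, w j), (2, j)}" if "j < n" for j
    proof -
      have "n + mirror n i \<noteq> 2 * n + mirror n (w j)" if "i < n" for i
        using ml[OF that] by linarith
      then show ?thesis using that by (auto simp: I_def v_def winj wl)
    qed
    have u4: "{z. z \<in> I \<and> u z = x} = {}" and v4: "{z. z \<in> I \<and> v z = x} = {}" if "3 * n \<le> x" for x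
    proof -
      have "i \<noteq> x" "n + mirror n i \<noteq> x" "2 * n + mirror n i \<noteq> x" if "i < n" for i
        using that ml[OF that] \<open>3 * n \<le> x\<close> by linarith+
      moreover have "2 * n + mirror n (w i) \<noteq> x" if "i < n" for i
        using ml[of "w i"] that wl[of i] \<open>3 * n \<le> x\<close> by linarith
      ultimately show "{z. z \<in> I \<and> u z = x} = {}" "{z. z \<in> I \<and> v z = x} = {}" by (auto simp: I_def u_def v_def)
    qed
    show "(\<forall>x. lookup \<gamma>0 x + outflow I u f x = outflow I v f x) \<longleftrightarrow>
      (\<forall>j<n. f (0, j) + f (2, j) = K \<and> f (1, j) = f (0, j) \<and> f (1, w j) + f (2, j) = K)" (is "?A \<longleftrightarrow> ?B")
    proof
      assume A: ?A
      show ?B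
      proof (intro allI impI)
        fix j assume j: "j < n"
        have "- int K + (int (f (0, j)) + int (f (2, j))) = 0"
          using A[rule_format, of j] j by (simp add: outflow_def u1 v1 g1)
        moreover have "int (f (1, j)) = int (f (0, j))"
          using A[rule_format, of "n + mirror n j"] j by (simp add: outflow_def u2 v2 g2)
        moreover have "int K = int (f (1, w j)) + int (f (2, j))"
          using A[rule_format, of "2 * n + mirror n (w j)"] j by (simp add: outflow_def u3 v3 g3 wl)
        ultimately show "f (0, j) + f (2, j) = K \<and> f (1, j) = f (0, j) \<and> f (1, w j) + f (2, j) = K"
          by linarith
      qed
    next
      assume B: ?B
      show ?A
      proof
        fix x
        consider "x < n" | j where "j < n" "x = n + mirror n j" | j where "j < n" "x = 2 * n + mirror n (w j)" | "3 * n \<le> x"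
        proof -
          consider "x < n" | "n \<le> x" "x < 2 * n" | "2 * n \<le> x" "x < 3 * n" | "3 * n \<le> x" by linarith
          then show thesis
          proof cases
            case 2
            then show thesis using that(2)[of "mirror n (x - n)"] by auto
          next
            case 3
            obtain j where "w j = mirror n (x - 2 * n)" using permutes_surj[OF w] by (metis surjD)
            moreover have "x - 2 * n < n" using 3 by linarith
            moreover from calculation have "j < n" using wl[of j] by simp
            ultimately show thesis using that(3)[of j] 3 by simp
          qed (use that in auto)
        qed
        then show "lookup \<gamma>0 x + outflow I u f x = outflow I v f x"
        proof cases
          case 1
          then have "f (0, x) + f (2, x) = K" using B by blast
          then show ?thesis using 1 by (simp add: outflow_def u1 v1 g1 flip: of_nat_add)
        next
          case 2
          then show ?thesis using B by (simp add: outflow_def u2 v2 g2)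
        next
          case 3
          then have "f (1, w j) + f (2, j) = K" using B by blast
          then show ?thesis using 3 by (simp add: outflow_def u3 v3 g3 wl flip: of_nat_add)
        next
          case 4
          then show ?thesis by (simp add: outflow_def u4 v4 g4)
        qed
      qed
    qed
  qed
  also have "card \<dots> = card {e. e \<in> {..<n} \<rightarrow>\<^sub>E {..<Suc K} \<and> (\<forall>j<n. e (w j) = e j) \<and> n * K + (\<Sum>i<n. e i) = d}"
  proof -
    let ?to = "\<lambda>f :: nat \<times> nat \<Rightarrow> nat. \<lambda>i\<in>{..<n}. f (0, i)"
    let ?from = "\<lambda>e :: nat \<Rightarrow> nat. \<lambda>z\<in>I. if fst z = 2 then K - e (snd z) else e (snd z)"
    let ?F = "{f \<in> flows I d. \<forall>j<n. f (0, j) + f (2, j) = K \<and> f (1, j) = f (0, j) \<and> f (1, w j) + f (2, j) = K}"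
    let ?E = "{e. e \<in> {..<n} \<rightarrow>\<^sub>E {..<Suc K} \<and> (\<forall>j<n. e (w j) = e j) \<and> n * K + (\<Sum>i<n. e i) = d}"
    have 1: "\<forall>f\<in>?F. ?from (?to f) = f"
    proof
      fix f assume f: "f \<in> ?F"
      show "?from (?to f) = f"
      proof (rule ext, goal_cases)
      case (1 z)
      show ?case
      proof (cases "z \<in> I")
        case True
        then obtain c j where z: "z = (c, j)" "c = 0 \<or> c = 1 \<or> c = 2" "j < n" by (auto simp: I_def)
        have F: "\<forall>j<n. f (0, j) + f (2, j) = K \<and> f (1, j) = f (0, j) \<and> f (1, w j) + f (2, j) = K"
          using f unfolding mem_Collect_eq by (rule conjunct2)
        then have F1: "f (0, j) + f (2, j) = K" and F2: "f (1, j) = f (0, j)"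
          using z(3) by (blast, blast)
        have "K - f (0, j) = f (2, j)" unfolding F1[symmetric] by (rule diff_add_inverse)
        note this F2
        then show ?thesis using z(2,3) True unfolding z(1) by (elim disjE) simp_all
      next
        case False
        have "f \<in> flows I d" using f unfolding mem_Collect_eq by (rule conjunct1)
        then have fI: "f \<in> I \<rightarrow>\<^sub>E UNIV" unfolding flows_def by (rule CollectE) (rule conjunct1)
        have "?from (?to f) z = undefined" by (rule extensional_arb[OF restrict_extensional False])
        also have "\<dots> = f z" by (rule PiE_arb[OF fI False, symmetric])
        finally show ?thesis .
      qed
      qed
    qed
    have 2: "\<forall>e\<in>?E. ?to (?from e) = e"
    proof
      fix e assume "e \<in> ?E"
      then have e: "e \<in> {..<n} \<rightarrow>\<^sub>E {..<Suc K}" by blast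
      show "?to (?from e) = e"
      proof (rule ext, goal_cases)
      case (1 j)
      show ?case
      proof (cases "j < n")
        case False
        then have j: "j \<notin> {..<n}" by simp
        have "?to (?from e) j = undefined" by (rule extensional_arb[OF restrict_extensional j])
        also have "\<dots> = e j" by (rule PiE_arb[OF e j, symmetric])
        finally show ?thesis .
      qed (simp add: I_def)
      qed
    qed
    have 3: "?to ` ?F \<subseteq> ?E"
    proof
      fix e assume "e \<in> ?to ` ?F"
      then obtain f where f: "f \<in> ?F" and e: "e = ?to f" by blast
      have fj: "f (0, j) + f (2, j) = K" "f (1, j) = f (0, j)" "f (1, w j) + f (2, j) = K" if "j < n" for j
        using f that by blast+
      have "e j < Suc K" if "j < n" for j using fj(1)[OF that] that by (simp add: e)
      moreover have "e (w j) = e j" if "j < n" for j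
        using fj(1,3)[OF that] fj(2)[of "w j"] that by (simp add: e wl)
      moreover have "n * K + (\<Sum>i<n. e i) = d"
      proof -
        have "d = (\<Sum>i<n. f (0, i)) + (\<Sum>i<n. f (1, i)) + (\<Sum>i<n. f (2, i))"
          using f unfolding flows_def sumI[symmetric] by blast
        also have "\<dots> = (\<Sum>i<n. f (0, i)) + (\<Sum>i<n. f (0, i) + f (2, i))"
          by (simp add: sum.distrib fj(2)[unfolded One_nat_def])
        also have "\<dots> = (\<Sum>i<n. e i) + n * K" by (simp add: fj(1) e)
        finally show ?thesis by simp
      qed
      moreover have "e \<in> extensional {..<n}" by (simp add: e)
      ultimately show "e \<in> ?E" by (simp add: PiE_def Pi_def)
    qed
    have 4: "?from ` ?E \<subseteq> ?F"
    proof
      fix f assume "f \<in> ?from ` ?E"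
      then obtain e where e: "e \<in> ?E" and f: "f = ?from e" by blast
      have ej: "e j \<le> K" "e (w j) = e j" if "j < n" for j using e that by (auto simp: PiE_def Pi_def less_Suc_eq_le)
      have f0: "f (0, j) = e j" "f (1, j) = e j" "f (2, j) = K - e j" if "j < n" for j
        using that by (simp_all add: f I_def)
      have "sum f I = (\<Sum>i<n. e i) + ((\<Sum>i<n. e i + (K - e i)))"
        unfolding sumI sum.distrib by (simp add: f0 f0(2)[unfolded One_nat_def])
      also have "(\<Sum>i<n. e i + (K - e i)) = (\<Sum>i<n. K)" by (rule sum.cong) (use ej in auto)
      finally have "sum f I = d" using e by simp
      moreover have "f \<in> extensional I" unfolding f by (rule restrict_extensional)
      ultimately have "f \<in> flows I d" by (simp add: flows_def PiE_def)
      moreover have "f (0, j) + f (2, j) = K \<and> f (1, j) = f (0, j) \<and> f (1, w j) + f (2, j) = K" if "j < n" for j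
        using ej[OF that] f0[OF that] f0(2)[of "w j"] wl[of j] that by simp
      ultimately show "f \<in> ?F" by blast
    qed
    show "card ?F = card ?E"
      using bij_betw_byWitness[OF 1 2 3 4] by (rule bij_betw_same_card)
  qed
  also have "int \<dots> = ?R $ d"
  proof -
    have "finite ({..<n} \<rightarrow>\<^sub>E {..<Suc K})" by (intro finite_PiE) auto
    then have fin: "finite {e. e \<in> {..<n} \<rightarrow>\<^sub>E {..<Suc K} \<and> (\<forall>j<n. e (w j) = e j)}"
      by (rule rev_finite_subset) auto
    have "?R $ d = (\<Sum>e | e \<in> {..<n} \<rightarrow>\<^sub>E {..<Suc K} \<and> (\<forall>j<n. e (w j) = e j). if n * K + (\<Sum>i<n. e i) = d then 1 else 0)"
      unfolding fps_sum_nth by (rule sum.cong) (auto simp: fps_X_power_iff)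
    also have "\<dots> = int (card {e. e \<in> {..<n} \<rightarrow>\<^sub>E {..<Suc K} \<and> (\<forall>j<n. e (w j) = e j) \<and> n * K + (\<Sum>i<n. e i) = d})"
      using fin by (simp add: conj_assoc flip: sum.inter_filter)
    finally show ?thesis by simp
  qed
  finally show "?L $ d = ?R $ d" .
qed

section \<open>Kostka polynomials with separated groups of variables\<close>

lemma sum_ct_const:
  "(\<Sum>p\<in>S. of_int (c p) * ct (fps_const (a * f p) * G)) = ct (fps_const (a * (\<Sum>p\<in>S. of_int (c p) * f p)) * G)"
proof -
  have "fps_const (a * (\<Sum>p\<in>S. of_int (c p) * f p)) * G = (\<Sum>p\<in>S. of_int (c p) * (fps_const (a * f p) * G))"
    unfolding sum_distrib_left fps_const_sum sum_distrib_right
    by (intro sum.cong refl) (simp add: fps_of_int mult_ac flip: fps_const_mult)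
  then show ?thesis by (simp add: ct_sum ct_of_int_mult)
qed

lemma sum_ct_const':
  "(\<Sum>p\<in>S. of_int (c p) * ct (fps_const (a * f p * b) * G)) =
    ct (fps_const (a * (\<Sum>p\<in>S. of_int (c p) * f p) * b) * G)"
  using sum_ct_const[where c = c and S = S and a = "a * b" and f = f and G = G] by (simp only: mult_ac)

lemma mon_affine: "mon n v (\<lambda>i. C + int (n - 1 - i)) = mon n v (\<lambda>i. C) * mon n v (\<lambda>i. int (n - 1 - i))"
  by (simp only: mon_mult)

lemma block_signed_sum:
  "(\<Sum>p | p permutes {..<n}. of_int (sign p) * mon n (\<lambda>i. s + p i) (\<lambda>i. - (C + int (n - 1 - i)))) =
    cmon s n (- C) * block_ialt s n"
  unfolding alt_sum_def sum_distrib_left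
proof (rule sum.cong[OF refl])
  fix p assume "p \<in> {p. p permutes {..<n}}"
  then have p: "p permutes {..<n}" by simp
  have "mon n (\<lambda>i. s + p i) (\<lambda>i. - (C + int (n - 1 - i))) =
      mon n (\<lambda>i. s + p i) (\<lambda>i. - C) * mon n (\<lambda>i. s + p i) (\<lambda>i. - int (n - 1 - i))"
    unfolding mon_mult by (rule mon_cong) simp_all
  also have "mon n (\<lambda>i. s + p i) (\<lambda>i. - C) = cmon s n (- C)"
    using mon_permutes[OF p, of "\<lambda>i. s + i" "\<lambda>i. - C"] .
  also have "mon n (\<lambda>i. s + p i) (\<lambda>i. - int (n - 1 - i)) = (\<Prod>i<n. ivar (s + p i) ^ (n - 1 - i))"
    by (simp only: mon_def xmon_single_neg_nat)
  finally show "of_int (sign p) * mon n (\<lambda>i. s + p i) (\<lambda>i. - (C + int (n - 1 - i))) =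
    cmon s n (- C) * (of_int (sign p) * (\<Prod>i<n. ivar (s + p i) ^ (n - 1 - i)))"
    by (simp only: mult_ac)
qed

lemma cmon_mult: "cmon s n c * cmon s n c' = cmon s n (c + c')"
  by (rule mon_mult)

text \<open>
  Here the partial sums of \<open>\<kappa>\<close> and \<open>\<nu>\<close> may differ, which a larger gap in \<open>\<kappa>\<close> compensates for. Since \<open>\<kappa>\<close> is
  \<open>\<delta>\<close> plus a constant on each group, the signed sum over the permutations of a group is an alternant
  in the inverse variables of the group.
\<close>

lemma weyl_sum_two_groups:
  fixes \<kappa> \<nu> :: "nat \<Rightarrow> int"
  assumes \<Phi>: "\<And>i j. (i, j) \<in> \<Phi> \<Longrightarrow> i < j"
    and \<kappa>1: "\<And>i. i < a \<Longrightarrow> \<kappa> i = C + int (a - 1 - i)" and \<kappa>2: "\<And>i. i < b \<Longrightarrow> \<kappa> (a + i) = C' + int (b - 1 - i)"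
    and gap: "C' + int b \<le> C" "sum \<kappa> {..<a} < sum \<nu> {..<a} + (C - (C' + int b) + 1)"
  shows "weyl_sum (a + b) \<Phi> \<kappa> \<nu> = ct (fps_const (mon (a + b) id \<nu> * ((cmon 0 a (- C) * block_ialt 0 a) *
     (cmon a b (- C') * block_ialt a b))) * root_series \<Phi>)"
proof -
  define t where "t w = of_int (sign w) * ct (fps_const (mon (a + b) id \<nu> * mon (a + b) w (\<lambda>i. - \<kappa> i)) * root_series \<Phi>)" for w
  define t1 where "t1 p = mon a (\<lambda>i. 0 + p i) (\<lambda>i. - (C + int (a - 1 - i)))" for p
  define t2 where "t2 r = mon b (\<lambda>i. a + r i) (\<lambda>i. - (C' + int (b - 1 - i)))" for r
  have "weyl_sum (a + b) \<Phi> \<kappa> \<nu> = (\<Sum>w | w permutes {..<a + b}. t w)"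
    by (simp add: weyl_sum_def t_def)
  also have "\<dots> = (\<Sum>p | p permutes {..<a}. \<Sum>r | r permutes {..<b}. t (p \<circ> shift_perm a r))"
  proof (rule sum_stabilizing)
    fix w assume w: "w permutes {..<a + b}" "w ` {..<a} \<noteq> {..<a}"
    have "ct (fps_const (mon (a + b) id \<nu> * mon (a + b) w (\<lambda>i. - \<kappa> i)) * root_series \<Phi>) = 0"
    proof (rule ct_eq_0_unless_stabilizing[OF w, of "C - (C' + int b) + 1" _ C])
      show "\<kappa> i \<le> C - (C - (C' + int b) + 1)" if "a \<le> i" "i < a + b" for i
      proof -
        have "\<kappa> i = C' + int (b - 1 - (i - a))" using \<kappa>2[of "i - a"] that by simp
        then show ?thesis using that by simp
      qed
    qed (use \<Phi> gap \<kappa>1 in auto)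
    then show "t w = 0" by (simp add: t_def)
  qed
  also have "\<dots> = (\<Sum>p | p permutes {..<a}. \<Sum>r | r permutes {..<b}. of_int (sign p) *
      (of_int (sign r) * ct (fps_const ((mon (a + b) id \<nu> * t1 p) * t2 r) * root_series \<Phi>)))"
  proof (intro sum.cong refl)
    fix p r assume "p \<in> {p. p permutes {..<a}}" "r \<in> {r. r permutes {..<b}}"
    then have p: "p permutes {..<a}" and r: "r permutes {..<b}" by auto
    have pa: "p (a + i) = a + i" for i using permutes_not_in[OF p, of "a + i"] by simp
    have "mon (a + b) (p \<circ> shift_perm a r) (\<lambda>i. - \<kappa> i) = t1 p * t2 r"
      unfolding mon_block_permutation[OF r] t1_def t2_def
      by (intro arg_cong2[where f = "(*)"] mon_cong) (simp_all add: pa \<kappa>1 \<kappa>2)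
    then show "t (p \<circ> shift_perm a r) = of_int (sign p) *
      (of_int (sign r) * ct (fps_const ((mon (a + b) id \<nu> * t1 p) * t2 r) * root_series \<Phi>))"
      unfolding t_def sign_block_permutation[OF p r] by (simp only: of_int_mult mult.assoc)
  qed
  also have "\<dots> = (\<Sum>p | p permutes {..<a}. of_int (sign p) *
      ct (fps_const (mon (a + b) id \<nu> * t1 p * (cmon a b (- C') * block_ialt a b)) * root_series \<Phi>))"
    by (intro sum.cong refl) (simp only: sum_distrib_left[symmetric] sum_ct_const t2_def block_signed_sum)
  also have "\<dots> = ct (fps_const (mon (a + b) id \<nu> * ((cmon 0 a (- C) * block_ialt 0 a) *
     (cmon a b (- C') * block_ialt a b))) * root_series \<Phi>)"
    unfolding sum_ct_const' t1_def block_signed_sum by (simp only: mult.assoc)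
  finally show ?thesis .
qed

lemma weyl_sum_three_groups:
  fixes \<kappa> \<nu> :: "nat \<Rightarrow> int" and n :: nat
  assumes \<Phi>: "\<And>i j. (i, j) \<in> \<Phi> \<Longrightarrow> i < j"
    and \<kappa>1: "\<And>i. i < n \<Longrightarrow> \<kappa> i = C1 + int (n - 1 - i)" and \<kappa>2: "\<And>i. i < n \<Longrightarrow> \<kappa> (n + i) = C2 + int (n - 1 - i)"
    and \<kappa>3: "\<And>i. i < n \<Longrightarrow> \<kappa> (2 * n + i) = C3 + int (n - 1 - i)"
    and gap1: "C2 + int n \<le> C1" "sum \<kappa> {..<n} < sum \<nu> {..<n} + (C1 - (C2 + int n) + 1)"
    and gap2: "C3 + int n \<le> C2" "sum \<kappa> {..<2 * n} < sum \<nu> {..<2 * n} + (C2 - (C3 + int n) + 1)"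
  shows "weyl_sum (2 * n + n) \<Phi> \<kappa> \<nu> = ct (fps_const (mon (2 * n + n) id \<nu> * ((cmon 0 n (- C1) * block_ialt 0 n) *
     ((cmon n n (- C2) * block_ialt n n) * (cmon (2 * n) n (- C3) * block_ialt (2 * n) n)))) * root_series \<Phi>)"
proof -
  let ?N = "2 * n + n"
  let ?M = "mon ?N id \<nu>"
  define t where "t w = of_int (sign w) * ct (fps_const (?M * mon ?N w (\<lambda>i. - \<kappa> i)) * root_series \<Phi>)" for w
  define t1 where "t1 p = mon n (\<lambda>i. 0 + p i) (\<lambda>i. - (C1 + int (n - 1 - i)))" for p
  define t2 where "t2 r = mon n (\<lambda>i. n + r i) (\<lambda>i. - (C2 + int (n - 1 - i)))" for r
  define t3 where "t3 r = mon n (\<lambda>i. 2 * n + r i) (\<lambda>i. - (C3 + int (n - 1 - i)))" for r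
  have split: "i < n \<or> (\<exists>j<n. i = n + j) \<or> (\<exists>j<n. i = 2 * n + j)" if "i < ?N" for i
  proof -
    consider "i < n" | "n \<le> i" "i < 2 * n" | "2 * n \<le> i" by linarith
    then show ?thesis
    proof cases
      case 2 then show ?thesis by (intro disjI2 disjI1 exI[of _ "i - n"]) auto
    next
      case 3 then show ?thesis using that by (intro disjI2 exI[of _ "i - 2 * n"]) auto
    qed simp
  qed
  have lo1: "\<kappa> i \<le> C1 - (C1 - (C2 + int n) + 1)" if "n \<le> i" "i < ?N" for i
    using split[OF that(2)] that(1) \<kappa>2 \<kappa>3 gap2(1) by fastforce
  have lo2: "\<kappa> i \<le> C2 - (C2 - (C3 + int n) + 1)" if "2 * n \<le> i" "i < ?N" for i
    using split[OF that(2)] that(1) \<kappa>3 by fastforce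
  have hi2: "C2 \<le> \<kappa> i" if "i < 2 * n" for i
    using split[of i] that \<kappa>1 \<kappa>2 gap1(1) by fastforce
  have zero1: "t w = 0" if "w permutes {..<?N}" "w ` {..<n} \<noteq> {..<n}" for w
    using ct_eq_0_unless_stabilizing[OF that, of "C1 - (C2 + int n) + 1" \<Phi> C1 \<kappa> \<nu>] \<Phi> \<kappa>1 lo1 gap1
    by (simp add: t_def)
  have zero2: "t w = 0" if "w permutes {..<?N}" "w ` {..<2 * n} \<noteq> {..<2 * n}" for w
    using ct_eq_0_unless_stabilizing[OF that, of "C2 - (C3 + int n) + 1" \<Phi> C2 \<kappa> \<nu>] \<Phi> hi2 lo2 gap2
    by (simp add: t_def)
  have "weyl_sum ?N \<Phi> \<kappa> \<nu> = (\<Sum>w | w permutes {..<?N}. t w)"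
    by (simp add: weyl_sum_def t_def)
  also have "\<dots> = (\<Sum>w | w permutes {..<2 * n}. \<Sum>r | r permutes {..<n}. t (w \<circ> shift_perm (2 * n) r))"
    by (rule sum_stabilizing) (rule zero2)
  also have "\<dots> = (\<Sum>w | w permutes {..<n + n}. \<Sum>r | r permutes {..<n}. t (w \<circ> shift_perm (2 * n) r))"
    by (simp only: mult_2)
  also have "\<dots> = (\<Sum>p | p permutes {..<n}. \<Sum>q | q permutes {..<n}. \<Sum>r | r permutes {..<n}.
      t (p \<circ> shift_perm n q \<circ> shift_perm (2 * n) r))"
  proof (rule sum_stabilizing)
    fix w assume w: "w permutes {..<n + n}" "w ` {..<n} \<noteq> {..<n}"
    show "(\<Sum>r | r permutes {..<n}. t (w \<circ> shift_perm (2 * n) r)) = 0"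
    proof (intro sum.neutral ballI zero1)
      fix r assume "r \<in> {r. r permutes {..<n}}"
      then have r: "r permutes {..<n}" by simp
      show "w \<circ> shift_perm (2 * n) r permutes {..<?N}"
        by (rule permutes_compose[OF shift_perm_permutes(2)[OF r]]) (rule permutes_subset[OF w(1)], auto)
      have "(w \<circ> shift_perm (2 * n) r) ` {..<n} = w ` {..<n}"
        by (intro image_cong) (auto simp: shift_perm_def)
      then show "(w \<circ> shift_perm (2 * n) r) ` {..<n} \<noteq> {..<n}" using w(2) by simp
    qed
  qed
  also have "\<dots> = (\<Sum>p | p permutes {..<n}. \<Sum>q | q permutes {..<n}. \<Sum>r | r permutes {..<n}.
      of_int (sign p) * (of_int (sign q) * (of_int (sign r) *
        ct (fps_const ((?M * t1 p * t2 q) * t3 r) * root_series \<Phi>))))"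
  proof (intro sum.cong refl)
    fix p q r assume "p \<in> {p. p permutes {..<n}}" "q \<in> {q. q permutes {..<n}}" "r \<in> {r. r permutes {..<n}}"
    then have p: "p permutes {..<n}" and q: "q permutes {..<n}" and r: "r permutes {..<n}" by auto
    have pq: "p \<circ> shift_perm n q permutes {..<2 * n}"
      by (rule permutes_compose) (rule permutes_subset[OF shift_perm_permutes(2)[OF q]] permutes_subset[OF p], auto)+
    have pa: "p (n + i) = n + i" for i using permutes_not_in[OF p, of "n + i"] by simp
    have pqa: "(p \<circ> shift_perm n q) (2 * n + i) = 2 * n + i" for i
      using permutes_not_in[OF pq, of "2 * n + i"] by simp
    have "mon ?N (p \<circ> shift_perm n q \<circ> shift_perm (2 * n) r) (\<lambda>i. - \<kappa> i) =
        mon (n + n) (p \<circ> shift_perm n q) (\<lambda>i. - \<kappa> i) * t3 r"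
      unfolding mon_block_permutation[OF r] pqa t3_def mult_2[of n, symmetric]
      by (intro arg_cong2[where f = "(*)"] mon_cong) (simp_all add: \<kappa>3)
    also have "mon (n + n) (p \<circ> shift_perm n q) (\<lambda>i. - \<kappa> i) = t1 p * t2 q"
      unfolding mon_block_permutation[OF q] t1_def t2_def
      by (intro arg_cong2[where f = "(*)"] mon_cong) (simp_all add: pa \<kappa>1 \<kappa>2)
    finally show "t (p \<circ> shift_perm n q \<circ> shift_perm (2 * n) r) =
      of_int (sign p) * (of_int (sign q) * (of_int (sign r) *
        ct (fps_const ((?M * t1 p * t2 q) * t3 r) * root_series \<Phi>)))"
      unfolding t_def sign_block_permutation[OF pq r] sign_block_permutation[OF p q]
      by (simp only: of_int_mult mult.assoc)
  qed
  also have "\<dots> = (\<Sum>p | p permutes {..<n}. \<Sum>q | q permutes {..<n}. of_int (sign p) * (of_int (sign q) *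
        ct (fps_const (?M * t1 p * t2 q * (cmon (2 * n) n (- C3) * block_ialt (2 * n) n)) * root_series \<Phi>)))"
    by (intro sum.cong refl) (simp only: sum_distrib_left[symmetric] sum_ct_const t3_def block_signed_sum)
  also have "\<dots> = (\<Sum>p | p permutes {..<n}. of_int (sign p) *
        ct (fps_const (?M * t1 p * ((cmon n n (- C2) * block_ialt n n) * (cmon (2 * n) n (- C3) * block_ialt (2 * n) n))) * root_series \<Phi>))"
    by (intro sum.cong refl)
       (simp only: sum_distrib_left[symmetric] sum_ct_const' t2_def block_signed_sum, simp only: mult.assoc)
  also have "\<dots> = ct (fps_const (?M * ((cmon 0 n (- C1) * block_ialt 0 n) *
     ((cmon n n (- C2) * block_ialt n n) * (cmon (2 * n) n (- C3) * block_ialt (2 * n) n)))) * root_series \<Phi>)"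
    unfolding sum_ct_const' t1_def block_signed_sum by (simp only: mult.assoc)
  finally show ?thesis .
qed

section \<open>The three-block constant term\<close>

lemma block_antisym_ialt: "t \<le> s \<Longrightarrow> s + n \<le> t + m \<Longrightarrow> block_antisym s n (fps_const (block_ialt t m))"
  unfolding ivar_def by (rule block_antisym_alt_sum)

lemma block_sym_ialt: "apart s n t m \<Longrightarrow> block_sym s n (fps_const (block_ialt t m))"
  unfolding ivar_def by (rule block_sym_alt_sum_apart)

text \<open>
  The blocks \<open>A\<close>, \<open>B\<close>, \<open>C\<close> start at the variables \<open>0\<close>, \<open>n\<close> and \<open>2 * n\<close>. Each block carries \<open>x\<^sup>\<delta>\<close> and an
  alternant in its inverse variables. Antisymmetrizing \<open>x\<^sup>\<delta>\<close> on \<open>A\<close> yields the alternant that,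
  with \<open>x\<^sup>\<delta>\<close> on \<open>B\<close>, reduces the pair \<open>A\<close>, \<open>B\<close> to one matching. The inverse alternant of \<open>B\<close>
  is a monomial times its ordinary alternant, and together with \<open>x\<^sup>\<delta>\<close> on \<open>C\<close> it reduces the pair \<open>B\<close>, \<open>C\<close>. The
  two inverse alternants of \<open>A\<close> and \<open>C\<close> that are left expand the pair \<open>A\<close>, \<open>C\<close> into the sum over all
  matchings.
\<close>

lemma three_block_ct:
  fixes n k :: nat
  defines "G_AB \<equiv> root_series ({0..<0 + n} \<times> {n..<n + n})"
    and "G_AC \<equiv> root_series ({0..<0 + n} \<times> {2 * n..<2 * n + n})"
    and "G_BC \<equiv> root_series ({n..<n + n} \<times> {2 * n..<2 * n + n})"
  assumes n: "0 < n"
  shows "fps_X ^ (3 * (\<Sum>i<n. i)) * ct (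
      fps_const (cmon 0 n (- int k)) * fps_const (cmon (2 * n) n (int k)) *
      (fps_const (dmon 0 n) * fps_const (dmon n n) * fps_const (dmon (2 * n) n)) *
      (fps_const (block_ialt 0 n) * fps_const (block_ialt n n) * fps_const (block_ialt (2 * n) n)) *
      (G_AB * G_AC * G_BC)) =
    fps_X ^ (n * (k + n - 1)) * subset_series 1 n (k + n)"
proof -
  define T where "T = (\<Sum>i<n. i)"
  define K where "K = k + n - 1"
  define cA where "cA = fps_const (cmon 0 n (- int k))"
  define cC where "cC = fps_const (cmon (2 * n) n (int k))"
  define dA where "dA = fps_const (dmon 0 n)"
  define dB where "dB = fps_const (dmon n n)"
  define dC where "dC = fps_const (dmon (2 * n) n)"
  define iA where "iA = fps_const (block_ialt 0 n)"
  define iB where "iB = fps_const (block_ialt n n)"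
  define iC where "iC = fps_const (block_ialt (2 * n) n)"
  define VA where "VA = fps_const (vandermonde n (\<lambda>i. var (0 + mirror n i)))"
  define VA' where "VA' = fps_const (vandermonde n (\<lambda>i. var (0 + id i)))"
  define VB where "VB = fps_const (vandermonde n (\<lambda>i. var (n + id i)))"
  define VC where "VC = fps_const (vandermonde n (\<lambda>i. ivar (2 * n + mirror n i)))"
  define PAB where "PAB = (\<Prod>i<n. geo (var (0 + mirror n i) * ivar (n + i)))"
  define PBC where "PBC = (\<Prod>i<n. geo (var (n + id i) * ivar (2 * n + i)))"
  define PAC where "PAC w = (\<Prod>i<n. geo (var (0 + id i) * ivar (2 * n + mirror n (w i))))" for w
  \<comment> \<open>The monomials by which an alternant differs from the one in the inverse variables.\<close>
  define up where "up s = fps_const (cmon s n (int (n - 1)))" for s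
  define dn where "dn s = fps_const (cmon s n (- int (n - 1)))" for s
  define W where "W = ct (cA * cC * (dA * dB * dC) * (iA * iB * iC) * (G_AB * G_AC * G_BC))"
  have updn: "up s * dn s = 1" for s
    unfolding up_def dn_def fps_const_mult cmon_mult by simp
  have iA: "iA = dn 0 * VA'" and iB: "iB = dn n * VB"
    by (simp_all only: iA_def iB_def VA'_def VB_def dn_def block_ialt_inverse fps_const_mult id_apply)
  have iC: "iC = VC" unfolding iC_def VC_def alt_sum_decreasing ..
  have anti: "block_antisym 0 n iA" "block_antisym n n iB" "block_antisym (2 * n) n iC"
    by (simp_all only: iA_def iB_def iC_def block_antisym_ialt le_refl)
  have sym_c: "block_sym s n cA" "block_sym s n cC" if "s = 0 \<or> s = n \<or> s = 2 * n" for s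
    using that unfolding cA_def cC_def
    by (auto intro: block_sym_mon_const block_sym_mon_apart simp del: add_0)
  have sym_d: "block_sym 0 n dB" "block_sym 0 n dC" "block_sym n n dC"
    unfolding dB_def dC_def by (rule block_sym_mon_apart; simp)+
  have sym_i: "block_sym 0 n iB" "block_sym 0 n iC" "block_sym n n iA" "block_sym n n iC" "block_sym (2 * n) n iA"
    unfolding iA_def iB_def iC_def by (rule block_sym_ialt; simp)+
  have sym_G: "block_sym 0 n G_AB" "block_sym 0 n G_AC" "block_sym 0 n G_BC" "block_sym n n G_AC" "block_sym n n G_BC" "block_sym (2 * n) n G_AC"
    unfolding G_AB_def G_AC_def G_BC_def by (rule block_sym_root_series; simp)+
  have sym_P: "block_sym (2 * n) n PAB"
    unfolding PAB_def
  proof (intro block_sym_prod block_sym_geo)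
    fix i assume "i \<in> {..<n}"
    then have "mirror n i < n" "i < n" by simp_all
    then show "0 + mirror n i < 2 * n \<or> 2 * n + n \<le> 0 + mirror n i" "n + i < 2 * n \<or> 2 * n + n \<le> n + i"
      by linarith+
  qed
  have "of_nat (fact n) * W = of_nat (fact n) * ct ((iA * (cA * cC * dB * dC * iB * iC * G_AB * G_AC * G_BC)) * fps_const (dmon 0 n))"
    unfolding W_def dA_def by (simp only: mult_ac)
  also have "\<dots> = ct ((iA * (cA * cC * dB * dC * iB * iC * G_AB * G_AC * G_BC)) * fps_const (block_alt 0 n))"
    by (intro ct_antisymmetrize block_antisym_mult_sym block_sym_mult anti sym_c sym_d sym_i sym_G) simp_all
  also have "\<dots> = ct ((iB * (cA * cC * dC * iA * iC * G_AC * G_BC)) * (VA * dB) * G_AB)"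
    unfolding alt_sum_decreasing VA_def by (simp only: mult_ac)
  finally have 1: "fps_X ^ T * (of_nat (fact n) * W) =
      fps_X ^ T * ct ((iB * (cA * cC * dC * iA * iC * G_AC * G_BC)) * (VA * dB) * G_AB)" by simp
  also have "\<dots> = ct ((iB * (cA * cC * dC * iA * iC * G_AC * G_BC)) * up n * PAB)"
    unfolding VA_def dB_def up_def PAB_def G_AB_def T_def fps_const_mult
    by (intro ct_block_cauchy block_antisym_mult_sym block_sym_mult anti sym_c sym_d sym_i sym_G mirror_permutes) simp_all
  also have "\<dots> = ct ((iC * (cA * cC * iA * G_AC * PAB)) * (VB * dC) * G_BC)"
  proof -
    have "(iB * (cA * cC * dC * iA * iC * G_AC * G_BC)) * up n * PAB =
        (iC * (cA * cC * iA * G_AC * PAB)) * (VB * dC) * G_BC * (up n * dn n)"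
      unfolding iB by (simp only: mult_ac)
    then show ?thesis by (simp only: updn mult_1_right)
  qed
  finally have "fps_X ^ T * (fps_X ^ T * (of_nat (fact n) * W)) = fps_X ^ T * \<dots>" by simp
  also have "\<dots> = ct ((iC * (cA * cC * iA * G_AC * PAB)) * up (2 * n) * PBC)"
    unfolding VB_def dC_def up_def PBC_def G_BC_def T_def fps_const_mult
    by (intro ct_block_cauchy block_antisym_mult_sym block_sym_mult anti sym_c sym_d sym_i sym_G sym_P permutes_id) simp_all
  finally have "fps_X ^ T * (fps_X ^ T * (fps_X ^ T * (of_nat (fact n) * W))) = fps_X ^ T * \<dots>" by simp
  also have "\<dots> = ct ((cA * dn 0 * (cC * up (2 * n)) * PAB * PBC) * (fps_X ^ T * (VA' * VC) * G_AC))"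
    unfolding iA iC ct_X_power_mult[symmetric] by (simp only: mult_ac)
  also have "fps_X ^ T * (VA' * VC) * G_AC = (\<Sum>w | w permutes {..<n}. of_int (sign w) * PAC w)"
    unfolding VA'_def VC_def G_AC_def T_def PAC_def fps_const_mult
    by (rule block_cauchy[OF permutes_id mirror_permutes])
  also have "ct ((cA * dn 0 * (cC * up (2 * n)) * PAB * PBC) * (\<Sum>w | w permutes {..<n}. of_int (sign w) * PAC w)) =
     (\<Sum>w | w permutes {..<n}. of_int (sign w) * ct (cA * dn 0 * (cC * up (2 * n)) * PAB * PBC * PAC w))"
    unfolding sum_distrib_left ct_sum mult.left_commute[of _ "of_int _"] ct_of_int_mult ..
  also have "\<dots> = (\<Sum>w | w permutes {..<n}. of_int (sign w) *
     (\<Sum>e | e \<in> {..<n} \<rightarrow>\<^sub>E {..<Suc K} \<and> (\<forall>j<n. e (w j) = e j). fps_X ^ (n * K + (\<Sum>i<n. e i))))"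
  proof (intro sum.cong refl arg_cong2[where f = "(*)"])
    fix w assume "w \<in> {w. w permutes {..<n}}"
    then have w: "w permutes {..<n}" by simp
    have a: "cA * dn 0 = fps_const (cmon 0 n (- int K))" and c: "cC * up (2 * n) = fps_const (cmon (2 * n) n (int K))"
      using n unfolding cA_def cC_def dn_def up_def fps_const_mult cmon_mult K_def
      by (auto intro!: arg_cong[where f = fps_const] mon_cong simp: of_nat_diff)
    have AB: "PAB = (\<Prod>i<n. geo (var i * ivar (n + mirror n i)))"
      using prod_mirror[of "\<lambda>i. geo (var i * ivar (n + mirror n i))" n] by (simp add: PAB_def)
    have BC: "PBC = (\<Prod>i<n. geo (var (n + mirror n i) * ivar (2 * n + mirror n i)))"
      using prod_mirror[of "\<lambda>i. geo (var (n + i) * ivar (2 * n + i))" n] by (simp add: PBC_def)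
    have AC: "PAC w = (\<Prod>i<n. geo (var i * ivar (2 * n + mirror n (w i))))"
      by (simp add: PAC_def)
    show "ct (cA * dn 0 * (cC * up (2 * n)) * PAB * PBC * PAC w) =
      (\<Sum>e | e \<in> {..<n} \<rightarrow>\<^sub>E {..<Suc K} \<and> (\<forall>j<n. e (w j) = e j). fps_X ^ (n * K + (\<Sum>i<n. e i)))"
      unfolding a c AB BC AC fps_const_mult by (rule three_block_flows[OF w])
  qed
  also have "\<dots> = (\<Sum>e | e \<in> {..<n} \<rightarrow>\<^sub>E {..<Suc K} \<and> inj_on e {..<n}. fps_X ^ (n * K + (\<Sum>i<n. e i)))"
  proof -
    define E where "E = {..<n} \<rightarrow>\<^sub>E {..<Suc K}"
    have fE: "finite E" unfolding E_def by (intro finite_PiE) auto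
    define x :: "(nat \<Rightarrow> nat) \<Rightarrow> int fps" where "x e = fps_X ^ (n * K + (\<Sum>i<n. e i))" for e
    have "(\<Sum>w | w permutes {..<n}. of_int (sign w) * (\<Sum>e | e \<in> E \<and> (\<forall>j<n. e (w j) = e j). x e)) =
      (\<Sum>w | w permutes {..<n}. \<Sum>e\<in>E. if \<forall>j<n. e (w j) = e j then of_int (sign w) * x e else 0)"
      using fE by (simp add: sum_distrib_left sum.inter_filter if_distrib cong: if_cong)
    also have "\<dots> = (\<Sum>e\<in>E. \<Sum>w | w permutes {..<n}. if \<forall>j<n. e (w j) = e j then of_int (sign w) * x e else 0)"
      by (rule sum.swap)
    also have "\<dots> = (\<Sum>e\<in>E. of_int (\<Sum>w | w permutes {..<n} \<and> (\<forall>j<n. e (w j) = e j). sign w) * x e)"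
    proof (rule sum.cong[OF refl])
      fix e
      have "(\<Sum>w | w permutes {..<n}. if \<forall>j<n. e (w j) = e j then of_int (sign w) * x e else 0) =
        (\<Sum>w | w permutes {..<n} \<and> (\<forall>j<n. e (w j) = e j). of_int (sign w) * x e)"
        using sum.inter_filter[OF finite_permutations[of "{..<n}"], of "\<lambda>w. of_int (sign w) * x e" "\<lambda>w. \<forall>j<n. e (w j) = e j"]
        by simp
      then show "(\<Sum>w | w permutes {..<n}. if \<forall>j<n. e (w j) = e j then of_int (sign w) * x e else 0) =
        of_int (\<Sum>w | w permutes {..<n} \<and> (\<forall>j<n. e (w j) = e j). sign w) * x e"
        by (simp add: sum_distrib_right)
    qed
    also have "\<dots> = (\<Sum>e\<in>E. if inj_on e {..<n} then x e else 0)"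
      unfolding sum_sign_fixing by (rule sum.cong) auto
    also have "\<dots> = (\<Sum>e | e \<in> E \<and> inj_on e {..<n}. x e)"
      using fE by (simp add: sum.inter_filter)
    finally show ?thesis by (simp only: E_def x_def)
  qed
  also have "\<dots> = of_nat (fact n) * (fps_X ^ (n * K) * subset_series 1 n (k + n))"
    unfolding sum_injections[of "\<lambda>m. fps_X ^ (n * K + m)" n "Suc K"] subset_series_def
    using n by (simp add: K_def power_add sum_distrib_left)
  finally have "of_nat (fact n) * (fps_X ^ (3 * T) * W) = of_nat (fact n) * (fps_X ^ (n * K) * subset_series 1 n (k + n))"
    by (simp add: power_add numeral_3_eq_3 mult_ac)
  then have "fps_X ^ (3 * T) * W = fps_X ^ (n * K) * subset_series 1 n (k + n)"
    by simp
  then show ?thesis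
    unfolding W_def cA_def cC_def dA_def dB_def dC_def iA_def iB_def iC_def K_def T_def .
qed

section \<open>Flows on two pairs of blocks\<close>

text \<open>
  The amount that the vertices of a block of \<open>2 * n\<close> vertices exchange with another such block,
  when \<open>f\<^sub>i\<close> units pass from the vertex \<open>i\<close> of the first half to its mirror image in the second half. By
  symmetry the same function describes the amounts sent and the amounts received.
\<close>

definition fold_map :: "nat \<Rightarrow> nat \<Rightarrow> nat \<Rightarrow> (nat \<Rightarrow> nat) \<Rightarrow> nat \<Rightarrow> nat" where
  "fold_map n s t f i = (if i < n then s - f i else t + f (mirror n (i - n)))"

lemma sum_mirror: "(\<Sum>i<n. f (mirror n i)) = (\<Sum>i<n. f i)"
  using sum.permute[OF mirror_permutes, of f n] by (simp add: o_def)

lemma sum_lessThan_add: "(\<Sum>i<a + b. f i) = (\<Sum>i<a. f i) + (\<Sum>i<b. f (a + i :: nat) :: 'a::comm_monoid_add)"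
  by (induction b) (simp_all add: add_ac)

lemma lookup_interval_mon:
  fixes a x :: nat and c :: int
  shows "lookup (\<Sum>i<n. single (a + i) c) x = (if a \<le> x \<and> x < a + n then c else 0)"
proof -
  have "lookup (\<Sum>i<n. single (a + i) c) x = (\<Sum>i<n. if i = x - a \<and> a \<le> x then c else 0)"
    unfolding lookup_sum by (rule sum.cong) (auto simp: lookup_single when_def)
  also have "\<dots> = (if a \<le> x \<and> x < a + n then c else 0)"
    by (cases "a \<le> x") auto
  finally show ?thesis .
qed

lemma mirror_double:
  assumes "i < 2 * n"
  shows "mirror (2 * n) i = (if i < n then n + mirror n i else mirror n (i - n))"
  using assms by (auto simp: mirror_def)

text \<open>
  Two blocks of \<open>2 * n\<close> vertices, each with a first and a second half. In each block there is an edge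
  from each vertex of the first half to its mirror image in the second half, carrying the
  amounts \<open>a\<^sub>i\<close> and \<open>b\<^sub>i\<close>, and the permutation \<open>v\<close> matches the first block with the reversed
  second block. A vertex of the first block emits \<open>s\<close> or \<open>t\<close> units, according to its half; in the
  second block, the demands are \<open>t\<close> and \<open>s\<close>. So the flow on the matching edges is determined by \<open>a\<close>
  on the one hand and by \<open>b\<close> on the other hand.
\<close>

lemma four_block_flows:
  fixes v :: "nat \<Rightarrow> nat" and n s t :: nat
  assumes v: "v permutes {..<2 * n}"
  shows "ct (fps_const (cmon 0 n (- int s) * (cmon n n (- int t) * (cmon (2 * n) n (int t) * cmon (3 * n) n (int s)))) *
      (\<Prod>i<2 * n. geo (var i * ivar (2 * n + mirror (2 * n) (v i)))) *
      (\<Prod>i<n. geo (var i * ivar (n + mirror n i))) *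
      (\<Prod>i<n. geo (var (2 * n + i) * ivar (3 * n + mirror n i)))) =
    (\<Sum>(a, b) | (a, b) \<in> ({..<n} \<rightarrow>\<^sub>E {..<Suc s}) \<times> ({..<n} \<rightarrow>\<^sub>E {..<Suc s}) \<and>
       (\<forall>i<2 * n. fold_map n s t b (v i) = fold_map n s t a i).
      fps_X ^ (n * (s + t) + (\<Sum>i<n. a i) + (\<Sum>i<n. b i)))"
    (is "?L = ?R")
proof (rule fps_ext)
  fix d
  define I where "I = {0 :: nat} \<times> {..<2 * n} \<union> {1, 2 :: nat} \<times> {..<n}"
  define u where "u = (\<lambda>(c :: nat, i). if c = 2 then 2 * n + i else i)"
  define r where "r = (\<lambda>(c :: nat, i). if c = 0 then 2 * n + mirror (2 * n) (v i) else if c = 1 then n + mirror n i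
     else 3 * n + mirror n i)"
  define \<gamma>0 :: weight where "\<gamma>0 = (\<Sum>i<n. single (0 + i) (- int s)) + ((\<Sum>i<n. single (n + i) (- int t)) +
     ((\<Sum>i<n. single (2 * n + i) (int t)) + (\<Sum>i<n. single (3 * n + i) (int s))))"
  let ?h = "fold_map n s t"
  have vl: "v i < 2 * n \<longleftrightarrow> i < 2 * n" for i using permutes_in_image[OF v, of i] by simp
  have vinj: "v i = v j \<longleftrightarrow> i = j" for i j using permutes_inj[OF v] by (auto dest: injD)
  have ml: "mirror n j < n" if "j < n" for j using that by simp
  have m2l: "mirror (2 * n) j < 2 * n" if "j < 2 * n" for j using that by simp
  have finI: "finite I" by (simp add: I_def)
  have disj: "{0 :: nat} \<times> {..<2 * n} \<inter> {1, 2 :: nat} \<times> {..<n} = {}" by auto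
  have sumI: "(\<Sum>z\<in>I. g z) = (\<Sum>i<2 * n. g (0, i)) + (\<Sum>i<n. g (1, i)) + (\<Sum>i<n. g (2, i))"
    for g :: "nat \<times> nat \<Rightarrow> nat"
  proof -
    have "(\<Sum>z\<in>I. g z) = (\<Sum>c\<in>{0}. \<Sum>i<2 * n. g (c, i)) + (\<Sum>c\<in>{1, 2}. \<Sum>i<n. g (c, i))"
    proof -
      have "(\<Sum>z\<in>I. g z) = sum g ({0} \<times> {..<2 * n}) + sum g ({1, 2} \<times> {..<n})"
        unfolding I_def by (rule sum.union_disjoint) (use disj in simp_all)
      then show ?thesis by (simp only: sum.cartesian_product case_prod_unfold prod.collapse)
    qed
    then show ?thesis by (simp add: add.assoc)
  qed
  have prodI: "(\<Prod>z\<in>I. g z) = (\<Prod>i<2 * n. g (0, i)) * (\<Prod>i<n. g (1, i)) * (\<Prod>i<n. g (2, i))"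
    for g :: "nat \<times> nat \<Rightarrow> laurent fps"
  proof -
    have "(\<Prod>z\<in>I. g z) = (\<Prod>c\<in>{0}. \<Prod>i<2 * n. g (c, i)) * (\<Prod>c\<in>{1, 2}. \<Prod>i<n. g (c, i))"
    proof -
      have "(\<Prod>z\<in>I. g z) = prod g ({0} \<times> {..<2 * n}) * prod g ({1, 2} \<times> {..<n})"
        unfolding I_def by (rule prod.union_disjoint) (use disj in simp_all)
      then show ?thesis by (simp only: prod.cartesian_product case_prod_unfold prod.collapse)
    qed
    then show ?thesis by (simp add: mult.assoc)
  qed
  have "?L = ct (fps_const (xmon \<gamma>0) * (\<Prod>z\<in>I. geo (var (u z) * ivar (r z))))"
    unfolding prodI by (simp add: u_def r_def mon_eq_xmon \<gamma>0_def xmon_add mult.assoc)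
  then have "?L $ d = int (card {f \<in> flows I d. \<forall>x. lookup \<gamma>0 x + outflow I u f x = outflow I r f x})"
    by (simp only: ct_prod_geo[OF finI])
  also have "{f \<in> flows I d. \<forall>x. lookup \<gamma>0 x + outflow I u f x = outflow I r f x} =
    {f \<in> flows I d. (\<forall>j<n. f (0, j) + f (1, j) = s \<and> f (0, n + mirror n j) = t + f (1, j)) \<and>
       (\<forall>i<2 * n. if v i < n then f (0, i) + f (2, v i) = s else f (0, i) = t + f (2, mirror n (v i - n)))}"
  proof (intro Collect_cong conj_cong refl)
    fix f
    have g0: "lookup \<gamma>0 x = (if x < n then - int s else 0) + ((if n \<le> x \<and> x < n + n then - int t else 0) +
       ((if 2 * n \<le> x \<and> x < 2 * n + n then int t else 0) + (if 3 * n \<le> x \<and> x < 3 * n + n then int s else 0)))" for x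
      unfolding \<gamma>0_def lookup_add lookup_interval_mon by simp
    have g1: "lookup \<gamma>0 j = - int s" if "j < n" for j using that by (simp add: g0)
    have g2: "lookup \<gamma>0 (n + j) = - int t" if "j < n" for j using that by (simp add: g0)
    have g3: "lookup \<gamma>0 (2 * n + j) = int t" if "j < n" for j using that by (simp add: g0)
    have g4: "lookup \<gamma>0 (3 * n + j) = int s" if "j < n" for j using that by (simp add: g0)
    have g5: "lookup \<gamma>0 x = 0" if "4 * n \<le> x" for x using that by (simp add: g0)
    have memI: "z \<in> I \<longleftrightarrow> (\<exists>i<2 * n. z = (0, i)) \<or> (\<exists>i<n. z = (1, i)) \<or> (\<exists>i<n. z = (2, i))" for z
      by (cases z) (auto simp: I_def)
    have u0: "u (0, i) = i" "u (1, i) = i" "u (2, i) = 2 * n + i" for i by (simp_all add: u_def)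
    have r0: "r (0, i) = 2 * n + mirror (2 * n) (v i)" "r (1, i) = n + mirror n i" "r (2, i) = 3 * n + mirror n i" for i
      by (simp_all add: r_def)
    have r0_lt: "2 * n \<le> r (0, i) \<and> r (0, i) < 4 * n" if "i < 2 * n" for i
      using m2l[of "v i"] vl[of i] that by (simp add: r0)
    have set: "{z. z \<in> I \<and> w z = x} = {z. (\<exists>i<2 * n. z = (0, i) \<and> w (0, i) = x) \<or> (\<exists>i<n. z = (1, i) \<and> w (1, i) = x) \<or>
        (\<exists>i<n. z = (2, i) \<and> w (2, i) = x)}" for w :: "nat \<times> nat \<Rightarrow> nat" and x
      unfolding memI by blast
    have u1: "{z. z \<in> I \<and> u z = j} = {(0, j), (1, j)}" and r1: "{z. z \<in> I \<and> r z = j} = {}" if "j < n" for j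
    proof -
      show "{z. z \<in> I \<and> u z = j} = {(0, j), (1, j)}"
        using that unfolding set u0 by auto
      have "r (0, i) \<noteq> j" if "i < 2 * n" for i using r0_lt[OF that] \<open>j < n\<close> by linarith
      moreover have "r (1, i) \<noteq> j" "r (2, i) \<noteq> j" for i using that unfolding r0 by linarith+
      ultimately show "{z. z \<in> I \<and> r z = j} = {}" unfolding set by blast
    qed
    have u2: "{z. z \<in> I \<and> u z = n + mirror n j} = {(0, n + mirror n j)}" and
      r2: "{z. z \<in> I \<and> r z = n + mirror n j} = {(1, j)}" if "j < n" for j
    proof -
      note m = ml[OF that]
      have "u (1, i) \<noteq> n + mirror n j" if "i < n" for i using that unfolding u0 by linarith
      moreover have "u (2, i) \<noteq> n + mirror n j" for i using m unfolding u0 by linarith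
      moreover have "n + mirror n j < 2 * n" using m by linarith
      ultimately show "{z. z \<in> I \<and> u z = n + mirror n j} = {(0, n + mirror n j)}"
        unfolding set u0(1) by blast
      have "r (0, i) \<noteq> n + mirror n j" if "i < 2 * n" for i using r0_lt[OF that] m by linarith
      moreover have "r (2, i) \<noteq> n + mirror n j" for i using m unfolding r0 by linarith
      moreover have "r (1, i) = n + mirror n j \<longleftrightarrow> i = j" for i unfolding r0 by simp
      ultimately show "{z. z \<in> I \<and> r z = n + mirror n j} = {(1, j)}"
        unfolding set using that by blast
    qed
    have u3: "{z. z \<in> I \<and> u z = r (0, i)} = {}" and r3: "{z. z \<in> I \<and> r z = r (0, i)} = {(0, i), (2, v i)}"
      and x3: "r (0, i) = 3 * n + mirror n (v i)" if i: "i < 2 * n" "v i < n" for i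
    proof -
      show x: "r (0, i) = 3 * n + mirror n (v i)"
        using i vl[of i] by (simp add: r0 mirror_double)
      have "u (0, j) \<noteq> r (0, i)" if "j < 2 * n" for j using r0_lt[OF i(1)] that unfolding u0 by linarith
      moreover have "u (1, j) \<noteq> r (0, i)" if "j < n" for j using r0_lt[OF i(1)] that unfolding u0 by linarith
      moreover have "u (2, j) \<noteq> r (0, i)" if "j < n" for j using that unfolding x u0 by linarith
      ultimately show "{z. z \<in> I \<and> u z = r (0, i)} = {}" unfolding set by blast
      have "r (0, j) = r (0, i) \<longleftrightarrow> j = i" for j unfolding r0 by (simp add: vinj)
      moreover have "r (1, j) \<noteq> r (0, i)" if "j < n" for j using ml[OF that] r0_lt[OF i(1)] unfolding r0(2) by linarith
      moreover have "r (2, j) = r (0, i) \<longleftrightarrow> j = v i" for j unfolding x r0(3) by simp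
      ultimately show "{z. z \<in> I \<and> r z = r (0, i)} = {(0, i), (2, v i)}" unfolding set using i by blast
    qed
    have u4: "{z. z \<in> I \<and> u z = r (0, i)} = {(2, mirror n (v i - n))}" and r4: "{z. z \<in> I \<and> r z = r (0, i)} = {(0, i)}"
      and x4: "r (0, i) = 2 * n + mirror n (v i - n)" and l4: "mirror n (v i - n) < n" if i: "i < 2 * n" "\<not> v i < n" for i
    proof -
      show x: "r (0, i) = 2 * n + mirror n (v i - n)"
        using i vl[of i] by (simp add: r0 mirror_double)
      have "v i - n < n" using i vl[of i] by linarith
      then show m: "mirror n (v i - n) < n" by (rule ml)
      have "u (0, j) \<noteq> r (0, i)" if "j < 2 * n" for j using r0_lt[OF i(1)] that unfolding u0 by linarith
      moreover have "u (1, j) \<noteq> r (0, i)" if "j < n" for j using r0_lt[OF i(1)] that unfolding u0 by linarith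
      moreover have "u (2, j) = r (0, i) \<longleftrightarrow> j = mirror n (v i - n)" for j unfolding x u0 by simp
      ultimately show "{z. z \<in> I \<and> u z = r (0, i)} = {(2, mirror n (v i - n))}" unfolding set using m by blast
      have "r (0, j) = r (0, i) \<longleftrightarrow> j = i" for j unfolding r0 by (simp add: vinj)
      moreover have "r (1, j) \<noteq> r (0, i)" if "j < n" for j using ml[OF that] r0_lt[OF i(1)] unfolding r0(2) by linarith
      moreover have "r (2, j) \<noteq> r (0, i)" for j using m unfolding x r0(3) by linarith
      ultimately show "{z. z \<in> I \<and> r z = r (0, i)} = {(0, i)}" unfolding set using i by blast
    qed
    have u5: "{z. z \<in> I \<and> u z = x} = {}" and r5: "{z. z \<in> I \<and> r z = x} = {}" if "4 * n \<le> x" for x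
    proof -
      have "u (0, i) \<noteq> x" "r (0, i) \<noteq> x" if "i < 2 * n" for i
        using r0_lt[OF that] that \<open>4 * n \<le> x\<close> unfolding u0 by linarith+
      moreover have "u (1, i) \<noteq> x" "u (2, i) \<noteq> x" "r (1, i) \<noteq> x" "r (2, i) \<noteq> x" if "i < n" for i
        using ml[OF that] that \<open>4 * n \<le> x\<close> unfolding u0 r0 by linarith+
      ultimately show "{z. z \<in> I \<and> u z = x} = {}" "{z. z \<in> I \<and> r z = x} = {}" unfolding set by blast+
    qed
    show "(\<forall>x. lookup \<gamma>0 x + outflow I u f x = outflow I r f x) \<longleftrightarrow>
      (\<forall>j<n. f (0, j) + f (1, j) = s \<and> f (0, n + mirror n j) = t + f (1, j)) \<and>
       (\<forall>i<2 * n. if v i < n then f (0, i) + f (2, v i) = s else f (0, i) = t + f (2, mirror n (v i - n)))" (is "?A \<longleftrightarrow> ?B \<and> ?C")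
    proof
      assume A: ?A
      show "?B \<and> ?C"
      proof (intro conjI allI impI)
        fix j assume j: "j < n"
        have "int (f (0, j)) + int (f (1, j)) = int s"
          using A[rule_format, of j] j by (simp add: outflow_def u1 r1 g1)
        then show "f (0, j) + f (1, j) = s" by linarith
        have "- int t + int (f (0, n + mirror n j)) = int (f (1, j))"
          using A[rule_format, of "n + mirror n j"] unfolding outflow_def u2[OF j] r2[OF j] g2[OF ml[OF j]] by simp
        then show "f (0, n + mirror n j) = t + f (1, j)" by linarith
      next
        fix i assume i: "i < 2 * n"
        show "if v i < n then f (0, i) + f (2, v i) = s else f (0, i) = t + f (2, mirror n (v i - n))"
        proof (cases "v i < n")
          case True
          have "lookup \<gamma>0 (r (0, i)) = int s" unfolding x3[OF i True] by (rule g4[OF ml[OF True]])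
          then have "int s = int (f (0, i)) + int (f (2, v i))"
            using A[rule_format, of "r (0, i)"] unfolding outflow_def u3[OF i True] r3[OF i True] by simp
          then show ?thesis using True by simp
        next
          case False
          have "lookup \<gamma>0 (r (0, i)) = int t" unfolding x4[OF i False] by (rule g3[OF l4[OF i False]])
          then have "int t + int (f (2, mirror n (v i - n))) = int (f (0, i))"
            using A[rule_format, of "r (0, i)"] unfolding outflow_def u4[OF i False] r4[OF i False] by simp
          then show ?thesis using False by simp
        qed
      qed
    next
      assume BC: "?B \<and> ?C"
      then have B: ?B and C: ?C by blast+
      show ?A
      proof
        fix x
        consider "x < n" | j where "j < n" "x = n + mirror n j" | i where "i < 2 * n" "x = r (0, i)" | "4 * n \<le> x"
        proof -
          consider "x < n" | "n \<le> x" "x < 2 * n" | "2 * n \<le> x" "x < 4 * n" | "4 * n \<le> x" by linarith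
          then show thesis
          proof cases
            case 2
            have "x - n < n" using 2 by linarith
            then have "mirror n (x - n) < n" by (rule ml)
            then show thesis using that(2)[of "mirror n (x - n)"] 2 by simp
          next
            case 3
            obtain i where i: "v i = mirror (2 * n) (x - 2 * n)" using permutes_surj[OF v] by (metis surjD)
            have "x - 2 * n < 2 * n" using 3 by linarith
            then have "v i < 2 * n" unfolding i by (rule m2l)
            then have "i < 2 * n" using vl by blast
            then show thesis using that(3)[of i] 3 i by (simp add: r0)
          qed (use that in blast)+
        qed
        then show "lookup \<gamma>0 x + outflow I u f x = outflow I r f x"
        proof cases
          case 1
          then have "f (0, x) + f (1, x) = s" using B by blast
          then show ?thesis using 1 by (simp add: outflow_def u1 r1 g1 flip: of_nat_add)
        next
          case 2
          then have "f (0, n + mirror n j) = t + f (1, j)" using B by blast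
          then show ?thesis using 2 unfolding outflow_def 2(2) u2[OF 2(1)] r2[OF 2(1)] g2[OF ml[OF 2(1)]] by simp
        next
          case 3
          show ?thesis
          proof (cases "v i < n")
            case True
            have "lookup \<gamma>0 (r (0, i)) = int s" unfolding x3[OF 3(1) True] by (rule g4[OF ml[OF True]])
            moreover have "f (0, i) + f (2, v i) = s" using C 3(1) True by metis
            ultimately show ?thesis unfolding outflow_def 3(2) u3[OF 3(1) True] r3[OF 3(1) True] by simp
          next
            case False
            have "lookup \<gamma>0 (r (0, i)) = int t" unfolding x4[OF 3(1) False] by (rule g3[OF l4[OF 3(1) False]])
            moreover have "f (0, i) = t + f (2, mirror n (v i - n))" using C 3(1) False by metis
            ultimately show ?thesis unfolding outflow_def 3(2) u4[OF 3(1) False] r4[OF 3(1) False] by simp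
          qed
        next
          case 4
          then show ?thesis by (simp add: outflow_def u5 r5 g5)
        qed
      qed
    qed
  qed
  also have "card \<dots> = card {(a, b). (a, b) \<in> ({..<n} \<rightarrow>\<^sub>E {..<Suc s}) \<times> ({..<n} \<rightarrow>\<^sub>E {..<Suc s}) \<and>
       (\<forall>i<2 * n. ?h b (v i) = ?h a i) \<and> n * (s + t) + (\<Sum>i<n. a i) + (\<Sum>i<n. b i) = d}"
  proof -
    define to where "to = (\<lambda>f :: nat \<times> nat \<Rightarrow> nat. (\<lambda>i\<in>{..<n}. f (1, i), \<lambda>i\<in>{..<n}. f (2, i)))"
    define fr where "fr = (\<lambda>(a, b). \<lambda>z\<in>I. if fst z = 0 then ?h a (snd z) else if fst z = 1 then a (snd z) else b (snd z))"
    define F where "F = {f \<in> flows I d. (\<forall>j<n. f (0, j) + f (1, j) = s \<and> f (0, n + mirror n j) = t + f (1, j)) \<and>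
       (\<forall>i<2 * n. if v i < n then f (0, i) + f (2, v i) = s else f (0, i) = t + f (2, mirror n (v i - n)))}"
    define E where "E = {(a, b). (a, b) \<in> ({..<n} \<rightarrow>\<^sub>E {..<Suc s}) \<times> ({..<n} \<rightarrow>\<^sub>E {..<Suc s}) \<and>
       (\<forall>i<2 * n. ?h b (v i) = ?h a i) \<and> n * (s + t) + (\<Sum>i<n. a i) + (\<Sum>i<n. b i) = d}"
    have F_D: "f \<in> I \<rightarrow>\<^sub>E UNIV" "sum f I = d" "\<And>j. j < n \<Longrightarrow> f (0, j) + f (1, j) = s"
      "\<And>j. j < n \<Longrightarrow> f (0, n + mirror n j) = t + f (1, j)"
      "\<And>i. i < 2 * n \<Longrightarrow> v i < n \<Longrightarrow> f (0, i) + f (2, v i) = s"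
      "\<And>i. i < 2 * n \<Longrightarrow> \<not> v i < n \<Longrightarrow> f (0, i) = t + f (2, mirror n (v i - n))" if "f \<in> F" for f
      using that unfolding F_def flows_def by auto
    have E_D: "a \<in> {..<n} \<rightarrow>\<^sub>E {..<Suc s}" "b \<in> {..<n} \<rightarrow>\<^sub>E {..<Suc s}" "\<And>i. i < 2 * n \<Longrightarrow> ?h b (v i) = ?h a i"
      "n * (s + t) + (\<Sum>i<n. a i) + (\<Sum>i<n. b i) = d" if "(a, b) \<in> E" for a b
      using that unfolding E_def by auto
    have h_eq: "?h a i = f (0, i)" if f: "f \<in> F" and a: "\<And>j. j < n \<Longrightarrow> a j = f (1, j)" and i: "i < 2 * n" for f a i
    proof (cases "i < n")
      case True
      then show ?thesis using F_D(3)[OF f True] a[OF True] by (simp add: fold_map_def)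
    next
      case False
      define j where "j = mirror n (i - n)"
      have "i - n < n" using i False by linarith
      then have j: "j < n" unfolding j_def by (rule ml)
      have "n + mirror n j = i" using False by (simp add: j_def)
      then show ?thesis using F_D(4)[OF f j] a[OF j] False by (simp add: fold_map_def j_def)
    qed
    have 1: "\<forall>f\<in>F. fr (to f) = f"
    proof
      fix f assume f: "f \<in> F"
      show "fr (to f) = f"
      proof (rule ext, goal_cases)
        case (1 z)
        show ?case
        proof (cases "z \<in> I")
          case True
          then consider i where "z = (0, i)" "i < 2 * n" | i where "z = (1, i)" "i < n" | i where "z = (2, i)" "i < n"
            by (auto simp: I_def)
          then show ?thesis
          proof cases
            case 1
            then have "fr (to f) z = ?h (\<lambda>i\<in>{..<n}. f (1, i)) i" by (simp add: fr_def to_def I_def)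
            also have "\<dots> = f (0, i)" by (rule h_eq[OF f]) (use 1 in simp_all)
            finally show ?thesis using 1 by simp
          qed (simp_all add: fr_def to_def I_def)
        next
          case False
          have "fr (to f) z = undefined"
            unfolding fr_def case_prod_unfold by (rule extensional_arb[OF restrict_extensional False])
          also have "\<dots> = f z" by (rule PiE_arb[OF F_D(1)[OF f] False, symmetric])
          finally show ?thesis .
        qed
      qed
    qed
    have 2: "\<forall>e\<in>E. to (fr e) = e"
    proof
      fix e assume "e \<in> E"
      then obtain a b where e: "e = (a, b)" and ab: "a \<in> {..<n} \<rightarrow>\<^sub>E {..<Suc s}" "b \<in> {..<n} \<rightarrow>\<^sub>E {..<Suc s}"
        using E_D(1,2) by (metis surj_pair)
      have "(\<lambda>i\<in>{..<n}. fr e (1, i)) = restrict a {..<n}" "(\<lambda>i\<in>{..<n}. fr e (2, i)) = restrict b {..<n}"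
        by (rule restrict_ext, simp add: fr_def e I_def)+
      then show "to (fr e) = e"
        using ab by (simp add: to_def e PiE_def extensional_restrict)
    qed
    have 3: "to ` F \<subseteq> E"
    proof
      fix e assume "e \<in> to ` F"
      then obtain f where f: "f \<in> F" and e: "e = to f" by blast
      define a b where "a = (\<lambda>i\<in>{..<n}. f (1, i))" and "b = (\<lambda>i\<in>{..<n}. f (2, i))"
      have aj: "a j = f (1, j)" and bj: "b j = f (2, j)" if "j < n" for j using that by (simp_all add: a_def b_def)
      have "a j < Suc s" if "j < n" for j using F_D(3)[OF f that] aj[OF that] by linarith
      moreover have "b j < Suc s" if j: "j < n" for j
      proof -
        obtain i where i: "v i = j" using permutes_surj[OF v] by (metis surjD)
        have "v i < 2 * n" using i j by linarith
        then have "i < 2 * n" using vl by blast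
        then show ?thesis using F_D(5)[OF f, of i] bj[OF j] i j by simp
      qed
      ultimately have ab: "a \<in> {..<n} \<rightarrow>\<^sub>E {..<Suc s}" "b \<in> {..<n} \<rightarrow>\<^sub>E {..<Suc s}"
        by (simp_all add: a_def b_def)
      have "?h b (v i) = ?h a i" if i: "i < 2 * n" for i
      proof -
        have "?h a i = f (0, i)" using f aj i by (rule h_eq)
        moreover have "?h b (v i) = f (0, i)"
        proof (cases "v i < n")
          case True
          then show ?thesis using F_D(5)[OF f i True] bj[OF True] by (simp add: fold_map_def)
        next
          case False
          have "v i - n < n" using vl[of i] i False by linarith
          then have "mirror n (v i - n) < n" by (rule ml)
          then show ?thesis using F_D(6)[OF f i False] bj False by (simp add: fold_map_def)
        qed
        ultimately show ?thesis by simp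
      qed
      moreover have "n * (s + t) + (\<Sum>i<n. a i) + (\<Sum>i<n. b i) = d"
      proof -
        have "(\<Sum>i<2 * n. f (0, i)) = (\<Sum>i<n. f (0, i)) + (\<Sum>i<n. f (0, n + i))"
          unfolding mult_2 by (rule sum_lessThan_add)
        also have "(\<Sum>i<n. f (0, n + i)) = (\<Sum>i<n. f (0, n + mirror n i))"
          using sum_mirror[of "\<lambda>i. f (0, n + i)" n] by simp
        also have "(\<Sum>i<n. f (0, i)) + \<dots> = (\<Sum>i<n. s + t)"
          unfolding sum.distrib[symmetric]
        proof (rule sum.cong[OF refl])
          fix i assume "i \<in> {..<n}"
          then have i: "i < n" by simp
          show "f (0, i) + f (0, n + mirror n i) = s + t"
            using F_D(3)[OF f i] F_D(4)[OF f i] by linarith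
        qed
        finally have "(\<Sum>i<2 * n. f (0, i)) = n * (s + t)" by simp
        moreover have "(\<Sum>i<n. f (1, i)) = (\<Sum>i<n. a i)" "(\<Sum>i<n. f (2, i)) = (\<Sum>i<n. b i)"
          by (rule sum.cong[OF refl], simp only: aj bj lessThan_iff)+
        ultimately show ?thesis using F_D(2)[OF f] unfolding sumI by simp
      qed
      ultimately show "e \<in> E" using ab unfolding E_def e to_def a_def[symmetric] b_def[symmetric] by simp
    qed
    have 4: "fr ` E \<subseteq> F"
    proof
      fix f assume "f \<in> fr ` E"
      then obtain a b where e: "(a, b) \<in> E" and f: "f = fr (a, b)" by auto
      note E = E_D[OF e]
      have aj: "a j \<le> s" and bj: "b j \<le> s" if "j < n" for j
        using E(1,2) that by (auto simp: PiE_def Pi_def less_Suc_eq_le)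
      have f0: "f (0, i) = ?h a i" if "i < 2 * n" for i using that by (simp add: f fr_def I_def)
      have f1: "f (1, j) = a j" and f2: "f (2, j) = b j" if "j < n" for j using that by (simp_all add: f fr_def I_def)
      have B1: "f (0, j) + f (1, j) = s" if j: "j < n" for j
        using f0[of j] f1[OF j] aj[OF j] j by (simp add: fold_map_def)
      have B2: "f (0, n + mirror n j) = t + f (1, j)" if j: "j < n" for j
        using f0[of "n + mirror n j"] f1[OF j] ml[OF j] by (simp add: fold_map_def)
      have C1: "f (0, i) + f (2, v i) = s" if i: "i < 2 * n" "v i < n" for i
        using E(3)[OF i(1)] f0[OF i(1)] f2[OF i(2)] bj[OF i(2)] i(2) by (simp add: fold_map_def)
      have C2: "f (0, i) = t + f (2, mirror n (v i - n))" if i: "i < 2 * n" "\<not> v i < n" for i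
      proof -
        have "v i - n < n" using vl[of i] i by linarith
        then have "mirror n (v i - n) < n" by (rule ml)
        then show ?thesis using E(3)[OF i(1)] f0[OF i(1)] f2 i(2) by (simp add: fold_map_def)
      qed
      have "(\<Sum>i<2 * n. f (0, i)) = (\<Sum>i<n. f (0, i)) + (\<Sum>i<n. f (0, n + i))"
        unfolding mult_2 by (rule sum_lessThan_add)
      also have "(\<Sum>i<n. f (0, n + i)) = (\<Sum>i<n. f (0, n + mirror n i))"
        using sum_mirror[of "\<lambda>i. f (0, n + i)" n] by simp
      also have "(\<Sum>i<n. f (0, i)) + \<dots> = (\<Sum>i<n. s + t)"
        unfolding sum.distrib[symmetric]
      proof (rule sum.cong[OF refl])
        fix i assume "i \<in> {..<n}"
        then have i: "i < n" by simp
        show "f (0, i) + f (0, n + mirror n i) = s + t"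
          using B1[OF i] B2[OF i] by linarith
      qed
      finally have "(\<Sum>i<2 * n. f (0, i)) = n * (s + t)" by simp
      moreover have "(\<Sum>i<n. f (1, i)) = (\<Sum>i<n. a i)" "(\<Sum>i<n. f (2, i)) = (\<Sum>i<n. b i)"
        by (rule sum.cong[OF refl], simp only: f1 f2 lessThan_iff)+
      ultimately have "sum f I = d" using E(4) unfolding sumI by simp
      moreover have "f \<in> extensional I" unfolding f fr_def case_prod_conv by (rule restrict_extensional)
      ultimately show "f \<in> F"
        unfolding F_def flows_def PiE_def using B1 B2 C1 C2 by auto
    qed
    have "card F = card E"
      using bij_betw_byWitness[OF 1 2 3 4] by (rule bij_betw_same_card)
    then show ?thesis unfolding F_def E_def .
  qed
  also have "int \<dots> = ?R $ d"
  proof -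
    define E where "E = {(a, b). (a, b) \<in> ({..<n} \<rightarrow>\<^sub>E {..<Suc s}) \<times> ({..<n} \<rightarrow>\<^sub>E {..<Suc s}) \<and>
       (\<forall>i<2 * n. ?h b (v i) = ?h a i)}"
    have "finite (({..<n} \<rightarrow>\<^sub>E {..<Suc s}) \<times> ({..<n} \<rightarrow>\<^sub>E {..<Suc s}))"
      by (intro finite_cartesian_product finite_PiE) auto
    then have fin: "finite E" by (rule rev_finite_subset) (auto simp: E_def)
    have "?R $ d = (\<Sum>e\<in>E. if n * (s + t) + (\<Sum>i<n. fst e i) + (\<Sum>i<n. snd e i) = d then 1 else 0)"
      unfolding fps_sum_nth E_def[symmetric] by (rule sum.cong) (auto simp: fps_X_power_iff)
    also have "\<dots> = int (card {e\<in>E. n * (s + t) + (\<Sum>i<n. fst e i) + (\<Sum>i<n. snd e i) = d})"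
      using fin by (simp flip: sum.inter_filter)
    also have "{e\<in>E. n * (s + t) + (\<Sum>i<n. fst e i) + (\<Sum>i<n. snd e i) = d} =
      {(a, b). (a, b) \<in> ({..<n} \<rightarrow>\<^sub>E {..<Suc s}) \<times> ({..<n} \<rightarrow>\<^sub>E {..<Suc s}) \<and>
       (\<forall>i<2 * n. ?h b (v i) = ?h a i) \<and> n * (s + t) + (\<Sum>i<n. a i) + (\<Sum>i<n. b i) = d}"
      by (auto simp: E_def)
    finally show ?thesis by simp
  qed
  finally show "?L $ d = ?R $ d" .
qed

lemma sum_permutations_filter:
  "(\<Sum>p | p permutes {..<n :: nat} \<and> P p. f p) = (\<Sum>p | p permutes {..<n}. if P p then f p else 0)"
  using sum.inter_filter[OF finite_permutations[OF finite_lessThan], where g = f and P = P] by simp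

text \<open>
  If \<open>a\<close> has distinct entries, this is \<open>0\<close> or the sign of the permutation that carries \<open>a\<close> to \<open>b\<close>;
  otherwise it vanishes.
\<close>

definition signed_matches :: "nat \<Rightarrow> (nat \<Rightarrow> nat) \<Rightarrow> (nat \<Rightarrow> nat) \<Rightarrow> int" where
  "signed_matches n a b = (\<Sum>p | p permutes {..<n} \<and> (\<forall>i<n. b (p i) = a i). sign p)"

text \<open>
  The values of \<open>fold_map\<close> are at most \<open>s\<close> on the first half and at least \<open>t\<close> on the second half. So \<open>v\<close> preserves
  the halves, and each half contributes a signed sum over the permutations that carry \<open>a\<close> to \<open>b\<close>.
\<close>

lemma signed_matches_fold:
  assumes a: "a \<in> {..<n} \<rightarrow>\<^sub>E {..<Suc s}" and b: "b \<in> {..<n} \<rightarrow>\<^sub>E {..<Suc s}" and st: "s < t"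
  shows "(\<Sum>v | v permutes {..<2 * n} \<and> (\<forall>i<2 * n. fold_map n s t b (v i) = fold_map n s t a i). sign v) =
    (signed_matches n a b)\<^sup>2"
proof -
  let ?h = "fold_map n s t"
  have al: "a i \<le> s" and bl: "b i \<le> s" if "i < n" for i
    using a b that by (auto simp: PiE_def Pi_def less_Suc_eq_le)
  have ml: "mirror n j < n" if "j < n" for j using that by simp
  define T where "T v = (if \<forall>i<2 * n. ?h b (v i) = ?h a i then sign v else 0)" for v :: "nat \<Rightarrow> nat"
  have "(\<Sum>v | v permutes {..<2 * n} \<and> (\<forall>i<2 * n. ?h b (v i) = ?h a i). sign v) =
      (\<Sum>v | v permutes {..<n + n}. T v)"
    unfolding T_def sum_permutations_filter mult_2 ..
  also have "\<dots> = (\<Sum>p | p permutes {..<n}. \<Sum>r | r permutes {..<n}. T (p \<circ> shift_perm n r))"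
  proof (rule sum_stabilizing)
    fix v assume v: "v permutes {..<n + n}" "v ` {..<n} \<noteq> {..<n}"
    have "\<not> (\<forall>i<2 * n. ?h b (v i) = ?h a i)"
    proof
      assume h: "\<forall>i<2 * n. ?h b (v i) = ?h a i"
      have "v i < n" if "i < n" for i
      proof (rule ccontr)
        assume "\<not> v i < n"
        then have "s < ?h b (v i)" using st by (simp add: fold_map_def)
        moreover have "?h a i \<le> s" using that by (simp add: fold_map_def)
        moreover have "?h b (v i) = ?h a i" using h that by simp
        ultimately show False by linarith
      qed
      then have "v ` {..<n} \<subseteq> {..<n}" by auto
      then have "v ` {..<n} = {..<n}"
        using card_image[OF inj_on_subset[OF permutes_inj[OF v(1)] subset_UNIV], of "{..<n}"]
        by (intro card_subset_eq) auto
      with v(2) show False ..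
    qed
    then show "T v = 0" unfolding T_def by (rule if_not_P)
  qed
  also have "\<dots> = (\<Sum>p | p permutes {..<n}. \<Sum>r | r permutes {..<n}.
     (if \<forall>i<n. b (p i) = a i then sign p else 0) * (if \<forall>i<n. b (r i) = a i then sign r else 0))"
  proof (rule sum.cong[OF refl])
    fix p assume "p \<in> {p. p permutes {..<n}}"
    then have p: "p permutes {..<n}" by simp
    have pl: "p i < n" if "i < n" for i using permutes_in_image[OF p, of i] that by simp
    have pa: "p (n + i) = n + i" for i using permutes_not_in[OF p, of "n + i"] by simp
    have "T (p \<circ> shift_perm n (mirror n \<circ> r \<circ> mirror n)) =
       (if \<forall>i<n. b (p i) = a i then sign p else 0) * (if \<forall>i<n. b (r i) = a i then sign r else 0)"
      if r: "r permutes {..<n}" for r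
    proof -
      let ?r = "mirror n \<circ> r \<circ> mirror n"
      let ?v = "p \<circ> shift_perm n ?r"
      have r': "?r permutes {..<n}" by (intro permutes_compose mirror_permutes r)
      have rl: "r i < n" if "i < n" for i using permutes_in_image[OF r, of i] that by simp
      have sgn: "sign ?v = sign p * sign r"
        using sign_block_permutation[OF p r'] sign_conj[of "{..<n}" r "mirror n"] r by simp
      have lo: "?h b (?v i) = ?h a i \<longleftrightarrow> b (p i) = a i" if "i < n" for i
        using that pl[OF that] al[OF that] bl[OF pl[OF that]] by (auto simp: fold_map_def shift_perm_def)
      have up: "?h b (?v (n + i)) = ?h a (n + i) \<longleftrightarrow> b (r (mirror n i)) = a (mirror n i)" for i
        by (simp add: shift_perm_def pa fold_map_def)
      have "(\<forall>i<2 * n. ?h b (?v i) = ?h a i) \<longleftrightarrow> (\<forall>i<n. b (p i) = a i) \<and> (\<forall>i<n. b (r i) = a i)"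
      proof
        assume h: "\<forall>i<2 * n. ?h b (?v i) = ?h a i"
        have "b (p i) = a i" if "i < n" for i using h lo[OF that] that by simp
        moreover have "b (r i) = a i" if "i < n" for i
        proof -
          have "n + mirror n i < 2 * n" using ml[OF that] by linarith
          then have "?h b (?v (n + mirror n i)) = ?h a (n + mirror n i)" using h by blast
          then show ?thesis unfolding up by simp
        qed
        ultimately show "(\<forall>i<n. b (p i) = a i) \<and> (\<forall>i<n. b (r i) = a i)" by blast
      next
        assume h: "(\<forall>i<n. b (p i) = a i) \<and> (\<forall>i<n. b (r i) = a i)"
        show "\<forall>i<2 * n. ?h b (?v i) = ?h a i"
        proof (intro allI impI)
          fix i assume i: "i < 2 * n"
          show "?h b (?v i) = ?h a i"
          proof (cases "i < n")
            case True
            then show ?thesis using lo h by blast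
          next
            case False
            define j where "j = i - n"
            have j: "i = n + j" "j < n" using False i by (simp_all add: j_def)
            show ?thesis unfolding j(1) up using h ml[OF j(2)] by blast
          qed
        qed
      qed
      then show ?thesis unfolding T_def sgn by auto
    qed
    then show "(\<Sum>r | r permutes {..<n}. T (p \<circ> shift_perm n r)) = (\<Sum>r | r permutes {..<n}.
     (if \<forall>i<n. b (p i) = a i then sign p else 0) * (if \<forall>i<n. b (r i) = a i then sign r else 0))"
      by (subst sum_permutes_mirror) (rule sum.cong[OF refl], simp)
  qed
  also have "\<dots> = (signed_matches n a b)\<^sup>2"
    unfolding signed_matches_def power2_eq_square sum_product[symmetric] sum_permutations_filter ..
  finally show ?thesis .
qed

text \<open>
  If \<open>a\<close> has distinct entries, then the square is 1 for each of the \<open>n!\<close> rearrangements \<open>b\<close> of \<open>a\<close>, and 0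
  for all other \<open>b\<close>.
\<close>

lemma sum_signed_matches_square:
  fixes g :: "nat \<Rightarrow> 'a::comm_ring_1"
  assumes a: "a \<in> {..<n} \<rightarrow>\<^sub>E {..<M}"
  shows "(\<Sum>b\<in>{..<n} \<rightarrow>\<^sub>E {..<M}. of_int ((signed_matches n a b)\<^sup>2) * g (\<Sum>i<n. b i)) =
    (if inj_on a {..<n} then of_nat (fact n) * g (\<Sum>i<n. a i) else 0)"
proof (cases "inj_on a {..<n}")
  case False
  then obtain i j where ij: "i < n" "j < n" "i \<noteq> j" "a i = a j" by (auto simp: inj_on_def)
  let ?t = "Transposition.transpose i j"
  have t: "?t permutes {..<n}" using ij by (intro permutes_swap_id) auto
  have at: "a (?t k) = a k" for k using ij by (auto simp: Transposition.transpose_def)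
  have tl: "?t k < n" if "k < n" for k using permutes_in_image[OF t, of k] that by simp
  have "signed_matches n a b = 0" for b
    unfolding signed_matches_def
  proof (rule sum_sign_eq_0[OF t])
    fix w assume w: "\<forall>i<n. b (w i) = a i"
    show "\<forall>i<n. b ((w \<circ> ?t) i) = a i"
    proof (intro allI impI)
      fix i assume "i < n"
      then have "b (w (?t i)) = a (?t i)" using w tl by blast
      then show "b ((w \<circ> ?t) i) = a i" by (simp only: o_apply at)
    qed
  qed (use ij in \<open>simp_all add: sign_swap_id\<close>)
  then show ?thesis using False by simp
next
  case inj: True
  define E where "E = {..<n} \<rightarrow>\<^sub>E {..<M}"
  have fE: "finite E" unfolding E_def by (intro finite_PiE) auto
  have sq: "of_int ((signed_matches n a b)\<^sup>2) * x = (\<Sum>p | p permutes {..<n} \<and> (\<forall>i<n. b (p i) = a i). x)" for b and x :: 'a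
  proof (cases "{p. p permutes {..<n} \<and> (\<forall>i<n. b (p i) = a i)} = {}")
    case False
    then obtain p where p: "p permutes {..<n}" "\<And>i. i < n \<Longrightarrow> b (p i) = a i" by blast
    have "q = p" if q: "q permutes {..<n}" "\<And>i. i < n \<Longrightarrow> b (q i) = a i" for q
    proof
      fix i show "q i = p i"
      proof (cases "i < n")
        case True
        have "q i < n" using permutes_in_image[OF q(1), of i] True by simp
        then have "q i \<in> p ` {..<n}" unfolding permutes_image[OF p(1)] by simp
        then obtain j where j: "j < n" "p j = q i" by (elim imageE) simp
        then have "a j = a i" using p(2)[OF j(1)] q(2)[OF True] by simp
        then have "j = i" by (rule inj_onD[OF inj]) (use j(1) True in simp_all)
        then show ?thesis using j by simp
      next
        case False
        then show ?thesis using permutes_not_in[OF p(1), of i] permutes_not_in[OF q(1), of i] by simp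
      qed
    qed
    then have "{p. p permutes {..<n} \<and> (\<forall>i<n. b (p i) = a i)} = {p}" using p by blast
    then show ?thesis unfolding signed_matches_def by (simp add: power2_eq_square)
  next
    case True
    show ?thesis unfolding signed_matches_def True by simp
  qed
  have "(\<Sum>b\<in>E. of_int ((signed_matches n a b)\<^sup>2) * g (\<Sum>i<n. b i)) =
     (\<Sum>b\<in>E. \<Sum>p | p permutes {..<n}. if \<forall>i<n. b (p i) = a i then g (\<Sum>i<n. b i) else 0)"
    unfolding sq sum_permutations_filter ..
  also have "\<dots> = (\<Sum>p | p permutes {..<n}. \<Sum>b\<in>E. if \<forall>i<n. b (p i) = a i then g (\<Sum>i<n. b i) else 0)"
    by (rule sum.swap)
  also have "\<dots> = (\<Sum>p | p permutes {..<n}. g (\<Sum>i<n. a i))"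
  proof (rule sum.cong[OF refl])
    fix p assume "p \<in> {p. p permutes {..<n}}"
    then have p: "p permutes {..<n}" by simp
    have bp: "bij p" using p by (rule permutes_bij)
    define c where "c = (\<lambda>i\<in>{..<n}. a (pinv p i))"
    have il: "pinv p i < n" if "i < n" for i using permutes_in_image[OF permutes_inv[OF p], of i] that by simp
    have pl: "p i < n" if "i < n" for i using permutes_in_image[OF p, of i] that by simp
    have cE: "c \<in> E" using a il by (auto simp: c_def E_def)
    have cp: "c (p i) = a i" if "i < n" for i using pl[OF that] bij_pinv[OF bp] by (simp add: c_def)
    have uniq: "b = c" if b: "b \<in> E" "\<forall>i<n. b (p i) = a i" for b
    proof (rule PiE_ext[of b "{..<n}" "\<lambda>_. {..<M}" c])
      fix i assume "i \<in> {..<n}"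
      then have i: "i < n" by simp
      have "b i = b (p (pinv p i))" using bij_pinv[OF bp] by simp
      also have "\<dots> = a (pinv p i)" using b(2) il[OF i] by blast
      finally show "b i = c i" using i by (simp add: c_def)
    qed (use b cE in \<open>simp_all add: E_def\<close>)
    have "(\<Sum>b\<in>E. if \<forall>i<n. b (p i) = a i then g (\<Sum>i<n. b i) else 0) =
      (\<Sum>b\<in>E. if b = c then g (\<Sum>i<n. c i) else 0)"
    proof (rule sum.cong[OF refl])
      fix b assume bE: "b \<in> E"
      have "(\<forall>i<n. b (p i) = a i) \<longleftrightarrow> b = c" using uniq[OF bE] cp by blast
      then show "(if \<forall>i<n. b (p i) = a i then g (\<Sum>i<n. b i) else 0) = (if b = c then g (\<Sum>i<n. c i) else 0)"
        by (cases "b = c") (simp_all only: if_True if_False)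
    qed
    also have "\<dots> = g (\<Sum>i<n. c i)" using fE cE by simp
    also have "(\<Sum>i<n. c i) = (\<Sum>i<n. c (p i))" using sum.permute[OF p, of c] by (simp add: o_def)
    also have "\<dots> = (\<Sum>i<n. a i)" by (rule sum.cong) (simp_all add: cp)
    finally show "(\<Sum>b\<in>E. if \<forall>i<n. b (p i) = a i then g (\<Sum>i<n. b i) else 0) = g (\<Sum>i<n. a i)" .
  qed
  also have "\<dots> = of_nat (fact n) * g (\<Sum>i<n. a i)" by (simp add: card_permutations)
  finally show ?thesis using inj by (simp add: E_def)
qed

section \<open>The four-block constant term\<close>

lemma cmon_split: "t = s + n \<Longrightarrow> cmon s (2 * n) c = cmon s n c * cmon t n c"
  unfolding mult_2 mon_split by (simp only: add.assoc)

lemma dmon_split: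
  assumes "t = s + n"
  shows "dmon s (2 * n) = cmon s n (int n) * (dmon s n * dmon t n)"
proof -
  have "dmon s (2 * n) = mon n (\<lambda>i. s + i) (\<lambda>i. int (n + n - 1 - i)) * mon n (\<lambda>i. s + (n + i)) (\<lambda>i. int (n + n - 1 - (n + i)))"
    unfolding mult_2 mon_split ..
  also have "mon n (\<lambda>i. s + i) (\<lambda>i. int (n + n - 1 - i)) = mon n (\<lambda>i. s + i) (\<lambda>i. int n + int (n - 1 - i))"
    by (rule mon_cong) auto
  also have "\<dots> = cmon s n (int n) * dmon s n" by (rule mon_affine)
  also have "mon n (\<lambda>i. s + (n + i)) (\<lambda>i. int (n + n - 1 - (n + i))) = dmon t n"
    unfolding assms by (rule mon_cong) auto
  finally show ?thesis by (simp only: mult.assoc)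
qed

text \<open>
  The blocks \<open>A\<close>, \<open>B\<close>, \<open>C\<close>, \<open>D\<close> start at \<open>0\<close>, \<open>n\<close>, \<open>2 * n\<close>, \<open>3 * n\<close>, and they form the groups \<open>X\<close> of \<open>A\<close>
  and \<open>B\<close>, and \<open>Y\<close> of \<open>C\<close> and \<open>D\<close>. The factor \<open>x\<^sup>\<delta>\<close> of a group is, up to a monomial, the product
  of those of its two blocks, and these reduce the pairs \<open>A\<close>, \<open>B\<close> and \<open>C\<close>, \<open>D\<close> to one
  matching each. The inverse alternants of \<open>X\<close> and \<open>Y\<close> expand the pair \<open>X\<close>, \<open>Y\<close> into the sum over all
  matchings.
\<close>

lemma four_block_ct:
  fixes n m :: nat
  defines "G_XY \<equiv> root_series ({0..<0 + 2 * n} \<times> {2 * n..<2 * n + 2 * n})"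
    and "G_AB \<equiv> root_series ({0..<0 + n} \<times> {n..<n + n})"
    and "G_CD \<equiv> root_series ({2 * n..<2 * n + n} \<times> {3 * n..<3 * n + n})"
  assumes n: "0 < n"
  shows "fps_X ^ ((\<Sum>i<2 * n. i) + 2 * (\<Sum>i<n. i)) * ct (
      fps_const (cmon 0 (2 * n) (- int m)) * fps_const (cmon (2 * n) (2 * n) (int m)) *
      (fps_const (dmon 0 (2 * n)) * fps_const (dmon (2 * n) (2 * n))) *
      (fps_const (block_ialt 0 (2 * n)) * fps_const (block_ialt (2 * n) (2 * n))) *
      (G_AB * G_CD * G_XY)) =
    fps_X ^ (n * (m + n - 1 + (m + n))) * subset_series 2 n (m + n)"
proof -
  define T where "T = (\<Sum>i<n. i)"
  define T2 where "T2 = (\<Sum>i<2 * n. i)"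
  define s where "s = m + n - 1"
  define t where "t = m + n"
  define c where "c a x = fps_const (cmon (a * n) n x)" for a x
  define dA where "dA = fps_const (dmon 0 n)"
  define dB where "dB = fps_const (dmon n n)"
  define dC where "dC = fps_const (dmon (2 * n) n)"
  define dD where "dD = fps_const (dmon (3 * n) n)"
  define iX where "iX = fps_const (block_ialt 0 (2 * n))"
  define iY where "iY = fps_const (block_ialt (2 * n) (2 * n))"
  define VA where "VA = fps_const (vandermonde n (\<lambda>i. var (0 + mirror n i)))"
  define VC where "VC = fps_const (vandermonde n (\<lambda>i. var (2 * n + mirror n i)))"
  define VX where "VX = fps_const (vandermonde (2 * n) (\<lambda>i. var (0 + id i)))"
  define VY where "VY = fps_const (vandermonde (2 * n) (\<lambda>i. ivar (2 * n + mirror (2 * n) i)))"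
  define PAB where "PAB = (\<Prod>i<n. geo (var (0 + mirror n i) * ivar (n + i)))"
  define PCD where "PCD = (\<Prod>i<n. geo (var (2 * n + mirror n i) * ivar (3 * n + i)))"
  define PXY where "PXY v = (\<Prod>i<2 * n. geo (var (0 + id i) * ivar (2 * n + mirror (2 * n) (v i))))" for v
  define W where "W = ct (fps_const (cmon 0 (2 * n) (- int m)) * fps_const (cmon (2 * n) (2 * n) (int m)) *
      (fps_const (dmon 0 (2 * n)) * fps_const (dmon (2 * n) (2 * n))) * (iX * iY) * (G_AB * G_CD * G_XY))"
  define E where "E = {..<n} \<rightarrow>\<^sub>E {..<Suc s}"
  have cc: "c a x * c a y = c a (x + y)" for a x y
    unfolding c_def fps_const_mult cmon_mult ..
  have c2: "fps_const (cmon 0 (2 * n) x) = c 0 x * c 1 x" "fps_const (cmon (2 * n) (2 * n) x) = c 2 x * c 3 x" for x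
  proof -
    have "cmon 0 (2 * n) x = cmon 0 n x * cmon n n x" "cmon (2 * n) (2 * n) x = cmon (2 * n) n x * cmon (3 * n) n x"
      by (rule cmon_split, simp)+
    then show "fps_const (cmon 0 (2 * n) x) = c 0 x * c 1 x" "fps_const (cmon (2 * n) (2 * n) x) = c 2 x * c 3 x"
      unfolding c_def mult_0 mult_1 fps_const_mult by (simp_all only:)
  qed
  have d2: "fps_const (dmon 0 (2 * n)) = c 0 (int n) * (dA * dB)" "fps_const (dmon (2 * n) (2 * n)) = c 2 (int n) * (dC * dD)"
  proof -
    have "dmon 0 (2 * n) = cmon 0 n (int n) * (dmon 0 n * dmon n n)"
      "dmon (2 * n) (2 * n) = cmon (2 * n) n (int n) * (dmon (2 * n) n * dmon (3 * n) n)"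
      by (rule dmon_split, simp)+
    then show "fps_const (dmon 0 (2 * n)) = c 0 (int n) * (dA * dB)" "fps_const (dmon (2 * n) (2 * n)) = c 2 (int n) * (dC * dD)"
      unfolding c_def dA_def dB_def dC_def dD_def mult_0 fps_const_mult by (simp_all only:)
  qed
  define cs where "cs = c 0 (- int m + int n) * (c 1 (- int m) * (c 2 (int m + int n) * c 3 (int m)))"
  have W: "W = ct (cs * (dA * dB * dC * dD) * (iX * iY) * (G_AB * G_CD * G_XY))"
    unfolding W_def c2 d2 cs_def cc[symmetric] by (simp only: mult_ac)
  have anti: "block_antisym 0 n iX" "block_antisym n n iX" "block_antisym (2 * n) n iY" "block_antisym (3 * n) n iY"
    unfolding iX_def iY_def by (rule block_antisym_ialt; simp)+
  have sym_i: "block_sym 0 n iY" "block_sym n n iY" "block_sym (2 * n) n iX" "block_sym (3 * n) n iX"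
    unfolding iX_def iY_def by (rule block_sym_ialt; simp)+
  have sym_c: "block_sym (b * n) n (c a x)" for a b x
  proof (cases "a = b")
    case True
    then show ?thesis unfolding c_def by (simp only: block_sym_mon_const)
  next
    case False
    then have "apart (b * n) n (a * n) n"
    proof (cases "a < b")
      case True
      then have "Suc a * n \<le> b * n" by (intro mult_le_mono1) simp
      then show ?thesis by simp
    next
      case False
      with \<open>a \<noteq> b\<close> have "Suc b * n \<le> a * n" by (intro mult_le_mono1) simp
      then show ?thesis by simp
    qed
    then show ?thesis unfolding c_def by (rule block_sym_mon_apart)
  qed
  have sym_cs: "block_sym 0 n cs" "block_sym n n cs" "block_sym (2 * n) n cs" "block_sym (3 * n) n cs"
    using sym_c[of 0] sym_c[of 1] sym_c[of 2] sym_c[of 3] unfolding cs_def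
    by (simp_all add: block_sym_mult)
  have sym_d: "block_sym 0 n dB" "block_sym 0 n dC" "block_sym 0 n dD" "block_sym n n dC" "block_sym n n dD" "block_sym (2 * n) n dD"
    unfolding dB_def dC_def dD_def by (rule block_sym_mon_apart; simp)+
  have sym_G: "block_sym 0 n G_AB" "block_sym 0 n G_CD" "block_sym 0 n G_XY" "block_sym n n G_CD" "block_sym n n G_XY"
    "block_sym (2 * n) n G_CD" "block_sym (2 * n) n G_XY" "block_sym (3 * n) n G_XY"
    unfolding G_AB_def G_CD_def G_XY_def by (rule block_sym_root_series; simp)+
  have PAB_lt: "mirror n i < n \<and> i < n" if "i \<in> {..<n}" for i using that by simp
  have sym_P: "block_sym (2 * n) n PAB" "block_sym (3 * n) n PAB"
    unfolding PAB_def by (intro block_sym_prod block_sym_geo; drule PAB_lt; linarith)+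
  have "of_nat (fact n) * W = of_nat (fact n) * ct ((iX * (cs * dB * dC * dD * iY * G_AB * G_CD * G_XY)) * fps_const (dmon 0 n))"
    unfolding W dA_def by (simp only: mult_ac)
  also have "\<dots> = ct ((iX * (cs * dB * dC * dD * iY * G_AB * G_CD * G_XY)) * fps_const (block_alt 0 n))"
    by (rule ct_antisymmetrize) (intro block_antisym_mult_sym block_sym_mult anti sym_cs sym_d sym_i sym_G)
  also have "\<dots> = ct ((iX * (cs * dC * dD * iY * G_CD * G_XY)) * (VA * dB) * G_AB)"
    unfolding alt_sum_decreasing VA_def by (simp only: mult_ac)
  finally have "fps_X ^ T * (of_nat (fact n) * W) =
      fps_X ^ T * ct ((iX * (cs * dC * dD * iY * G_CD * G_XY)) * (VA * dB) * G_AB)" by simp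
  also have "\<dots> = ct ((iX * (cs * dC * dD * iY * G_CD * G_XY)) * c 1 (int (n - 1)) * PAB)"
    unfolding VA_def dB_def PAB_def G_AB_def T_def fps_const_mult c_def mult_1
    by (rule ct_block_cauchy[OF _ mirror_permutes])
       (intro block_antisym_mult_sym block_sym_mult anti sym_cs sym_d sym_i sym_G, simp)
  finally have "of_nat (fact n) * (fps_X ^ T * (of_nat (fact n) * W)) = of_nat (fact n) *
      ct ((iY * (cs * c 1 (int (n - 1)) * dD * iX * G_CD * G_XY * PAB)) * fps_const (dmon (2 * n) n))"
    unfolding dC_def by (simp only: mult_ac)
  also have "\<dots> = ct ((iY * (cs * c 1 (int (n - 1)) * dD * iX * G_CD * G_XY * PAB)) * fps_const (block_alt (2 * n) n))"
    by (rule ct_antisymmetrize)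
       (intro block_antisym_mult_sym block_sym_mult anti sym_cs sym_c sym_d sym_i sym_G sym_P)
  also have "\<dots> = ct ((iY * (cs * c 1 (int (n - 1)) * iX * G_XY * PAB)) * (VC * dD) * G_CD)"
    unfolding alt_sum_decreasing VC_def by (simp only: mult_ac)
  finally have "fps_X ^ T * (of_nat (fact n) * (fps_X ^ T * (of_nat (fact n) * W))) =
      fps_X ^ T * ct ((iY * (cs * c 1 (int (n - 1)) * iX * G_XY * PAB)) * (VC * dD) * G_CD)" by simp
  also have "\<dots> = ct ((iY * (cs * c 1 (int (n - 1)) * iX * G_XY * PAB)) * c 3 (int (n - 1)) * PCD)"
    unfolding VC_def dD_def PCD_def G_CD_def T_def fps_const_mult c_def[of 3]
    by (rule ct_block_cauchy[OF _ mirror_permutes])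
       (intro block_antisym_mult_sym block_sym_mult anti sym_cs sym_c sym_d sym_i sym_G sym_P, simp)
  also have "\<dots> = ct ((c 0 (- int s) * (c 1 (- int t) * (c 2 (int t) * c 3 (int s))) * PAB * PCD) * (VX * VY * G_XY))"
  proof -
    have iX: "iX = c 0 (- int (2 * n - 1)) * c 1 (- int (2 * n - 1)) * VX"
      unfolding iX_def VX_def c2[symmetric] block_ialt_inverse id_apply by (simp only: fps_const_mult)
    have iY: "iY = VY" unfolding iY_def VY_def alt_sum_decreasing ..
    have e0: "c 0 (- int m + int n) * c 0 (- int (2 * n - 1)) = c 0 (- int s)"
      unfolding cc s_def using n by (intro arg_cong[where f = "c 0"]) linarith
    have e1: "c 1 (- int m) * c 1 (int (n - 1)) * c 1 (- int (2 * n - 1)) = c 1 (- int t)"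
      unfolding cc t_def using n by (intro arg_cong[where f = "c 1"]) linarith
    have e2: "c 2 (int m + int n) = c 2 (int t)" unfolding t_def by simp
    have e3: "c 3 (int m) * c 3 (int (n - 1)) = c 3 (int s)"
      unfolding cc s_def using n by (intro arg_cong[where f = "c 3"]) linarith
    have "(iY * (cs * c 1 (int (n - 1)) * iX * G_XY * PAB)) * c 3 (int (n - 1)) * PCD =
      ((c 0 (- int m + int n) * c 0 (- int (2 * n - 1))) * ((c 1 (- int m) * c 1 (int (n - 1)) * c 1 (- int (2 * n - 1))) *
        (c 2 (int m + int n) * (c 3 (int m) * c 3 (int (n - 1))))) * PAB * PCD) * (VX * VY * G_XY)"
      unfolding cs_def iX iY by (simp only: mult_ac)
    then show ?thesis unfolding e0 e1 e2 e3 by (rule arg_cong)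
  qed
  finally have e5: "fps_X ^ T * (of_nat (fact n) * (fps_X ^ T * (of_nat (fact n) * W))) =
      ct ((c 0 (- int s) * (c 1 (- int t) * (c 2 (int t) * c 3 (int s))) * PAB * PCD) * (VX * VY * G_XY))" .
  have "fps_X ^ T2 * (fps_X ^ T * (of_nat (fact n) * (fps_X ^ T * (of_nat (fact n) * W)))) =
      ct ((c 0 (- int s) * (c 1 (- int t) * (c 2 (int t) * c 3 (int s))) * PAB * PCD) * (fps_X ^ T2 * (VX * VY) * G_XY))"
    unfolding e5 ct_X_power_mult[symmetric] by (simp only: mult_ac)
  also have "fps_X ^ T2 * (VX * VY) * G_XY = (\<Sum>v | v permutes {..<2 * n}. of_int (sign v) * PXY v)"
    unfolding VX_def VY_def G_XY_def T2_def PXY_def fps_const_mult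
    by (rule block_cauchy[OF permutes_id mirror_permutes])
  also have "ct ((c 0 (- int s) * (c 1 (- int t) * (c 2 (int t) * c 3 (int s))) * PAB * PCD) * (\<Sum>v | v permutes {..<2 * n}. of_int (sign v) * PXY v)) =
     (\<Sum>v | v permutes {..<2 * n}. of_int (sign v) * ct (c 0 (- int s) * (c 1 (- int t) * (c 2 (int t) * c 3 (int s))) * PAB * PCD * PXY v))"
    unfolding sum_distrib_left ct_sum mult.left_commute[of _ "of_int _"] ct_of_int_mult ..
  also have "\<dots> = (\<Sum>v | v permutes {..<2 * n}. of_int (sign v) *
     (\<Sum>(a, b) | (a, b) \<in> E \<times> E \<and> (\<forall>i<2 * n. fold_map n s t b (v i) = fold_map n s t a i).
      fps_X ^ (n * (s + t) + (\<Sum>i<n. a i) + (\<Sum>i<n. b i))))"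
  proof (intro sum.cong refl arg_cong2[where f = "(*)"])
    fix v assume "v \<in> {v. v permutes {..<2 * n}}"
    then have v: "v permutes {..<2 * n}" by simp
    have cst: "c 0 (- int s) * (c 1 (- int t) * (c 2 (int t) * c 3 (int s))) =
      fps_const (cmon 0 n (- int s) * (cmon n n (- int t) * (cmon (2 * n) n (int t) * cmon (3 * n) n (int s))))"
      unfolding c_def mult_0 mult_1 by (simp only: fps_const_mult)
    have AB: "PAB = (\<Prod>i<n. geo (var i * ivar (n + mirror n i)))"
      using prod_mirror[of "\<lambda>i. geo (var i * ivar (n + mirror n i))" n] by (simp add: PAB_def)
    have CD: "PCD = (\<Prod>i<n. geo (var (2 * n + i) * ivar (3 * n + mirror n i)))"
      using prod_mirror[of "\<lambda>i. geo (var (2 * n + i) * ivar (3 * n + mirror n i))" n] by (simp add: PCD_def)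
    have XY: "PXY v = (\<Prod>i<2 * n. geo (var i * ivar (2 * n + mirror (2 * n) (v i))))"
      by (simp add: PXY_def)
    have re: "c 0 (- int s) * (c 1 (- int t) * (c 2 (int t) * c 3 (int s))) * PAB * PCD * PXY v =
      c 0 (- int s) * (c 1 (- int t) * (c 2 (int t) * c 3 (int s))) * PXY v * PAB * PCD"
      by (simp only: mult_ac)
    show "ct (c 0 (- int s) * (c 1 (- int t) * (c 2 (int t) * c 3 (int s))) * PAB * PCD * PXY v) =
      (\<Sum>(a, b) | (a, b) \<in> E \<times> E \<and> (\<forall>i<2 * n. fold_map n s t b (v i) = fold_map n s t a i).
      fps_X ^ (n * (s + t) + (\<Sum>i<n. a i) + (\<Sum>i<n. b i)))"
      unfolding re unfolding cst AB CD XY E_def by (rule four_block_flows[OF v])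
  qed
  also have "\<dots> = (\<Sum>a\<in>E. \<Sum>b\<in>E. of_int ((signed_matches n a b)\<^sup>2) * fps_X ^ (n * (s + t) + (\<Sum>i<n. a i) + (\<Sum>i<n. b i)))"
  proof -
    have fE: "finite (E \<times> E)" unfolding E_def by (intro finite_cartesian_product finite_PiE) auto
    define x :: "(nat \<Rightarrow> nat) \<times> (nat \<Rightarrow> nat) \<Rightarrow> int fps"
      where "x = (\<lambda>(a, b). fps_X ^ (n * (s + t) + (\<Sum>i<n. a i) + (\<Sum>i<n. b i)))"
    define Q where "Q v z \<longleftrightarrow> (\<forall>i<2 * n. fold_map n s t (snd z) (v i) = fold_map n s t (fst z) i)" for v z
    have set: "{(a, b). (a, b) \<in> E \<times> E \<and> (\<forall>i<2 * n. fold_map n s t b (v i) = fold_map n s t a i)} = {z \<in> E \<times> E. Q v z}" for v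
      unfolding Q_def case_prod_unfold prod.collapse ..
    have "(\<Sum>v | v permutes {..<2 * n}. of_int (sign v) *
     (\<Sum>(a, b) | (a, b) \<in> E \<times> E \<and> (\<forall>i<2 * n. fold_map n s t b (v i) = fold_map n s t a i).
      fps_X ^ (n * (s + t) + (\<Sum>i<n. a i) + (\<Sum>i<n. b i)))) =
      (\<Sum>v | v permutes {..<2 * n}. of_int (sign v) * (\<Sum>z | z \<in> E \<times> E \<and> Q v z. x z))"
      unfolding set x_def ..
    also have "\<dots> = (\<Sum>v | v permutes {..<2 * n}. \<Sum>z\<in>E \<times> E. if Q v z then of_int (sign v) * x z else 0)"
    proof (rule sum.cong[OF refl])
      fix v
      show "of_int (sign v) * (\<Sum>z | z \<in> E \<times> E \<and> Q v z. x z) =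
          (\<Sum>z\<in>E \<times> E. if Q v z then of_int (sign v) * x z else 0)"
        unfolding sum_distrib_left by (rule sum.inter_filter[OF fE])
    qed
    also have "\<dots> = (\<Sum>z\<in>E \<times> E. \<Sum>v | v permutes {..<2 * n}. if Q v z then of_int (sign v) * x z else 0)"
      by (rule sum.swap)
    also have "\<dots> = (\<Sum>z\<in>E \<times> E. of_int ((signed_matches n (fst z) (snd z))\<^sup>2) * x z)"
    proof (rule sum.cong[OF refl])
      fix z assume "z \<in> E \<times> E"
      then have z: "fst z \<in> {..<n} \<rightarrow>\<^sub>E {..<Suc s}" "snd z \<in> {..<n} \<rightarrow>\<^sub>E {..<Suc s}" unfolding E_def mem_Times_iff by blast+
      have st: "s < t" using n by (simp add: s_def t_def)
      have "(signed_matches n (fst z) (snd z))\<^sup>2 = (\<Sum>v | v permutes {..<2 * n} \<and> Q v z. sign v)"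
        using signed_matches_fold[OF z st] unfolding Q_def by (rule sym)
      then have "of_int ((signed_matches n (fst z) (snd z))\<^sup>2) * x z =
          (\<Sum>v | v permutes {..<2 * n} \<and> Q v z. of_int (sign v) * x z)"
        by (simp only: of_int_sum sum_distrib_right)
      then show "(\<Sum>v | v permutes {..<2 * n}. if Q v z then of_int (sign v) * x z else 0) =
        of_int ((signed_matches n (fst z) (snd z))\<^sup>2) * x z"
        unfolding sum_permutations_filter by (rule sym)
    qed
    also have "\<dots> = (\<Sum>a\<in>E. \<Sum>b\<in>E. of_int ((signed_matches n a b)\<^sup>2) * x (a, b))"
      unfolding sum.cartesian_product by (rule sum.cong[OF refl]) (simp only: case_prod_unfold prod.collapse)
    finally show ?thesis unfolding x_def case_prod_conv .
  qed
  also have "\<dots> = (\<Sum>a\<in>E. if inj_on a {..<n} then of_nat (fact n) * fps_X ^ (n * (s + t) + 2 * (\<Sum>i<n. a i)) else 0)"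
  proof (rule sum.cong[OF refl])
    fix a assume a: "a \<in> E"
    have "n * (s + t) + 2 * (\<Sum>i<n. a i) = n * (s + t) + (\<Sum>i<n. a i) + (\<Sum>i<n. a i)" by simp
    then show "(\<Sum>b\<in>E. of_int ((signed_matches n a b)\<^sup>2) * fps_X ^ (n * (s + t) + (\<Sum>i<n. a i) + (\<Sum>i<n. b i))) =
      (if inj_on a {..<n} then of_nat (fact n) * fps_X ^ (n * (s + t) + 2 * (\<Sum>i<n. a i)) else (0 :: int fps))"
      using sum_signed_matches_square[OF a[unfolded E_def],
          where g = "\<lambda>k. fps_X ^ (n * (s + t) + (\<Sum>i<n. a i) + k) :: int fps"]
      unfolding E_def by (simp only:)
  qed
  also have "\<dots> = of_nat (fact n) * (\<Sum>a | a \<in> E \<and> inj_on a {..<n}. fps_X ^ (n * (s + t) + 2 * (\<Sum>i<n. a i)))"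
  proof -
    have "finite E" unfolding E_def by (intro finite_PiE) auto
    then show ?thesis unfolding sum_distrib_left by (rule sum.inter_filter[symmetric])
  qed
  also have "\<dots> = of_nat (fact n) * (of_nat (fact n) * (fps_X ^ (n * (s + t)) * subset_series 2 n (m + n)))"
    unfolding E_def sum_injections[of "\<lambda>k. fps_X ^ (n * (s + t) + 2 * k)" n "Suc s"] subset_series_def
    using n by (simp add: s_def power_add sum_distrib_left)
  finally have "of_nat (fact n) * (of_nat (fact n) * (fps_X ^ (T2 + 2 * T) * W)) =
      of_nat (fact n) * (of_nat (fact n) * (fps_X ^ (n * (s + t)) * subset_series 2 n (m + n)))"
    unfolding mult_2[of T] power_add by (simp only: mult_ac)
  then have "fps_X ^ (T2 + 2 * T) * W = fps_X ^ (n * (s + t)) * subset_series 2 n (m + n)"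
    by simp
  then show ?thesis
    unfolding W_def iX_def iY_def s_def t_def T_def T2_def .
qed

section \<open>Gaussian binomial coefficients\<close>

definition subset_poly :: "nat \<Rightarrow> nat \<Rightarrow> int poly" where
  "subset_poly n M = (\<Sum>S | S \<subseteq> {..<M} \<and> card S = n. monom 1 (\<Sum>S))"

lemma subset_poly_0 [simp]: "subset_poly 0 M = 1"
proof -
  have "{S. S \<subseteq> {..<M} \<and> card S = 0} = {{}}" by (auto dest: finite_subset)
  then show ?thesis by (simp add: subset_poly_def)
qed

lemma subset_poly_eq_0:
  assumes "M < n"
  shows "subset_poly n M = 0"
proof -
  have "card S \<noteq> n" if "S \<subseteq> {..<M}" for S using card_mono[OF _ that] assms by simp
  then show ?thesis unfolding subset_poly_def by (intro sum.neutral) auto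
qed

lemma subset_poly_Suc:
  "subset_poly (Suc n) (Suc M) = subset_poly (Suc n) M + monom 1 M * subset_poly n M"
proof -
  define A where "A = {S. S \<subseteq> {..<M} \<and> card S = Suc n}"
  define B where "B = {S. S \<subseteq> {..<M} \<and> card S = n}"
  have fin: "finite A" "finite B"
    unfolding A_def B_def by (rule finite_subset[of _ "Pow {..<M}"], auto)+
  have Bd: "finite S" "M \<notin> S" "S \<subseteq> {..<M}" "card S = n" if "S \<in> B" for S
    using that finite_subset[of S "{..<M}"] by (auto simp: B_def)
  have inj: "inj_on (insert M) B"
    by (rule inj_onI) (metis Bd(2) Diff_insert_absorb)
  have "{S. S \<subseteq> {..<Suc M} \<and> card S = Suc n} = A \<union> insert M ` B"
  proof (intro equalityI subsetI)
    fix S assume "S \<in> {S. S \<subseteq> {..<Suc M} \<and> card S = Suc n}"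
    then have S: "S \<subseteq> {..<Suc M}" "card S = Suc n" by auto
    have fS: "finite S" using S(1) finite_subset by blast
    show "S \<in> A \<union> insert M ` B"
    proof (cases "M \<in> S")
      case True
      then have "S - {M} \<in> B" using S fS by (auto simp: B_def less_Suc_eq)
      moreover have "S = insert M (S - {M})" using True by blast
      ultimately show ?thesis by blast
    next
      case False
      then show ?thesis using S by (auto simp: A_def less_Suc_eq)
    qed
  next
    fix S assume "S \<in> A \<union> insert M ` B"
    then show "S \<in> {S. S \<subseteq> {..<Suc M} \<and> card S = Suc n}"
    proof
      assume "S \<in> insert M ` B"
      then obtain S' where S': "S' \<in> B" "S = insert M S'" by blast
      show ?thesis using Bd[OF S'(1)] unfolding S'(2) by (auto simp: less_Suc_eq)
    qed (auto simp: A_def)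
  qed
  moreover have "A \<inter> insert M ` B = {}" by (auto simp: A_def)
  ultimately have "subset_poly (Suc n) (Suc M) = subset_poly (Suc n) M + (\<Sum>S\<in>insert M ` B. monom 1 (\<Sum>S))"
    using fin by (simp add: subset_poly_def sum.union_disjoint A_def)
  also have "(\<Sum>S\<in>insert M ` B. monom (1 :: int) (\<Sum>S)) = (\<Sum>S\<in>B. monom 1 M * monom 1 (\<Sum>S))"
    unfolding sum.reindex[OF inj] o_def
    by (rule sum.cong[OF refl]) (simp add: Bd mult_monom)
  finally show ?thesis by (simp add: subset_poly_def B_def sum_distrib_left)
qed

abbreviation gaussian :: "nat \<Rightarrow> nat \<Rightarrow> int poly" where
  "gaussian m n \<equiv> q_multinomial [m, n]"

lemma gaussian_mult: "gaussian m n * (q_poch m * q_poch n) = q_poch (m + n)"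
  using q_multinomial_mult[of "[m, n]"] by simp

lemma gaussian_eqI: "P * (q_poch m * q_poch n) = q_poch (m + n) \<Longrightarrow> gaussian m n = P"
  using gaussian_mult[of m n] q_poch_nonzero[of m] q_poch_nonzero[of n]
  by (metis mult_right_cancel no_zero_divisors)

lemma gaussian_0 [simp]: "gaussian m 0 = 1" "gaussian 0 n = 1"
  by (rule gaussian_eqI; simp)+

lemma gaussian_Suc: "gaussian (Suc m) (Suc n) = gaussian m (Suc n) + monom 1 (Suc m) * gaussian (Suc m) n"
proof (rule gaussian_eqI)
  have "(gaussian m (Suc n) + monom 1 (Suc m) * gaussian (Suc m) n) * (q_poch (Suc m) * q_poch (Suc n)) =
      gaussian m (Suc n) * (q_poch m * q_poch (Suc n)) * (1 - monom 1 (Suc m)) +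
      monom 1 (Suc m) * (gaussian (Suc m) n * (q_poch (Suc m) * q_poch n)) * (1 - monom 1 (Suc n))"
    by (simp add: q_poch_Suc algebra_simps)
  also have "\<dots> = q_poch (Suc (m + n)) * (1 - monom 1 (Suc m) * monom 1 (Suc n))"
    unfolding gaussian_mult by (simp add: algebra_simps)
  also have "\<dots> = q_poch (Suc m + Suc n)"
    by (simp add: q_poch_Suc[of "Suc (m + n)"] mult_monom)
  finally show "(gaussian m (Suc n) + monom 1 (Suc m) * gaussian (Suc m) n) * (q_poch (Suc m) * q_poch (Suc n)) =
      q_poch (Suc m + Suc n)" .
qed

text \<open>
  Both sides satisfy the \<open>q\<close>-Pascal recursion: a subset of \<open>{..<Suc M}\<close> contains \<open>M\<close> or not.
\<close>

lemma subset_poly_eq_gaussian: "subset_poly n (m + n) = monom 1 (\<Sum>i<n. i) * gaussian m n"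
proof (induction "m + n" arbitrary: m n)
  case (Suc M)
  show ?case
  proof (cases n)
    case n: (Suc n')
    show ?thesis
    proof (cases m)
      case 0
      have "subset_poly n' (0 + n') = monom 1 (\<Sum>i<n'. i) * gaussian 0 n'"
        by (rule Suc.hyps(1)) (use Suc.hyps(2) n 0 in simp)
      then show ?thesis by (simp add: n 0 subset_poly_Suc subset_poly_eq_0 mult_monom add.commute)
    next
      case m: (Suc m')
      have "subset_poly n (m' + n) = monom 1 (\<Sum>i<n. i) * gaussian m' n"
        "subset_poly n' (m + n') = monom 1 (\<Sum>i<n'. i) * gaussian m n'"
        by (rule Suc.hyps(1); use Suc.hyps(2) n m in simp)+
      then show ?thesis
        by (simp add: n m subset_poly_Suc gaussian_Suc algebra_simps flip: mult_monom)
           (simp add: mult_monom algebra_simps flip: mult.assoc)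
    qed
  qed simp
qed simp

lemma fps_of_poly_monom_1: "fps_of_poly (monom (1 :: int) k) = fps_X ^ k"
  by (simp add: fps_of_poly_monom)

lemma subst_q_squared_monom: "subst_q_squared (monom c k) = monom c (2 * k)"
  unfolding subst_q_squared_def
  by (induction k) (simp_all add: monom_Suc pcompose_pCons monom_0 mult_monom)

lemma subst_q_squared_sum: "subst_q_squared (\<Sum>i\<in>S. f i) = (\<Sum>i\<in>S. subst_q_squared (f i))"
  unfolding subst_q_squared_def
  by (induction S rule: infinite_finite_induct) (simp_all add: pcompose_add)

lemma subst_q_squared_mult: "subst_q_squared (P * Q) = subst_q_squared P * subst_q_squared Q"
  by (simp add: subst_q_squared_def pcompose_mult)

lemma subst_q_squared_1 [simp]: "subst_q_squared 1 = 1"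
  using subst_q_squared_monom[of 1 0] by (simp add: monom_0 one_pCons)

lemma subset_series_1: "subset_series 1 n (m + n) = fps_X ^ (\<Sum>i<n. i) * fps_of_poly (gaussian m n)"
proof -
  have "subset_series 1 n (m + n) = fps_of_poly (subset_poly n (m + n))"
    by (simp add: subset_series_def subset_poly_def fps_of_poly_sum fps_of_poly_monom_1)
  then show ?thesis by (simp add: subset_poly_eq_gaussian fps_of_poly_mult fps_of_poly_monom_1)
qed

lemma subset_series_2:
  "subset_series 2 n (m + n) = fps_X ^ (2 * (\<Sum>i<n. i)) * fps_of_poly (subst_q_squared (gaussian m n))"
proof -
  have "subset_series 2 n (m + n) = fps_of_poly (subst_q_squared (subset_poly n (m + n)))"
    by (simp add: subset_series_def subset_poly_def subst_q_squared_sum subst_q_squared_monom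
        fps_of_poly_sum fps_of_poly_monom_1)
  then show ?thesis
    by (simp add: subset_poly_eq_gaussian subst_q_squared_mult subst_q_squared_monom fps_of_poly_mult fps_of_poly_monom_1)
qed

lemma coeff_0_mult: "coeff (P * Q) 0 = coeff P 0 * coeff (Q :: int poly) 0"
  by (simp add: coeff_mult)

lemma coeff_0_q_poch: "coeff (q_poch m) 0 = 1"
  by (induction m) (simp_all add: q_poch_Suc coeff_0_mult)

lemma coeff_0_q_multinomial: "coeff (q_multinomial ms) 0 = 1"
proof -
  have "coeff (\<Prod>m\<leftarrow>ms. q_poch m) 0 = 1"
    by (induction ms) (simp_all add: coeff_0_mult coeff_0_q_poch)
  then show ?thesis
    using arg_cong[OF q_multinomial_mult[of ms], of "\<lambda>P. coeff P 0"]
    by (simp add: coeff_0_mult coeff_0_q_poch)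
qed

lemma coeff_0_subst_q_squared: "coeff (subst_q_squared P) 0 = coeff P 0"
  unfolding subst_q_squared_def poly_0_coeff_0[symmetric] by (simp add: poly_pcompose poly_monom)

lemma coeff_mult_nonneg:
  "(\<And>i. 0 \<le> coeff P i) \<Longrightarrow> (\<And>i. 0 \<le> coeff Q i) \<Longrightarrow> 0 \<le> coeff (P * Q :: int poly) i"
  unfolding coeff_mult by (intro sum_nonneg mult_nonneg_nonneg) auto

lemma coeff_gaussian_nonneg: "0 \<le> coeff (gaussian m n) i"
proof -
  have "0 \<le> coeff (subset_poly n (m + n)) (i + (\<Sum>i<n. i))"
    unfolding subset_poly_def coeff_sum by (intro sum_nonneg) simp
  then show ?thesis by (simp add: subset_poly_eq_gaussian coeff_monom_mult)
qed

lemma coeff_subst_q_squared_nonneg: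
  assumes "\<And>i. 0 \<le> coeff P i"
  shows "0 \<le> coeff (subst_q_squared P) i"
proof -
  have "subst_q_squared P = (\<Sum>j\<le>degree P. monom (coeff P j) (2 * j))"
    unfolding subst_q_squared_monom[symmetric] subst_q_squared_sum[symmetric] poly_as_sum_of_monoms ..
  then have "coeff (subst_q_squared P) i = (\<Sum>j\<le>degree P. if 2 * j = i then coeff P j else 0)"
    by (simp add: coeff_sum)
  also have "\<dots> \<ge> 0" by (intro sum_nonneg) (simp add: assms)
  finally show ?thesis .
qed

lemma q_multinomial_Nil: "q_multinomial [] = 1"
  using q_multinomial_mult[of "[]"] by simp

lemma q_multinomial_Cons: "q_multinomial (m # ms) = gaussian m (sum_list ms) * q_multinomial ms"
proof -
  have nz: "(\<Prod>m\<leftarrow>m # ms. q_poch m) \<noteq> 0"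
    using q_poch_nonzero by (auto simp: prod_list_zero_iff)
  have "gaussian m (sum_list ms) * q_multinomial ms * (\<Prod>m\<leftarrow>m # ms. q_poch m) =
     gaussian m (sum_list ms) * (q_poch m * (q_multinomial ms * (\<Prod>m\<leftarrow>ms. q_poch m)))"
    by (simp add: mult_ac)
  also have "\<dots> = q_multinomial (m # ms) * (\<Prod>m\<leftarrow>m # ms. q_poch m)"
    unfolding q_multinomial_mult gaussian_mult by simp
  finally show ?thesis using nz by simp
qed

section \<open>Realizing the Gaussian binomial coefficients\<close>

text \<open>
  The order of vanishing at \<open>q = 0\<close> shows that \<open>a \<le> b\<close>.
\<close>

lemma power_shift_cancel:
  fixes K :: "int fps"
  assumes eq: "fps_X ^ a * K = fps_X ^ b * fps_of_poly P" and P: "coeff P 0 \<noteq> 0"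
  obtains c where "K = fps_X ^ c * fps_of_poly P"
proof -
  have "a \<le> b"
  proof (rule ccontr)
    assume "\<not> a \<le> b"
    then have "(fps_X ^ a * K) $ b = 0" by (simp add: fps_X_power_mult_nth)
    moreover have "(fps_X ^ b * fps_of_poly P) $ b = coeff P 0" by (simp add: fps_X_power_mult_nth)
    ultimately show False using eq P by simp
  qed
  then have "fps_X ^ a * K = fps_X ^ a * (fps_X ^ (b - a) * fps_of_poly P)"
    unfolding eq by (simp flip: mult.assoc power_add)
  then have "K = fps_X ^ (b - a) * fps_of_poly P" by simp
  then show thesis by (rule that)
qed

lemma Phi_single: "Phi [n] = {}"
proof -
  have "\<not> (i < sum_list (take u [n]) \<and> sum_list (take u [n]) \<le> j)" if "j < n" for i j u
    using that by (cases u) auto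
  then have "z \<notin> Phi [n]" for z unfolding Phi_def by (cases z) simp
  then show ?thesis by blast
qed

lemma Phi_pair: "Phi [n, n] = {0..<0 + n} \<times> {n..<n + n}"
  using Phi_append[of "[n]" "[n]"] by (simp add: Phi_single lessThan_atLeast0)

lemma shift_pairs: "(\<lambda>(i, j). (s + i, s + j)) ` ({a..<b} \<times> {c..<d :: nat}) = {s + a..<s + b} \<times> {s + c..<s + d}"
  unfolding image_paired_Times by (simp add: add.commute)

lemma root_series_Phi_triple:
  "root_series (Phi [n, n, n]) = root_series ({0..<0 + n} \<times> {n..<n + n}) *
     root_series ({0..<0 + n} \<times> {2 * n..<2 * n + n}) * root_series ({n..<n + n} \<times> {2 * n..<2 * n + n})"
proof -
  have "Phi [n, n, n] = ({0..<0 + n} \<times> {n..<n + n} \<union> {0..<0 + n} \<times> {2 * n..<2 * n + n}) \<union> {n..<n + n} \<times> {2 * n..<2 * n + n}"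
  proof -
    have "Phi [n, n, n] = {n..<n + n} \<times> {2 * n..<2 * n + n} \<union> {0..<0 + n} \<times> {n..<n + (n + n)}"
      using Phi_append[of "[n]" "[n, n]"]
      by (simp add: Phi_single Phi_pair shift_pairs lessThan_atLeast0 mult_2 add.assoc)
    moreover have "{n..<n + (n + n)} = {n..<n + n} \<union> {2 * n..<2 * n + n}" by auto
    ultimately show ?thesis by blast
  qed
  moreover have "({0..<0 + n} \<times> {n..<n + n} \<union> {0..<0 + n} \<times> {2 * n..<2 * n + n}) \<inter>
      {n..<n + n} \<times> {2 * n..<2 * n + n} = {}" by auto
  moreover have "({0..<0 + n} \<times> {n..<n + n}) \<inter> ({0..<0 + n} \<times> {2 * n..<2 * n + n}) = {}" by auto
  ultimately show ?thesis by (simp add: root_series_Un del: add_0)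
qed

lemma root_series_Phi_quadruple:
  "root_series (Phi [n, n, n, n]) = root_series ({0..<0 + n} \<times> {n..<n + n}) *
     root_series ({2 * n..<2 * n + n} \<times> {3 * n..<3 * n + n}) * root_series ({0..<0 + 2 * n} \<times> {2 * n..<2 * n + 2 * n})"
proof -
  have "Phi [n, n, n, n] = ({0..<0 + n} \<times> {n..<n + n} \<union> {2 * n..<2 * n + n} \<times> {3 * n..<3 * n + n}) \<union>
      {0..<0 + 2 * n} \<times> {2 * n..<2 * n + 2 * n}"
  proof -
    have "Phi [n, n, n, n] = {0..<n} \<times> {n..<n + n} \<union> {n + n..<n + n + n} \<times> {n + n + n..<n + n + (n + n)} \<union>
        {0..<n + n} \<times> {n + n..<n + n + (n + n)}"
      using Phi_append[of "[n, n]" "[n, n]"] by (simp add: Phi_pair shift_pairs lessThan_atLeast0)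
    moreover have "2 * n = n + n" "3 * n = n + n + n" "n + n + n + n = n + n + (n + n)" by simp_all
    ultimately show ?thesis by (simp only: add_0)
  qed
  moreover have "({0..<0 + n} \<times> {n..<n + n} \<union> {2 * n..<2 * n + n} \<times> {3 * n..<3 * n + n}) \<inter>
      {0..<0 + 2 * n} \<times> {2 * n..<2 * n + 2 * n} = {}" by auto
  moreover have "{0..<0 + n} \<times> {n..<n + n} \<inter> {2 * n..<2 * n + n} \<times> {3 * n..<3 * n + n} = {}" by auto
  ultimately show ?thesis by (simp add: root_series_Un del: add_0)
qed

lemma sorted_wrt_ge_replicate: "sorted_wrt (\<ge>) (replicate n (x :: nat))"
  by (induction n) auto

text \<open>
  The difference of \<open>\<lambda>\<close> and \<open>\<mu>\<close> is \<open>k\<close>, \<open>0\<close>, \<open>- k\<close> on the three groups of rows. The partial sums after the first and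
  the second group thus differ by \<open>n * k\<close>, and \<open>c\<close> is chosen so large that the gaps of \<open>\<lambda> + \<delta>\<close> between the
  groups exceed this number. The parts \<open>1\<close> at the end of \<open>\<lambda>\<close> give it the full number of rows.
\<close>

lemma kostka_realizable_gaussian_pos:
  assumes n: "0 < n"
  shows "kostka_realizable (gaussian k n)"
proof -
  define c where "c = n * k + k + 1"
  define xs where "xs = replicate n (2 * c + k) @ replicate n c @ replicate n 1"
  define R where "R = [(2 * c, n), (c, n), (k + 1, n)]"
  define N where "N = 2 * n + n"
  define \<kappa> where "\<kappa> i = int (xs ! i) + int (N - 1 - i)" for i
  define \<nu> where "\<nu> i = int (rects_mu R ! i) + int (N - 1 - i)" for i
  have eta: "rects_eta R = [n, n, n]" by (simp add: rects_eta_def R_def)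
  have mu: "rects_mu R = replicate n (2 * c) @ replicate n c @ replicate n (k + 1)" by (simp add: rects_mu_def R_def)
  have xs: "is_partition xs"
    by (auto simp: is_partition_def xs_def sorted_wrt_append sorted_wrt_ge_replicate c_def)
  have R: "dominant_rects R" using n by (auto simp: dominant_rects_def R_def c_def)
  have len: "length xs = N" "sum_list (rects_eta R) = N" by (simp_all add: xs_def eta N_def)
  have sums: "sum_list xs = sum_list (rects_mu R)"
    by (simp add: xs_def mu sum_list_replicate algebra_simps)
  have nth3: "(replicate n x @ replicate n y @ replicate n z) ! i = x"
    "(replicate n x @ replicate n y @ replicate n z) ! (n + i) = y"
    "(replicate n x @ replicate n y @ replicate n z) ! (2 * n + i) = z" if "i < n" for x y z i :: nat
    using that by (simp_all add: nth_append)
  have \<kappa>1: "\<kappa> i = int (2 * c + k + 2 * n) + int (n - 1 - i)" and \<nu>1: "\<nu> i = int (2 * c + 2 * n) + int (n - 1 - i)" if "i < n" for i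
    using that unfolding \<kappa>_def \<nu>_def mu xs_def N_def nth3[OF that] by (simp_all add: of_nat_diff)
  have \<kappa>2: "\<kappa> (n + i) = int (c + n) + int (n - 1 - i)" and \<nu>2: "\<nu> (n + i) = int (c + n) + int (n - 1 - i)" if "i < n" for i
    using that unfolding \<kappa>_def \<nu>_def mu xs_def N_def nth3[OF that] by (simp_all add: of_nat_diff)
  have \<kappa>3: "\<kappa> (2 * n + i) = 1 + int (n - 1 - i)" and \<nu>3: "\<nu> (2 * n + i) = int (k + 1) + int (n - 1 - i)" if "i < n" for i
    using that unfolding \<kappa>_def \<nu>_def mu xs_def N_def nth3[OF that] by (simp_all add: of_nat_diff)
  have s1: "sum \<kappa> {..<n} = sum \<nu> {..<n} + int (n * k)"
  proof -
    have "sum \<kappa> {..<n} = (\<Sum>i<n. \<nu> i + int k)" by (rule sum.cong) (simp_all add: \<kappa>1 \<nu>1)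
    then show ?thesis by (simp add: sum.distrib)
  qed
  have s2: "sum \<kappa> {..<2 * n} = sum \<nu> {..<2 * n} + int (n * k)"
  proof -
    have "(\<Sum>i<n. \<kappa> (n + i)) = (\<Sum>i<n. \<nu> (n + i))" by (rule sum.cong) (simp_all add: \<kappa>2 \<nu>2)
    then show ?thesis using s1 sum_lessThan_add[of \<kappa> n n] sum_lessThan_add[of \<nu> n n] by (simp only: mult_2)
  qed
  have ck: "n * k < c" by (simp add: c_def)
  have "kostka_rects xs R = weyl_sum N (Phi [n, n, n]) \<kappa> \<nu>"
    unfolding \<kappa>_def[abs_def] \<nu>_def[abs_def] eta[symmetric]
    by (rule kostka_rects_eq_weyl_sum[OF xs len(1) len(2)[symmetric]])
  also have "\<dots> = ct (fps_const (mon N id \<nu> * ((cmon 0 n (- int (2 * c + k + 2 * n)) * block_ialt 0 n) *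
     ((cmon n n (- int (c + n)) * block_ialt n n) * (cmon (2 * n) n (- 1) * block_ialt (2 * n) n)))) * root_series (Phi [n, n, n]))"
    unfolding N_def
  proof (rule weyl_sum_three_groups)
    show "i < j" if "(i, j) \<in> Phi [n, n, n]" for i j using Phi_bounds[OF that] by simp
    show "int (c + n) + int n \<le> int (2 * c + k + 2 * n)" "1 + int n \<le> int (c + n)" using ck by simp_all
    show "sum \<kappa> {..<n} < sum \<nu> {..<n} + (int (2 * c + k + 2 * n) - (int (c + n) + int n) + 1)"
      unfolding s1 using ck by linarith
    show "sum \<kappa> {..<2 * n} < sum \<nu> {..<2 * n} + (int (c + n) - (1 + int n) + 1)"
      unfolding s2 using ck by linarith
  qed (simp_all only: \<kappa>1 \<kappa>2 \<kappa>3)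
  also have "mon N id \<nu> = (cmon 0 n (int (2 * c + 2 * n)) * dmon 0 n) *
      ((cmon n n (int (c + n)) * dmon n n) * (cmon (2 * n) n (int (k + 1)) * dmon (2 * n) n))"
  proof -
    have "mon N id \<nu> = mon (n + n) id \<nu> * mon n (\<lambda>i. 2 * n + i) (\<lambda>i. \<nu> (2 * n + i))"
      unfolding N_def mon_split id_apply mult_2 ..
    also have "mon (n + n) id \<nu> = mon n (\<lambda>i. 0 + i) \<nu> * mon n (\<lambda>i. n + i) (\<lambda>i. \<nu> (n + i))"
      unfolding mon_split by (simp add: id_def)
    also have "mon n (\<lambda>i. 0 + i) \<nu> = cmon 0 n (int (2 * c + 2 * n)) * dmon 0 n"
      unfolding mon_affine[symmetric] by (rule mon_cong[OF refl \<nu>1])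
    also have "mon n (\<lambda>i. n + i) (\<lambda>i. \<nu> (n + i)) = cmon n n (int (c + n)) * dmon n n"
      unfolding mon_affine[symmetric] by (rule mon_cong[OF refl \<nu>2])
    also have "mon n (\<lambda>i. 2 * n + i) (\<lambda>i. \<nu> (2 * n + i)) = cmon (2 * n) n (int (k + 1)) * dmon (2 * n) n"
      unfolding mon_affine[symmetric] by (rule mon_cong[OF refl \<nu>3])
    finally show ?thesis by (simp only: mult.assoc)
  qed
  also have "(cmon 0 n (int (2 * c + 2 * n)) * dmon 0 n) *
      ((cmon n n (int (c + n)) * dmon n n) * (cmon (2 * n) n (int (k + 1)) * dmon (2 * n) n)) *
      ((cmon 0 n (- int (2 * c + k + 2 * n)) * block_ialt 0 n) *
     ((cmon n n (- int (c + n)) * block_ialt n n) * (cmon (2 * n) n (- 1) * block_ialt (2 * n) n))) =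
     cmon 0 n (- int k) * cmon (2 * n) n (int k) * (dmon 0 n * dmon n n * dmon (2 * n) n) *
     (block_ialt 0 n * block_ialt n n * block_ialt (2 * n) n)" (is "?L = ?R")
  proof -
    have e: "cmon 0 n (int (2 * c + 2 * n)) * cmon 0 n (- int (2 * c + k + 2 * n)) = cmon 0 n (- int k)"
      "cmon n n (int (c + n)) * cmon n n (- int (c + n)) = 1"
      "cmon (2 * n) n (int (k + 1)) * cmon (2 * n) n (- 1) = cmon (2 * n) n (int k)"
      unfolding cmon_mult by ((rule mon_cong; simp), simp, (rule mon_cong; simp))
    have "?L = (cmon 0 n (int (2 * c + 2 * n)) * cmon 0 n (- int (2 * c + k + 2 * n))) *
      (cmon n n (int (c + n)) * cmon n n (- int (c + n))) * (cmon (2 * n) n (int (k + 1)) * cmon (2 * n) n (- 1)) *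
      (dmon 0 n * dmon n n * dmon (2 * n) n) * (block_ialt 0 n * block_ialt n n * block_ialt (2 * n) n)"
      by (simp only: mult_ac)
    then show ?thesis unfolding e by (simp only: mult_1_right)
  qed
  finally have K: "kostka_rects xs R = ct (fps_const ?R * root_series (Phi [n, n, n]))" .
  have "fps_X ^ (3 * (\<Sum>i<n. i)) * kostka_rects xs R =
      fps_X ^ (n * (k + n - 1)) * (fps_X ^ (\<Sum>i<n. i) * fps_of_poly (gaussian k n))"
    unfolding K root_series_Phi_triple fps_const_mult[symmetric] three_block_ct[OF n] subset_series_1 ..
  then have "fps_X ^ (3 * (\<Sum>i<n. i)) * kostka_rects xs R =
      fps_X ^ (n * (k + n - 1) + (\<Sum>i<n. i)) * fps_of_poly (gaussian k n)"
    by (simp only: power_add mult.assoc)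
  then obtain T where "kostka_rects xs R = fps_X ^ T * fps_of_poly (gaussian k n)"
    by (rule power_shift_cancel) (simp add: coeff_0_q_multinomial)
  then show ?thesis
    unfolding kostka_realizable_def using xs R len sums by (intro exI conjI) (assumption | simp)+
qed

text \<open>
  The two rectangles of a pair have the same width, so \<open>\<lambda>\<close> and \<open>\<mu>\<close> are constant on the two groups
  of \<open>2 * n\<close> rows, but the roots inside a group between its two rectangles are present. The partial sums after
  the first group differ by \<open>2 * n * m\<close>, which \<open>c\<close> exceeds.
\<close>

lemma kostka_realizable_gaussian_squared_pos:
  assumes n: "0 < n"
  shows "kostka_realizable (subst_q_squared (gaussian m n))"
proof -
  define c where "c = 2 * n * m + m + 1"
  define xs where "xs = replicate (2 * n) (c + m) @ replicate (2 * n) 1"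
  define R where "R = [(c, n), (c, n), (m + 1, n), (m + 1, n)]"
  define N where "N = 2 * n + 2 * n"
  define \<kappa> where "\<kappa> i = int (xs ! i) + int (N - 1 - i)" for i
  define \<nu> where "\<nu> i = int (rects_mu R ! i) + int (N - 1 - i)" for i
  have eta: "rects_eta R = [n, n, n, n]" by (simp add: rects_eta_def R_def)
  have mu: "rects_mu R = replicate (2 * n) c @ replicate (2 * n) (m + 1)"
    by (simp add: rects_mu_def R_def mult_2 replicate_add)
  have xs: "is_partition xs"
    by (auto simp: is_partition_def xs_def sorted_wrt_append sorted_wrt_ge_replicate c_def)
  have R: "dominant_rects R" using n by (auto simp: dominant_rects_def R_def c_def)
  have len: "length xs = N" "sum_list (rects_eta R) = N" by (simp_all add: xs_def eta N_def)
  have sums: "sum_list xs = sum_list (rects_mu R)"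
    by (simp add: xs_def mu sum_list_replicate algebra_simps)
  have nth2: "(replicate (2 * n) x @ replicate (2 * n) y) ! i = x"
    "(replicate (2 * n) x @ replicate (2 * n) y) ! (2 * n + i) = y" if "i < 2 * n" for x y i :: nat
    using that by (simp_all add: nth_append)
  have \<kappa>1: "\<kappa> i = int (c + m + 2 * n) + int (2 * n - 1 - i)" and \<nu>1: "\<nu> i = int (c + 2 * n) + int (2 * n - 1 - i)" if "i < 2 * n" for i
    using that unfolding \<kappa>_def \<nu>_def mu xs_def N_def nth2[OF that] by (simp_all add: of_nat_diff)
  have \<kappa>2: "\<kappa> (2 * n + i) = 1 + int (2 * n - 1 - i)" and \<nu>2: "\<nu> (2 * n + i) = int (m + 1) + int (2 * n - 1 - i)" if "i < 2 * n" for i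
    using that unfolding \<kappa>_def \<nu>_def mu xs_def N_def nth2[OF that] by (simp_all add: of_nat_diff)
  have s1: "sum \<kappa> {..<2 * n} = sum \<nu> {..<2 * n} + int (2 * n * m)"
  proof -
    have "sum \<kappa> {..<2 * n} = (\<Sum>i<2 * n. \<nu> i + int m)" by (rule sum.cong) (simp_all add: \<kappa>1 \<nu>1)
    then show ?thesis by (simp add: sum.distrib)
  qed
  have cm: "2 * n * m < c" by (simp add: c_def)
  have "kostka_rects xs R = weyl_sum N (Phi [n, n, n, n]) \<kappa> \<nu>"
    unfolding \<kappa>_def[abs_def] \<nu>_def[abs_def] eta[symmetric]
    by (rule kostka_rects_eq_weyl_sum[OF xs len(1) len(2)[symmetric]])
  also have "\<dots> = ct (fps_const (mon N id \<nu> * ((cmon 0 (2 * n) (- int (c + m + 2 * n)) * block_ialt 0 (2 * n)) *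
     (cmon (2 * n) (2 * n) (- 1) * block_ialt (2 * n) (2 * n)))) * root_series (Phi [n, n, n, n]))"
    unfolding N_def
  proof (rule weyl_sum_two_groups)
    show "i < j" if "(i, j) \<in> Phi [n, n, n, n]" for i j using Phi_bounds[OF that] by simp
    show "1 + int (2 * n) \<le> int (c + m + 2 * n)" using cm by simp
    show "sum \<kappa> {..<2 * n} < sum \<nu> {..<2 * n} + (int (c + m + 2 * n) - (1 + int (2 * n)) + 1)"
      unfolding s1 using cm by linarith
  qed (simp_all only: \<kappa>1 \<kappa>2)
  also have "mon N id \<nu> = (cmon 0 (2 * n) (int (c + 2 * n)) * dmon 0 (2 * n)) *
      (cmon (2 * n) (2 * n) (int (m + 1)) * dmon (2 * n) (2 * n))"
  proof -
    have "mon N id \<nu> = mon (2 * n) (\<lambda>i. 0 + i) \<nu> * mon (2 * n) (\<lambda>i. 2 * n + i) (\<lambda>i. \<nu> (2 * n + i))"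
      unfolding N_def mon_split by (simp add: id_def)
    also have "mon (2 * n) (\<lambda>i. 0 + i) \<nu> = cmon 0 (2 * n) (int (c + 2 * n)) * dmon 0 (2 * n)"
      unfolding mon_affine[symmetric] by (rule mon_cong[OF refl \<nu>1])
    also have "mon (2 * n) (\<lambda>i. 2 * n + i) (\<lambda>i. \<nu> (2 * n + i)) = cmon (2 * n) (2 * n) (int (m + 1)) * dmon (2 * n) (2 * n)"
      unfolding mon_affine[symmetric] by (rule mon_cong[OF refl \<nu>2])
    finally show ?thesis .
  qed
  also have "(cmon 0 (2 * n) (int (c + 2 * n)) * dmon 0 (2 * n)) *
      (cmon (2 * n) (2 * n) (int (m + 1)) * dmon (2 * n) (2 * n)) *
      ((cmon 0 (2 * n) (- int (c + m + 2 * n)) * block_ialt 0 (2 * n)) *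
     (cmon (2 * n) (2 * n) (- 1) * block_ialt (2 * n) (2 * n))) =
     cmon 0 (2 * n) (- int m) * cmon (2 * n) (2 * n) (int m) * (dmon 0 (2 * n) * dmon (2 * n) (2 * n)) *
     (block_ialt 0 (2 * n) * block_ialt (2 * n) (2 * n))" (is "?L = ?R")
  proof -
    have e: "cmon 0 (2 * n) (int (c + 2 * n)) * cmon 0 (2 * n) (- int (c + m + 2 * n)) = cmon 0 (2 * n) (- int m)"
      "cmon (2 * n) (2 * n) (int (m + 1)) * cmon (2 * n) (2 * n) (- 1) = cmon (2 * n) (2 * n) (int m)"
      unfolding cmon_mult by (rule mon_cong; simp)+
    show ?thesis unfolding e[symmetric] by (simp only: mult_ac)
  qed
  finally have K: "kostka_rects xs R = ct (fps_const ?R * root_series (Phi [n, n, n, n]))" .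
  have "fps_X ^ ((\<Sum>i<2 * n. i) + 2 * (\<Sum>i<n. i)) * kostka_rects xs R =
      fps_X ^ (n * (m + n - 1 + (m + n))) * (fps_X ^ (2 * (\<Sum>i<n. i)) * fps_of_poly (subst_q_squared (gaussian m n)))"
    unfolding K root_series_Phi_quadruple fps_const_mult[symmetric] four_block_ct[OF n] subset_series_2 ..
  then have "fps_X ^ ((\<Sum>i<2 * n. i) + 2 * (\<Sum>i<n. i)) * kostka_rects xs R =
      fps_X ^ (n * (m + n - 1 + (m + n)) + 2 * (\<Sum>i<n. i)) * fps_of_poly (subst_q_squared (gaussian m n))"
    by (simp only: power_add mult.assoc)
  then obtain T where "kostka_rects xs R = fps_X ^ T * fps_of_poly (subst_q_squared (gaussian m n))"
    by (rule power_shift_cancel) (simp add: coeff_0_q_multinomial coeff_0_subst_q_squared)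
  then show ?thesis
    unfolding kostka_realizable_def using xs R len sums by (intro exI conjI) (assumption | simp)+
qed

lemma kostka_realizable_1: "kostka_realizable 1"
  using kostka_realizable_gaussian_pos[of 1 0] by simp

lemma kostka_realizable_gaussian: "kostka_realizable (gaussian m n)"
  by (cases n) (simp_all add: kostka_realizable_1 kostka_realizable_gaussian_pos)

lemma kostka_realizable_gaussian_squared: "kostka_realizable (subst_q_squared (gaussian m n))"
  by (cases n) (simp_all add: kostka_realizable_1 kostka_realizable_gaussian_squared_pos)

section \<open>Multinomial coefficients\<close>

lemma PK_realizableI:
  assumes "kostka_realizable P" "\<And>i. 0 \<le> coeff P i" "coeff P 0 \<noteq> 0"
  shows "P \<in> PK_realizable"
proof -
  obtain xs R T where xs: "is_partition xs" "dominant_rects R" "kostka_rects xs R = fps_X ^ T * fps_of_poly P"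
    using assms(1) unfolding kostka_realizable_def by blast
  have "fps_to_fls (fps_of_poly P) = fls_X_intpow (- int T) * fps_to_fls (kostka_rects xs R)"
    unfolding xs(3) fls_X_intpow_times_conv_shift
  proof (rule fls_eqI)
    fix i
    show "fls_nth (fps_to_fls (fps_of_poly P)) i =
        fls_nth (fls_shift (- (- int T)) (fps_to_fls (fps_X ^ T * fps_of_poly P))) i"
      by (auto simp: fps_X_power_mult_nth nat_add_distrib)
  qed
  then show ?thesis
    unfolding PK_realizable_def using assms(2,3) xs(1,2) by (intro CollectI conjI exI allI) assumption+
qed

theorem mainTheorem5:
  fixes ms :: "nat list"
  shows "q_multinomial ms \<in> PK_realizable
    \<and> subst_q_squared (q_multinomial ms) \<in> PK_realizable"
proof -
  have nonneg: "0 \<le> coeff (q_multinomial ms) i" for i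
  proof (induction ms arbitrary: i)
    case (Cons m ms)
    have "0 \<le> coeff (gaussian m (sum_list ms) * q_multinomial ms) i"
      by (rule coeff_mult_nonneg[OF coeff_gaussian_nonneg Cons])
    then show ?case
      by (simp only: q_multinomial_Cons[of m ms])
  qed (simp add: q_multinomial_Nil)
  have "kostka_realizable (q_multinomial ms)"
  proof (induction ms)
    case (Cons m ms)
    have "kostka_realizable (gaussian m (sum_list ms) * q_multinomial ms)"
      by (rule kostka_realizable_mult[OF kostka_realizable_gaussian Cons])
    then show ?case
      by (simp only: q_multinomial_Cons[of m ms])
  qed (simp add: q_multinomial_Nil kostka_realizable_1)
  moreover have "kostka_realizable (subst_q_squared (q_multinomial ms))"
  proof (induction ms)
    case (Cons m ms)
    have "kostka_realizable (subst_q_squared (gaussian m (sum_list ms)) * subst_q_squared (q_multinomial ms))"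
      by (rule kostka_realizable_mult[OF kostka_realizable_gaussian_squared Cons])
    then show ?case
      by (simp only: q_multinomial_Cons[of m ms] subst_q_squared_mult)
  qed (simp add: q_multinomial_Nil kostka_realizable_1)
  moreover have "coeff (q_multinomial ms) 0 \<noteq> 0" "coeff (subst_q_squared (q_multinomial ms)) 0 \<noteq> 0"
    by (simp_all add: coeff_0_q_multinomial coeff_0_subst_q_squared)
  ultimately show ?thesis
    using PK_realizableI nonneg coeff_subst_q_squared_nonneg[OF nonneg] by blast
qed

end
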